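(* Let $\mathcal{C}$ be a cocomplete category with pullbacks and a terminal object, and such that pullbacks preserve colimits. Let $\tau$ be a subcanonical Grothendieck topology on $\mathcal{C}$, let $G$ be a group object in $\mathcal{C}$, and let $X$ be an object of $\mathcal{C}$ equipped with an action $x\colon G\times X\to X$ of $G$. Then the quotient prestack $[X/G]\colon \mathcal{C}^{\mathrm{op}}\to \mathrm{Cat}$ (formed with respect to $\tau$) is a stack on the site $(\mathcal{C},\tau)$.
   Context: "Pullbacks preserve colimits" means that pulling back along any morphism of $\mathcal{C}$ preserves colimits. A Grothendieck topology is subcanonical if every representable presheaf is a sheaf for it. For $f\colon P\to Y$ and $g\colon Z\to Y$, write $f^*g\colon P\times_Y Z\to P$ and $g^*f\colon P\times_Y Z\to Z$ for the projections of the (chosen) pullback. **Actions.** Let $G$ be a group object of $\mathcal{C}$ with multiplication $m\colon G\times G\to G$ and unit $e\colon T\to G$, with $T$ terminal. An action of $G$ on $X$ is a morphism $x\colon G\times X\to X$ with $x\circ(\mathrm{id}_G\times x)=x\circ(m\times \mathrm{id}_X)$ and $x\circ(e\times \mathrm{id}_X)=\mathrm{pr}_2\colon T\times X\to X$. If $G$ acts on $X$ and $Y$ by $x,y$, a morphism $f\colon X\to Y$ is $G$-equivariant if $f\circ x=y\circ(\mathrm{id}_G\times f)$. Objects for which no action is specified carry the trivial action (second projection). If $G$ acts on $P,Y,Z$ via $p,y,z$ and $f\colon P\to Y$, $g\colon Z\to Y$ are $G$-equivariant, then $P\times_Y Z$ carries the action $\psi\colon G\times(P\times_Y Z)\to P\times_Y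 Z$ determined by $f^*g\circ\psi=p\circ(\mathrm{id}_G\times f^*g)$ and $g^*f\circ\psi=z\circ(\mathrm{id}_G\times g^*f)$. **Principal bundles.** A principal $G$-bundle over $Y$ (in the site $(\mathcal{C},\tau)$) is an object $P$ with an action $p\colon G\times P\to P$ and a $G$-equivariant morphism $\pi_P\colon P\to Y$ ($Y$ with trivial action) that is locally trivial: there is a covering family $\{f_i\colon U_i\to Y\}_{i\in I}$ for $\tau$ such that for every $i$ there is a $G$-equivariant isomorphism $\phi_i\colon P\times_Y U_i\to G\times U_i$ over $U_i$ (i.e. $\mathrm{pr}_2\circ\phi_i=f_i^*\pi_P$), where $P\times_Y U_i$ has the pullback action above ($U_i$, $Y$ with trivial actions) and $G\times U_i$ has the action by multiplication $m$ on the first factor. A morphism of principal $G$-bundles over $Y$ from $\pi_P$ to $\pi_Q$ is a $G$-equivariant morphism $\phi\colon P\to Q$ with $\pi_Q\circ\phi=\pi_P$. **Quotient prestack.** A prestack is a pseudofunctor $\mathcal{C}^{\mathrm{op}}\to\mathrm{Cat}$. For $Y\in\mathcal{C}$, the category $[X/G](Y)$ has as objects the pairs $(P,\alpha)$ with $\pi_P\colon P\to Y$ a principal $G$-bundle over $Y$ and $\alpha\colon P\to X$ a $G$-equivariant morphism; morphisms $(P,\alpha)\to(Q,\beta)$ are the morphisms of principal $G$-bundles $\phi\colon P\to Q$ with $\beta\circ\phi=\alpha$. For $f\colon Z\to Y$, the functor $[X/G](f)$ sends $(P,\alpha)$ to $(P\times_Y Z,\ \alpha\circ\pi_P^*f)$,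 with bundle morphism $f^*\pi_P\colon P\times_Y Z\to Z$ and the pullback action, and sends $\phi\colon(P,\alpha)\to(Q,\beta)$ to the unique morphism $P\times_Y Z\to Q\times_Y Z$ whose composites with $\pi_Q^*f$ and $f^*\pi_Q$ are $\phi\circ\pi_P^*f$ and $f^*\pi_P$ respectively. The coherence isomorphisms are the canonical isomorphisms between pullbacks. **Stacks.** Let $\mathcal{F}\colon\mathcal{C}^{\mathrm{op}}\to\mathrm{Cat}$ be a prestack; write $f^*=\mathcal{F}(f)$, and write restriction $|_{U_i}$ for $f_i^*$. A descent datum for $\mathcal{F}$ on a sieve $S$ on $Y$ assigns to every $f\colon Z\to Y$ in $S$ an object $W_f\in\mathcal{F}(Z)$ and to every composable pair $Z'\xrightarrow{g}Z\xrightarrow{f}Y$ with $f\in S$ an isomorphism $\varphi^{f,g}\colon g^*W_f\to W_{f\circ g}$, such that for all $Z''\xrightarrow{h}Z'\xrightarrow{g}Z\xrightarrow{f}Y$ with $f\in S$ one has $\varphi^{f\circ g,h}\circ h^*\varphi^{f,g}=\varphi^{f,g\circ h}$ modulo the coherence isomorphism $h^*(g^*W_f)\cong(g\circ h)^*W_f$. It is effective if there are $W\in\mathcal{F}(Y)$ and isomorphisms $\psi^f\colon f^*W\to W_f$ for all $f\in S$ such that for all $Z'\xrightarrow{g}Z\xrightarrow{f}Y$ with $f\in S$ one has $\varphi^{f,g}\circ g^*\psi^f=\psi^{f\circ g}$ modulo the coherence isomorphism $g^*(f^*W)\cong(f\circ g)^*W$. The prestack $\mathcal{F}$ is a stack on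 $(\mathcal{C},\tau)$ if: (1) every descent datum for $\mathcal{F}$ on a covering sieve is effective; (2) for every covering family $\{f_i\colon U_i\to U\}_{i\in I}$, objects $x,y\in\mathcal{F}(U)$ and morphisms $\phi_i\colon x|_{U_i}\to y|_{U_i}$ in $\mathcal{F}(U_i)$ with $\phi_i|_{U_{ij}}=\phi_j|_{U_{ij}}$ for all $i,j$ (where $U_{ij}=U_i\times_U U_j$ and coherence isomorphisms are used to identify sources and targets), there is a morphism $\eta\colon x\to y$ with $\eta|_{U_i}=\phi_i$ for all $i$; (3) for every covering family $\{f_i\colon U_i\to U\}_{i\in I}$, objects $x,y\in\mathcal{F}(U)$ and morphisms $\phi,\psi\colon x\to y$ with $\phi|_{U_i}=\psi|_{U_i}$ for all $i$, one has $\phi=\psi$.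
   Formalization: Covering families are indexed by small sets, and every covering sieve is assumed to contain one (automatic when the topology is given by set-indexed covering families); for covering sieves with no small covering family, effective descent can fail. *)

theory Defs
  imports Main
begin

section \<open>Categories and functors\<close>

record ('o, 'a) cat =
  Obj :: "'o set"
  Arr :: "'a set"
  Dom :: "'a \<Rightarrow> 'o"
  Cod :: "'a \<Rightarrow> 'o"
  Ident :: "'o \<Rightarrow> 'a"
  Comp :: "'a \<Rightarrow> 'a \<Rightarrow> 'a" (infixl "\<cdot>\<index>" 70)

definition Hom :: "('o, 'a, 'm) cat_scheme \<Rightarrow> 'o \<Rightarrow> 'o \<Rightarrow> 'a set" where
  "Hom C A B = {f \<in> Arr C. Dom C f = A \<and> Cod C f = B}"

locale category =
  fixes C :: "('o, 'a, 'm) cat_scheme" (structure)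
  assumes Dom_Obj: "f \<in> Arr C \<Longrightarrow> Dom C f \<in> Obj C"
    and Cod_Obj: "f \<in> Arr C \<Longrightarrow> Cod C f \<in> Obj C"
    and Ident_Hom: "A \<in> Obj C \<Longrightarrow> Ident C A \<in> Hom C A A"
    and Comp_Hom: "f \<in> Hom C A B \<Longrightarrow> g \<in> Hom C B D \<Longrightarrow> g \<cdot> f \<in> Hom C A D"
    and Comp_assoc: "f \<in> Hom C A B \<Longrightarrow> g \<in> Hom C B D \<Longrightarrow> h \<in> Hom C D E
      \<Longrightarrow> h \<cdot> (g \<cdot> f) = (h \<cdot> g) \<cdot> f"
    and Ident_left: "f \<in> Hom C A B \<Longrightarrow> Ident C B \<cdot> f = f"
    and Ident_right: "f \<in> Hom C A B \<Longrightarrow> f \<cdot> Ident C A = f"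

definition inverse_arrows :: "('o, 'a, 'm) cat_scheme \<Rightarrow> 'a \<Rightarrow> 'a \<Rightarrow> bool" where
  "inverse_arrows C f g \<longleftrightarrow> f \<in> Arr C \<and> g \<in> Hom C (Cod C f) (Dom C f)
    \<and> g \<cdot>\<^bsub>C\<^esub> f = Ident C (Dom C f) \<and> f \<cdot>\<^bsub>C\<^esub> g = Ident C (Cod C f)"

definition iso_arrow :: "('o, 'a, 'm) cat_scheme \<Rightarrow> 'a \<Rightarrow> bool" where
  "iso_arrow C f \<longleftrightarrow> (\<exists>g. inverse_arrows C f g)"

definition inv_arrow :: "('o, 'a, 'm) cat_scheme \<Rightarrow> 'a \<Rightarrow> 'a" where
  "inv_arrow C f = (THE g. inverse_arrows C f g)"

record ('o, 'a, 'p, 'b) cfunctor =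
  omap :: "'o \<Rightarrow> 'p"
  amap :: "'a \<Rightarrow> 'b"

definition is_functor ::
  "('o, 'a, 'm) cat_scheme \<Rightarrow> ('p, 'b, 'n) cat_scheme \<Rightarrow> ('o, 'a, 'p, 'b) cfunctor \<Rightarrow> bool" where
  "is_functor A B F \<longleftrightarrow>
     (\<forall>X \<in> Obj A. omap F X \<in> Obj B) \<and>
     (\<forall>f \<in> Arr A. amap F f \<in> Hom B (omap F (Dom A f)) (omap F (Cod A f))) \<and>
     (\<forall>X \<in> Obj A. amap F (Ident A X) = Ident B (omap F X)) \<and>
     (\<forall>f \<in> Arr A. \<forall>g \<in> Arr A. Cod A f = Dom A g \<longrightarrow>
        amap F (g \<cdot>\<^bsub>A\<^esub> f) = amap F g \<cdot>\<^bsub>B\<^esub> amap F f)"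

definition comp_functor ::
  "('p, 'b, 'q, 'c) cfunctor \<Rightarrow> ('o, 'a, 'p, 'b) cfunctor \<Rightarrow> ('o, 'a, 'q, 'c) cfunctor" where
  "comp_functor F D = \<lparr>omap = omap F \<circ> omap D, amap = amap F \<circ> amap D\<rparr>"


section \<open>Small colimits\<close>

text \<open>Smallness is relative to an infinite regular cardinal \<open>\<kappa>\<close>, represented by a cardinal order on
  some type: a set is small if it has fewer than \<open>\<kappa>\<close> elements. For inaccessible \<open>\<kappa>\<close> these are the
  sets of size in a Grothendieck universe. A fixed notion of smallness is needed because a category
  with coproducts indexed by its own set of arrows is a preorder. Small index categories and small
  index sets are taken inside the type carrying \<open>\<kappa>\<close>; up to isomorphism this covers all of them.\<close>

definition smallness_cardinal :: "'k rel \<Rightarrow> bool" where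
  "smallness_cardinal \<kappa> \<longleftrightarrow> Cinfinite \<kappa> \<and> regularCard \<kappa>"

definition small :: "'k rel \<Rightarrow> 'x set \<Rightarrow> bool" where
  "small \<kappa> A \<longleftrightarrow> (card_of A, \<kappa>) \<in> ordLess"

definition small_category :: "'k rel \<Rightarrow> ('i, 'j, 'n) cat_scheme \<Rightarrow> bool" where
  "small_category \<kappa> I \<longleftrightarrow> category I \<and> small \<kappa> (Obj I) \<and> small \<kappa> (Arr I)"

definition cocone :: "('o, 'a, 'm) cat_scheme \<Rightarrow> ('i, 'j, 'n) cat_scheme
    \<Rightarrow> ('i, 'j, 'o, 'a) cfunctor \<Rightarrow> 'o \<Rightarrow> ('i \<Rightarrow> 'a) \<Rightarrow> bool" where
  "cocone C I D L l \<longleftrightarrow> L \<in> Obj C \<and>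
     (\<forall>i \<in> Obj I. l i \<in> Hom C (omap D i) L) \<and>
     (\<forall>u \<in> Arr I. l (Cod I u) \<cdot>\<^bsub>C\<^esub> amap D u = l (Dom I u))"

definition colimit :: "('o, 'a, 'm) cat_scheme \<Rightarrow> ('i, 'j, 'n) cat_scheme
    \<Rightarrow> ('i, 'j, 'o, 'a) cfunctor \<Rightarrow> 'o \<Rightarrow> ('i \<Rightarrow> 'a) \<Rightarrow> bool" where
  "colimit C I D L l \<longleftrightarrow> cocone C I D L l \<and>
     (\<forall>M k. cocone C I D M k \<longrightarrow>
        (\<exists>!h. h \<in> Hom C L M \<and> (\<forall>i \<in> Obj I. h \<cdot>\<^bsub>C\<^esub> l i = k i)))"

definition cocomplete :: "'k rel \<Rightarrow> ('o, 'a, 'm) cat_scheme \<Rightarrow> bool" where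
  "cocomplete \<kappa> C \<longleftrightarrow>
     (\<forall>(I :: ('k, 'k) cat) D. small_category \<kappa> I \<and> is_functor I C D \<longrightarrow>
        (\<exists>L l. colimit C I D L l))"

definition preserves_colimits :: "'k rel \<Rightarrow> ('o, 'a, 'm) cat_scheme \<Rightarrow> ('p, 'b, 'n) cat_scheme
    \<Rightarrow> ('o, 'a, 'p, 'b) cfunctor \<Rightarrow> bool" where
  "preserves_colimits \<kappa> A B F \<longleftrightarrow>
     (\<forall>(I :: ('k, 'k) cat) D L l.
        small_category \<kappa> I \<and> is_functor I A D \<and> colimit A I D L l \<longrightarrow>
        colimit B I (comp_functor F D) (omap F L) (\<lambda>i. amap F (l i)))"


section \<open>Terminal object and chosen pullbacks\<close>

text \<open>For \<open>f : P \<rightarrow> Y\<close> and \<open>g : Z \<rightarrow> Y\<close>, \<open>pb f g\<close> is the chosen pullback \<open>P \<times>\<^sub>Y Z\<close>, and \<open>pb1 f g\<close> and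
  \<open>pb2 f g\<close> are its projections to \<open>P\<close> and \<open>Z\<close>, usually written \<open>f\<^sup>*g\<close> and \<open>g\<^sup>*f\<close>.\<close>

record ('o, 'a) pcat = "('o, 'a) cat" +
  Term :: 'o
  pb :: "'a \<Rightarrow> 'a \<Rightarrow> 'o"
  pb1 :: "'a \<Rightarrow> 'a \<Rightarrow> 'a"
  pb2 :: "'a \<Rightarrow> 'a \<Rightarrow> 'a"

definition is_terminal :: "('o, 'a, 'm) cat_scheme \<Rightarrow> 'o \<Rightarrow> bool" where
  "is_terminal C T \<longleftrightarrow> T \<in> Obj C \<and> (\<forall>A \<in> Obj C. \<exists>!t. t \<in> Hom C A T)"

definition is_pullback ::
  "('o, 'a, 'm) cat_scheme \<Rightarrow> 'a \<Rightarrow> 'a \<Rightarrow> 'o \<Rightarrow> 'a \<Rightarrow> 'a \<Rightarrow> bool" where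
  "is_pullback C f g P p q \<longleftrightarrow>
     p \<in> Hom C P (Dom C f) \<and> q \<in> Hom C P (Dom C g) \<and> f \<cdot>\<^bsub>C\<^esub> p = g \<cdot>\<^bsub>C\<^esub> q \<and>
     (\<forall>W a b. a \<in> Hom C W (Dom C f) \<and> b \<in> Hom C W (Dom C g) \<and> f \<cdot>\<^bsub>C\<^esub> a = g \<cdot>\<^bsub>C\<^esub> b \<longrightarrow>
        (\<exists>!h. h \<in> Hom C W P \<and> p \<cdot>\<^bsub>C\<^esub> h = a \<and> q \<cdot>\<^bsub>C\<^esub> h = b))"

locale pullback_category = category C
  for C :: "('o, 'a, 'm) pcat_scheme" (structure) +
  assumes Term: "is_terminal C (Term C)"
    and pb: "f \<in> Arr C \<Longrightarrow> g \<in> Arr C \<Longrightarrow> Cod C f = Cod C g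
      \<Longrightarrow> is_pullback C f g (pb C f g) (pb1 C f g) (pb2 C f g)"

definition lift :: "('o, 'a, 'm) pcat_scheme \<Rightarrow> 'a \<Rightarrow> 'a \<Rightarrow> 'a \<Rightarrow> 'a \<Rightarrow> 'a" where
  "lift C f g a b = (THE h. h \<in> Hom C (Dom C a) (pb C f g)
     \<and> pb1 C f g \<cdot>\<^bsub>C\<^esub> h = a \<and> pb2 C f g \<cdot>\<^bsub>C\<^esub> h = b)"

definition to_Term :: "('o, 'a, 'm) pcat_scheme \<Rightarrow> 'o \<Rightarrow> 'a" where
  "to_Term C A = (THE t. t \<in> Hom C A (Term C))"

text \<open>Binary products are the chosen pullbacks over the terminal object.\<close>

definition Prod :: "('o, 'a, 'm) pcat_scheme \<Rightarrow> 'o \<Rightarrow> 'o \<Rightarrow> 'o" where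
  "Prod C A B = pb C (to_Term C A) (to_Term C B)"

definition pr1 :: "('o, 'a, 'm) pcat_scheme \<Rightarrow> 'o \<Rightarrow> 'o \<Rightarrow> 'a" where
  "pr1 C A B = pb1 C (to_Term C A) (to_Term C B)"

definition pr2 :: "('o, 'a, 'm) pcat_scheme \<Rightarrow> 'o \<Rightarrow> 'o \<Rightarrow> 'a" where
  "pr2 C A B = pb2 C (to_Term C A) (to_Term C B)"

definition pair :: "('o, 'a, 'm) pcat_scheme \<Rightarrow> 'a \<Rightarrow> 'a \<Rightarrow> 'a" where
  "pair C a b = lift C (to_Term C (Cod C a)) (to_Term C (Cod C b)) a b"

definition prod_map :: "('o, 'a, 'm) pcat_scheme \<Rightarrow> 'a \<Rightarrow> 'a \<Rightarrow> 'a" where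
  "prod_map C f g =
     pair C (f \<cdot>\<^bsub>C\<^esub> pr1 C (Dom C f) (Dom C g)) (g \<cdot>\<^bsub>C\<^esub> pr2 C (Dom C f) (Dom C g))"

text \<open>The canonical isomorphism \<open>A \<times> (B \<times> D) \<rightarrow> (A \<times> B) \<times> D\<close>.\<close>

definition assoc :: "('o, 'a, 'm) pcat_scheme \<Rightarrow> 'o \<Rightarrow> 'o \<Rightarrow> 'o \<Rightarrow> 'a" where
  "assoc C A B D =
     pair C (pair C (pr1 C A (Prod C B D)) (pr1 C B D \<cdot>\<^bsub>C\<^esub> pr2 C A (Prod C B D)))
            (pr2 C B D \<cdot>\<^bsub>C\<^esub> pr2 C A (Prod C B D))"

text \<open>In the slice category \<open>C/Y\<close>, the arrow \<open>(f, h, f')\<close> is \<open>h\<close> regarded as an arrow from \<open>f\<close>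
  to \<open>f'\<close>.\<close>

definition slice :: "('o, 'a, 'm) cat_scheme \<Rightarrow> 'o \<Rightarrow> ('a, 'a \<times> 'a \<times> 'a) cat" where
  "slice C Y = \<lparr>
     Obj = {f \<in> Arr C. Cod C f = Y},
     Arr = {(f, h, f'). f \<in> Arr C \<and> Cod C f = Y \<and> f' \<in> Arr C \<and> Cod C f' = Y
              \<and> h \<in> Hom C (Dom C f) (Dom C f') \<and> f' \<cdot>\<^bsub>C\<^esub> h = f},
     Dom = (\<lambda>(f, h, f'). f),
     Cod = (\<lambda>(f, h, f'). f'),
     Ident = (\<lambda>f. (f, Ident C (Dom C f), f)),
     Comp = (\<lambda>(f1, k, f2) (f0, h, _). (f0, k \<cdot>\<^bsub>C\<^esub> h, f2))\<rparr>"

definition base_change ::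
  "('o, 'a, 'm) pcat_scheme \<Rightarrow> 'a \<Rightarrow> ('a, 'a \<times> 'a \<times> 'a, 'a, 'a \<times> 'a \<times> 'a) cfunctor" where
  "base_change C g = \<lparr>
     omap = (\<lambda>f. pb2 C f g),
     amap = (\<lambda>(f, h, f'). (pb2 C f g, lift C f' g (h \<cdot>\<^bsub>C\<^esub> pb1 C f g) (pb2 C f g), pb2 C f' g))\<rparr>"

definition pullbacks_preserve_colimits :: "'k rel \<Rightarrow> ('o, 'a, 'm) pcat_scheme \<Rightarrow> bool" where
  "pullbacks_preserve_colimits \<kappa> C \<longleftrightarrow>
     (\<forall>g \<in> Arr C. preserves_colimits \<kappa> (slice C (Cod C g)) (slice C (Dom C g)) (base_change C g))"


section \<open>Sites\<close>

definition sieve :: "('o, 'a, 'm) cat_scheme \<Rightarrow> 'o \<Rightarrow> 'a set \<Rightarrow> bool" where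
  "sieve C Y S \<longleftrightarrow> S \<subseteq> {f \<in> Arr C. Cod C f = Y} \<and>
     (\<forall>f \<in> S. \<forall>g \<in> Arr C. Cod C g = Dom C f \<longrightarrow> f \<cdot>\<^bsub>C\<^esub> g \<in> S)"

definition pullback_sieve :: "('o, 'a, 'm) cat_scheme \<Rightarrow> 'a \<Rightarrow> 'a set \<Rightarrow> 'a set" where
  "pullback_sieve C g S = {h \<in> Arr C. Cod C h = Dom C g \<and> g \<cdot>\<^bsub>C\<^esub> h \<in> S}"

definition grothendieck_topology :: "('o, 'a, 'm) cat_scheme \<Rightarrow> ('o \<Rightarrow> 'a set set) \<Rightarrow> bool" where
  "grothendieck_topology C \<tau> \<longleftrightarrow>
     (\<forall>Y \<in> Obj C. \<forall>S \<in> \<tau> Y. sieve C Y S) \<and>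
     (\<forall>Y \<in> Obj C. {f \<in> Arr C. Cod C f = Y} \<in> \<tau> Y) \<and>
     (\<forall>g \<in> Arr C. \<forall>S \<in> \<tau> (Cod C g). pullback_sieve C g S \<in> \<tau> (Dom C g)) \<and>
     (\<forall>Y \<in> Obj C. \<forall>S \<in> \<tau> Y. \<forall>R. sieve C Y R \<and> (\<forall>f \<in> S. pullback_sieve C f R \<in> \<tau> (Dom C f))
        \<longrightarrow> R \<in> \<tau> Y)"

definition generated_sieve :: "('o, 'a, 'm) cat_scheme \<Rightarrow> 'k set \<Rightarrow> ('k \<Rightarrow> 'a) \<Rightarrow> 'a set" where
  "generated_sieve C I f = {f i \<cdot>\<^bsub>C\<^esub> h |i h. i \<in> I \<and> h \<in> Arr C \<and> Cod C h = Dom C (f i)}"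

definition covering_family :: "'k rel \<Rightarrow> ('o, 'a, 'm) cat_scheme \<Rightarrow> ('o \<Rightarrow> 'a set set) \<Rightarrow> 'o
    \<Rightarrow> 'k set \<Rightarrow> ('k \<Rightarrow> 'a) \<Rightarrow> bool" where
  "covering_family \<kappa> C \<tau> Y I f \<longleftrightarrow> small \<kappa> I \<and> (\<forall>i \<in> I. f i \<in> Arr C \<and> Cod C (f i) = Y)
     \<and> generated_sieve C I f \<in> \<tau> Y"

text \<open>Covering families are indexed by small sets, and the second condition says that the topology is
  given by its covering families: a sieve covers only if it contains a covering family. It holds
  automatically when the sieves of \<open>C\<close> are small, but a cocomplete category is small only if it is
  a preorder, and then a sieve may be too large for the colimits that exist.\<close>

definition site :: "'k rel \<Rightarrow> ('o, 'a, 'm) cat_scheme \<Rightarrow> ('o \<Rightarrow> 'a set set) \<Rightarrow> bool" where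
  "site \<kappa> C \<tau> \<longleftrightarrow> grothendieck_topology C \<tau> \<and>
     (\<forall>Y \<in> Obj C. \<forall>S \<in> \<tau> Y. \<exists>I f. covering_family \<kappa> C \<tau> Y I f \<and> f ` I \<subseteq> S)"

record ('o, 'a, 'v) presheaf =
  sections :: "'o \<Rightarrow> 'v set"
  restriction :: "'a \<Rightarrow> 'v \<Rightarrow> 'v"

definition is_sheaf ::
  "('o, 'a, 'm) cat_scheme \<Rightarrow> ('o \<Rightarrow> 'a set set) \<Rightarrow> ('o, 'a, 'v) presheaf \<Rightarrow> bool" where
  "is_sheaf C \<tau> F \<longleftrightarrow>
     (\<forall>Y \<in> Obj C. \<forall>S \<in> \<tau> Y. \<forall>s.
        (\<forall>f \<in> S. s f \<in> sections F (Dom C f)) \<and>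
        (\<forall>f \<in> S. \<forall>g \<in> Arr C. Cod C g = Dom C f \<longrightarrow> restriction F g (s f) = s (f \<cdot>\<^bsub>C\<^esub> g))
        \<longrightarrow> (\<exists>!t. t \<in> sections F Y \<and> (\<forall>f \<in> S. restriction F f t = s f)))"

definition representable :: "('o, 'a, 'm) cat_scheme \<Rightarrow> 'o \<Rightarrow> ('o, 'a, 'a) presheaf" where
  "representable C A = \<lparr>sections = (\<lambda>Y. Hom C Y A), restriction = (\<lambda>g s. s \<cdot>\<^bsub>C\<^esub> g)\<rparr>"

definition subcanonical :: "('o, 'a, 'm) cat_scheme \<Rightarrow> ('o \<Rightarrow> 'a set set) \<Rightarrow> bool" where
  "subcanonical C \<tau> \<longleftrightarrow> (\<forall>A \<in> Obj C. is_sheaf C \<tau> (representable C A))"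


section \<open>Group objects and actions\<close>

record ('o, 'a) grp =
  Gobj :: 'o
  Gmult :: 'a
  Gunit :: 'a

definition group_object :: "('o, 'a, 'm) pcat_scheme \<Rightarrow> ('o, 'a) grp \<Rightarrow> bool" where
  "group_object C G \<longleftrightarrow>
     (let K = Gobj G; m = Gmult G; e = Gunit G; i = Ident C K in
       K \<in> Obj C \<and> m \<in> Hom C (Prod C K K) K \<and> e \<in> Hom C (Term C) K \<and>
       m \<cdot>\<^bsub>C\<^esub> prod_map C i m = m \<cdot>\<^bsub>C\<^esub> (prod_map C m i \<cdot>\<^bsub>C\<^esub> assoc C K K K) \<and>
       m \<cdot>\<^bsub>C\<^esub> prod_map C e i = pr2 C (Term C) K \<and>
       m \<cdot>\<^bsub>C\<^esub> prod_map C i e = pr1 C K (Term C) \<and>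
       (\<exists>v \<in> Hom C K K. m \<cdot>\<^bsub>C\<^esub> pair C v i = e \<cdot>\<^bsub>C\<^esub> to_Term C K
                       \<and> m \<cdot>\<^bsub>C\<^esub> pair C i v = e \<cdot>\<^bsub>C\<^esub> to_Term C K))"

definition action :: "('o, 'a, 'm) pcat_scheme \<Rightarrow> ('o, 'a) grp \<Rightarrow> 'o \<Rightarrow> 'a \<Rightarrow> bool" where
  "action C G X x \<longleftrightarrow> X \<in> Obj C \<and> x \<in> Hom C (Prod C (Gobj G) X) X \<and>
     x \<cdot>\<^bsub>C\<^esub> prod_map C (Ident C (Gobj G)) x
       = x \<cdot>\<^bsub>C\<^esub> (prod_map C (Gmult G) (Ident C X) \<cdot>\<^bsub>C\<^esub> assoc C (Gobj G) (Gobj G) X) \<and>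
     x \<cdot>\<^bsub>C\<^esub> prod_map C (Gunit G) (Ident C X) = pr2 C (Term C) X"

definition equivariant ::
  "('o, 'a, 'm) pcat_scheme \<Rightarrow> ('o, 'a) grp \<Rightarrow> 'o \<Rightarrow> 'a \<Rightarrow> 'o \<Rightarrow> 'a \<Rightarrow> 'a \<Rightarrow> bool" where
  "equivariant C G X x Y y f \<longleftrightarrow> f \<in> Hom C X Y \<and>
     f \<cdot>\<^bsub>C\<^esub> x = y \<cdot>\<^bsub>C\<^esub> prod_map C (Ident C (Gobj G)) f"

definition trivial_action :: "('o, 'a, 'm) pcat_scheme \<Rightarrow> ('o, 'a) grp \<Rightarrow> 'o \<Rightarrow> 'a" where
  "trivial_action C G Y = pr2 C (Gobj G) Y"

text \<open>The action of \<open>G\<close> on \<open>G \<times> U\<close> by multiplication on the first factor.\<close>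

definition mult_action :: "('o, 'a, 'm) pcat_scheme \<Rightarrow> ('o, 'a) grp \<Rightarrow> 'o \<Rightarrow> 'a" where
  "mult_action C G U =
     prod_map C (Gmult G) (Ident C U) \<cdot>\<^bsub>C\<^esub> assoc C (Gobj G) (Gobj G) U"

text \<open>The action on \<open>P \<times>\<^sub>Y Z\<close> induced by actions \<open>p\<close> on \<open>P\<close> and \<open>z\<close> on \<open>Z\<close>, for equivariant
  \<open>f : P \<rightarrow> Y\<close> and \<open>g : Z \<rightarrow> Y\<close>.\<close>

definition pullback_action ::
  "('o, 'a, 'm) pcat_scheme \<Rightarrow> ('o, 'a) grp \<Rightarrow> 'a \<Rightarrow> 'a \<Rightarrow> 'a \<Rightarrow> 'a \<Rightarrow> 'a" where
  "pullback_action C G f p g z =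
     lift C f g (p \<cdot>\<^bsub>C\<^esub> prod_map C (Ident C (Gobj G)) (pb1 C f g))
                (z \<cdot>\<^bsub>C\<^esub> prod_map C (Ident C (Gobj G)) (pb2 C f g))"


section \<open>Principal bundles\<close>

record ('o, 'a) gbundle =
  total :: 'o
  act :: 'a
  proj :: 'a

definition pullback_bundle :: "('o, 'a, 'm) pcat_scheme \<Rightarrow> ('o, 'a) grp \<Rightarrow> 'a
    \<Rightarrow> ('o, 'a) gbundle \<Rightarrow> ('o, 'a) gbundle" where
  "pullback_bundle C G f P = \<lparr>
     total = pb C (proj P) f,
     act = pullback_action C G (proj P) (act P) f (trivial_action C G (Dom C f)),
     proj = pb2 C (proj P) f\<rparr>"

definition trivial_bundle ::
  "('o, 'a, 'm) pcat_scheme \<Rightarrow> ('o, 'a) grp \<Rightarrow> 'o \<Rightarrow> ('o, 'a) gbundle" where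
  "trivial_bundle C G U = \<lparr>
     total = Prod C (Gobj G) U,
     act = mult_action C G U,
     proj = pr2 C (Gobj G) U\<rparr>"

definition bundle_morphism :: "('o, 'a, 'm) pcat_scheme \<Rightarrow> ('o, 'a) grp
    \<Rightarrow> ('o, 'a) gbundle \<Rightarrow> ('o, 'a) gbundle \<Rightarrow> 'a \<Rightarrow> bool" where
  "bundle_morphism C G P Q \<phi> \<longleftrightarrow>
     equivariant C G (total P) (act P) (total Q) (act Q) \<phi> \<and> proj Q \<cdot>\<^bsub>C\<^esub> \<phi> = proj P"

definition principal_bundle :: "'k rel \<Rightarrow> ('o, 'a, 'm) pcat_scheme \<Rightarrow> ('o \<Rightarrow> 'a set set)
    \<Rightarrow> ('o, 'a) grp \<Rightarrow> 'o \<Rightarrow> ('o, 'a) gbundle \<Rightarrow> bool" where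
  "principal_bundle \<kappa> C \<tau> G Y P \<longleftrightarrow> Y \<in> Obj C \<and>
     action C G (total P) (act P) \<and>
     equivariant C G (total P) (act P) Y (trivial_action C G Y) (proj P) \<and>
     (\<exists>I f. covering_family \<kappa> C \<tau> Y I f \<and>
        (\<forall>i \<in> I. \<exists>\<phi>. iso_arrow C \<phi> \<and>
           bundle_morphism C G (pullback_bundle C G (f i) P) (trivial_bundle C G (Dom C (f i))) \<phi>))"


section \<open>Prestacks and stacks\<close>

text \<open>A pseudofunctor \<open>C\<^sup>o\<^sup>p \<rightarrow> Cat\<close>. For \<open>g : Z' \<rightarrow> Z\<close> and \<open>f : Z \<rightarrow> Y\<close> the coherence isomorphism
  \<open>coh f g W\<close> goes from \<open>g\<^sup>*(f\<^sup>*W)\<close> to \<open>(f \<cdot> g)\<^sup>*W\<close>, and \<open>coh_id Y W\<close> goes from \<open>W\<close> to \<open>id\<^sub>Y\<^sup>*W\<close>.\<close>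

record ('o, 'a, 'p, 'b) prestack =
  fib :: "'o \<Rightarrow> ('p, 'b) cat"
  pull :: "'a \<Rightarrow> ('p, 'b, 'p, 'b) cfunctor"
  coh :: "'a \<Rightarrow> 'a \<Rightarrow> 'p \<Rightarrow> 'b"
  coh_id :: "'o \<Rightarrow> 'p \<Rightarrow> 'b"

locale is_prestack = category C
  for C :: "('o, 'a, 'm) cat_scheme" (structure) and F :: "('o, 'a, 'p, 'b) prestack" +
  assumes fib: "Y \<in> Obj C \<Longrightarrow> category (fib F Y)"
    and pull: "f \<in> Arr C \<Longrightarrow> is_functor (fib F (Cod C f)) (fib F (Dom C f)) (pull F f)"
    and coh_Hom: "f \<in> Hom C Z Y \<Longrightarrow> g \<in> Hom C Z' Z \<Longrightarrow> W \<in> Obj (fib F Y) \<Longrightarrow>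
      coh F f g W \<in> Hom (fib F Z') (omap (pull F g) (omap (pull F f) W)) (omap (pull F (f \<cdot> g)) W)"
    and coh_iso: "f \<in> Hom C Z Y \<Longrightarrow> g \<in> Hom C Z' Z \<Longrightarrow> W \<in> Obj (fib F Y) \<Longrightarrow>
      iso_arrow (fib F Z') (coh F f g W)"
    and coh_natural: "f \<in> Hom C Z Y \<Longrightarrow> g \<in> Hom C Z' Z \<Longrightarrow> a \<in> Hom (fib F Y) V W \<Longrightarrow>
      coh F f g W \<cdot>\<^bsub>fib F Z'\<^esub> amap (pull F g) (amap (pull F f) a)
        = amap (pull F (f \<cdot> g)) a \<cdot>\<^bsub>fib F Z'\<^esub> coh F f g V"
    and coh_id_Hom: "Y \<in> Obj C \<Longrightarrow> W \<in> Obj (fib F Y) \<Longrightarrow>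
      coh_id F Y W \<in> Hom (fib F Y) W (omap (pull F (Ident C Y)) W)"
    and coh_id_iso: "Y \<in> Obj C \<Longrightarrow> W \<in> Obj (fib F Y) \<Longrightarrow> iso_arrow (fib F Y) (coh_id F Y W)"
    and coh_id_natural: "Y \<in> Obj C \<Longrightarrow> a \<in> Hom (fib F Y) V W \<Longrightarrow>
      coh_id F Y W \<cdot>\<^bsub>fib F Y\<^esub> a = amap (pull F (Ident C Y)) a \<cdot>\<^bsub>fib F Y\<^esub> coh_id F Y V"
    and coh_assoc: "f \<in> Hom C Z Y \<Longrightarrow> g \<in> Hom C Z' Z \<Longrightarrow> h \<in> Hom C Z'' Z' \<Longrightarrow> W \<in> Obj (fib F Y) \<Longrightarrow>
      coh F (f \<cdot> g) h W \<cdot>\<^bsub>fib F Z''\<^esub> amap (pull F h) (coh F f g W)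
        = coh F f (g \<cdot> h) W \<cdot>\<^bsub>fib F Z''\<^esub> coh F g h (omap (pull F f) W)"
    and coh_unit_left: "f \<in> Hom C Z Y \<Longrightarrow> W \<in> Obj (fib F Y) \<Longrightarrow>
      coh F f (Ident C Z) W \<cdot>\<^bsub>fib F Z\<^esub> coh_id F Z (omap (pull F f) W)
        = Ident (fib F Z) (omap (pull F f) W)"
    and coh_unit_right: "f \<in> Hom C Z Y \<Longrightarrow> W \<in> Obj (fib F Y) \<Longrightarrow>
      coh F (Ident C Y) f W \<cdot>\<^bsub>fib F Z\<^esub> amap (pull F f) (coh_id F Y W)
        = Ident (fib F Z) (omap (pull F f) W)"

definition descent_datum :: "('o, 'a, 'm) cat_scheme \<Rightarrow> ('o, 'a, 'p, 'b) prestack \<Rightarrow> 'a set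
    \<Rightarrow> ('a \<Rightarrow> 'p) \<Rightarrow> ('a \<Rightarrow> 'a \<Rightarrow> 'b) \<Rightarrow> bool" where
  "descent_datum C F S W \<phi> \<longleftrightarrow>
     (\<forall>f \<in> S. W f \<in> Obj (fib F (Dom C f))) \<and>
     (\<forall>f \<in> S. \<forall>g \<in> Arr C. Cod C g = Dom C f \<longrightarrow>
        \<phi> f g \<in> Hom (fib F (Dom C g)) (omap (pull F g) (W f)) (W (f \<cdot>\<^bsub>C\<^esub> g)) \<and>
        iso_arrow (fib F (Dom C g)) (\<phi> f g)) \<and>
     (\<forall>f \<in> S. \<forall>g \<in> Arr C. \<forall>h \<in> Arr C. Cod C g = Dom C f \<and> Cod C h = Dom C g \<longrightarrow>
        \<phi> (f \<cdot>\<^bsub>C\<^esub> g) h \<cdot>\<^bsub>fib F (Dom C h)\<^esub> amap (pull F h) (\<phi> f g)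
          = \<phi> f (g \<cdot>\<^bsub>C\<^esub> h) \<cdot>\<^bsub>fib F (Dom C h)\<^esub> coh F g h (W f))"

definition effective :: "('o, 'a, 'm) cat_scheme \<Rightarrow> ('o, 'a, 'p, 'b) prestack \<Rightarrow> 'o \<Rightarrow> 'a set
    \<Rightarrow> ('a \<Rightarrow> 'p) \<Rightarrow> ('a \<Rightarrow> 'a \<Rightarrow> 'b) \<Rightarrow> bool" where
  "effective C F Y S W \<phi> \<longleftrightarrow>
     (\<exists>V \<psi>. V \<in> Obj (fib F Y) \<and>
       (\<forall>f \<in> S. \<psi> f \<in> Hom (fib F (Dom C f)) (omap (pull F f) V) (W f) \<and>
               iso_arrow (fib F (Dom C f)) (\<psi> f)) \<and>
       (\<forall>f \<in> S. \<forall>g \<in> Arr C. Cod C g = Dom C f \<longrightarrow>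
          \<phi> f g \<cdot>\<^bsub>fib F (Dom C g)\<^esub> amap (pull F g) (\<psi> f)
            = \<psi> (f \<cdot>\<^bsub>C\<^esub> g) \<cdot>\<^bsub>fib F (Dom C g)\<^esub> coh F f g V))"

text \<open>For \<open>a : f\<^sup>*x \<rightarrow> f\<^sup>*y\<close>, the arrow \<open>g\<^sup>*a\<close> regarded as an arrow \<open>(f \<cdot> g)\<^sup>*x \<rightarrow> (f \<cdot> g)\<^sup>*y\<close> by means of
  the coherence isomorphisms.\<close>

definition restrict_arrow :: "('o, 'a, 'm) cat_scheme \<Rightarrow> ('o, 'a, 'p, 'b) prestack
    \<Rightarrow> 'p \<Rightarrow> 'p \<Rightarrow> 'a \<Rightarrow> 'a \<Rightarrow> 'b \<Rightarrow> 'b" where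
  "restrict_arrow C F x y f g a =
     (coh F f g y \<cdot>\<^bsub>fib F (Dom C g)\<^esub> amap (pull F g) a)
       \<cdot>\<^bsub>fib F (Dom C g)\<^esub> inv_arrow (fib F (Dom C g)) (coh F f g x)"

definition effective_descent :: "('o, 'a, 'm) cat_scheme \<Rightarrow> ('o \<Rightarrow> 'a set set)
    \<Rightarrow> ('o, 'a, 'p, 'b) prestack \<Rightarrow> bool" where
  "effective_descent C \<tau> F \<longleftrightarrow>
     (\<forall>Y \<in> Obj C. \<forall>S \<in> \<tau> Y. \<forall>W \<phi>. descent_datum C F S W \<phi> \<longrightarrow> effective C F Y S W \<phi>)"

definition morphisms_glue :: "'k rel \<Rightarrow> ('o, 'a, 'm) pcat_scheme \<Rightarrow> ('o \<Rightarrow> 'a set set)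
    \<Rightarrow> ('o, 'a, 'p, 'b) prestack \<Rightarrow> bool" where
  "morphisms_glue \<kappa> C \<tau> F \<longleftrightarrow>
     (\<forall>U \<in> Obj C. \<forall>I f. covering_family \<kappa> C \<tau> U I f \<longrightarrow>
       (\<forall>x \<in> Obj (fib F U). \<forall>y \<in> Obj (fib F U). \<forall>\<phi>.
          (\<forall>i \<in> I. \<phi> i \<in> Hom (fib F (Dom C (f i))) (omap (pull F (f i)) x) (omap (pull F (f i)) y)) \<and>
          (\<forall>i \<in> I. \<forall>j \<in> I.
             restrict_arrow C F x y (f i) (pb1 C (f i) (f j)) (\<phi> i)
               = restrict_arrow C F x y (f j) (pb2 C (f i) (f j)) (\<phi> j))
          \<longrightarrow> (\<exists>\<eta> \<in> Hom (fib F U) x y. \<forall>i \<in> I. amap (pull F (f i)) \<eta> = \<phi> i)))"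

definition morphisms_separated :: "'k rel \<Rightarrow> ('o, 'a, 'm) pcat_scheme \<Rightarrow> ('o \<Rightarrow> 'a set set)
    \<Rightarrow> ('o, 'a, 'p, 'b) prestack \<Rightarrow> bool" where
  "morphisms_separated \<kappa> C \<tau> F \<longleftrightarrow>
     (\<forall>U \<in> Obj C. \<forall>I f. covering_family \<kappa> C \<tau> U I f \<longrightarrow>
       (\<forall>x \<in> Obj (fib F U). \<forall>y \<in> Obj (fib F U). \<forall>\<phi> \<in> Hom (fib F U) x y. \<forall>\<psi> \<in> Hom (fib F U) x y.
          (\<forall>i \<in> I. amap (pull F (f i)) \<phi> = amap (pull F (f i)) \<psi>) \<longrightarrow> \<phi> = \<psi>))"

definition is_stack :: "'k rel \<Rightarrow> ('o, 'a, 'm) pcat_scheme \<Rightarrow> ('o \<Rightarrow> 'a set set)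
    \<Rightarrow> ('o, 'a, 'p, 'b) prestack \<Rightarrow> bool" where
  "is_stack \<kappa> C \<tau> F \<longleftrightarrow> is_prestack C F \<and> effective_descent C \<tau> F \<and>
     morphisms_glue \<kappa> C \<tau> F \<and> morphisms_separated \<kappa> C \<tau> F"


section \<open>The quotient prestack\<close>

text \<open>An object over \<open>Y\<close> is a pair \<open>(P, \<alpha>)\<close>; an arrow \<open>((P, \<alpha>), \<phi>, (Q, \<beta>))\<close> is \<open>\<phi>\<close> together with its
  source and target.\<close>

type_synonym ('o, 'a) qobj = "('o, 'a) gbundle \<times> 'a"
type_synonym ('o, 'a) qarr = "('o, 'a) qobj \<times> 'a \<times> ('o, 'a) qobj"

definition quotient_obj :: "'k rel \<Rightarrow> ('o, 'a, 'm) pcat_scheme \<Rightarrow> ('o \<Rightarrow> 'a set set)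
    \<Rightarrow> ('o, 'a) grp \<Rightarrow> 'o \<Rightarrow> 'a \<Rightarrow> 'o \<Rightarrow> ('o, 'a) qobj set" where
  "quotient_obj \<kappa> C \<tau> G X x Y = {(P, \<alpha>). principal_bundle \<kappa> C \<tau> G Y P \<and>
     equivariant C G (total P) (act P) X x \<alpha>}"

definition quotient_fib :: "'k rel \<Rightarrow> ('o, 'a, 'm) pcat_scheme \<Rightarrow> ('o \<Rightarrow> 'a set set)
    \<Rightarrow> ('o, 'a) grp \<Rightarrow> 'o \<Rightarrow> 'a \<Rightarrow> 'o \<Rightarrow> (('o, 'a) qobj, ('o, 'a) qarr) cat" where
  "quotient_fib \<kappa> C \<tau> G X x Y = \<lparr>
     Obj = quotient_obj \<kappa> C \<tau> G X x Y,
     Arr = {((P, \<alpha>), \<phi>, (Q, \<beta>)). (P, \<alpha>) \<in> quotient_obj \<kappa> C \<tau> G X x Y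
              \<and> (Q, \<beta>) \<in> quotient_obj \<kappa> C \<tau> G X x Y
              \<and> bundle_morphism C G P Q \<phi> \<and> \<beta> \<cdot>\<^bsub>C\<^esub> \<phi> = \<alpha>},
     Dom = (\<lambda>(A, \<phi>, B). A),
     Cod = (\<lambda>(A, \<phi>, B). B),
     Ident = (\<lambda>(P, \<alpha>). ((P, \<alpha>), Ident C (total P), (P, \<alpha>))),
     Comp = (\<lambda>(_, \<psi>, B) (A, \<phi>, _). (A, \<psi> \<cdot>\<^bsub>C\<^esub> \<phi>, B))\<rparr>"

definition quotient_pull_obj :: "('o, 'a, 'm) pcat_scheme \<Rightarrow> ('o, 'a) grp \<Rightarrow> 'a
    \<Rightarrow> ('o, 'a) qobj \<Rightarrow> ('o, 'a) qobj" where
  "quotient_pull_obj C G f = (\<lambda>(P, \<alpha>). (pullback_bundle C G f P, \<alpha> \<cdot>\<^bsub>C\<^esub> pb1 C (proj P) f))"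

definition quotient_pull :: "('o, 'a, 'm) pcat_scheme \<Rightarrow> ('o, 'a) grp \<Rightarrow> 'a
    \<Rightarrow> (('o, 'a) qobj, ('o, 'a) qarr, ('o, 'a) qobj, ('o, 'a) qarr) cfunctor" where
  "quotient_pull C G f = \<lparr>
     omap = quotient_pull_obj C G f,
     amap = (\<lambda>((P, \<alpha>), \<phi>, (Q, \<beta>)).
       (quotient_pull_obj C G f (P, \<alpha>),
        lift C (proj Q) f (\<phi> \<cdot>\<^bsub>C\<^esub> pb1 C (proj P) f) (pb2 C (proj P) f),
        quotient_pull_obj C G f (Q, \<beta>)))\<rparr>"

text \<open>The coherence isomorphisms are \<open>(P \<times>\<^sub>Y Z) \<times>\<^sub>Z Z' \<cong> P \<times>\<^sub>Y Z'\<close> and \<open>P \<cong> P \<times>\<^sub>Y Y\<close>.\<close>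

definition quotient_coh :: "('o, 'a, 'm) pcat_scheme \<Rightarrow> ('o, 'a) grp \<Rightarrow> 'a \<Rightarrow> 'a
    \<Rightarrow> ('o, 'a) qobj \<Rightarrow> ('o, 'a) qarr" where
  "quotient_coh C G f g = (\<lambda>(P, \<alpha>).
     (quotient_pull_obj C G g (quotient_pull_obj C G f (P, \<alpha>)),
      lift C (proj P) (f \<cdot>\<^bsub>C\<^esub> g)
        (pb1 C (proj P) f \<cdot>\<^bsub>C\<^esub> pb1 C (pb2 C (proj P) f) g) (pb2 C (pb2 C (proj P) f) g),
      quotient_pull_obj C G (f \<cdot>\<^bsub>C\<^esub> g) (P, \<alpha>)))"

definition quotient_coh_id :: "('o, 'a, 'm) pcat_scheme \<Rightarrow> ('o, 'a) grp \<Rightarrow> 'o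
    \<Rightarrow> ('o, 'a) qobj \<Rightarrow> ('o, 'a) qarr" where
  "quotient_coh_id C G Y = (\<lambda>(P, \<alpha>).
     ((P, \<alpha>),
      lift C (proj P) (Ident C Y) (Ident C (total P)) (proj P),
      quotient_pull_obj C G (Ident C Y) (P, \<alpha>)))"

definition quotient_prestack :: "'k rel \<Rightarrow> ('o, 'a, 'm) pcat_scheme \<Rightarrow> ('o \<Rightarrow> 'a set set)
    \<Rightarrow> ('o, 'a) grp \<Rightarrow> 'o \<Rightarrow> 'a \<Rightarrow> ('o, 'a, ('o, 'a) qobj, ('o, 'a) qarr) prestack" where
  "quotient_prestack \<kappa> C \<tau> G X x = \<lparr>
     fib = quotient_fib \<kappa> C \<tau> G X x,
     pull = quotient_pull C G,
     coh = quotient_coh C G,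
     coh_id = quotient_coh_id C G\<rparr>"

end

theory Submission
  imports Defs
begin


text \<open>Two different reasons make \<open>[X/G]\<close> a stack.

  Everything about arrows is local because representable presheaves are sheaves. If \<open>S\<close> covers \<open>Y\<close> and
  \<open>a : A \<rightarrow> Y\<close> is any arrow, then the \<open>x\<close> with \<open>a \<cdot> x \<in> S\<close> form a covering sieve on \<open>A\<close>, and so an arrow
  \<open>A \<rightarrow> M\<close> is the same as a compatible family of arrows, one for each such \<open>x\<close>
  (\<open>arrow_ext_on_cover\<close>, \<open>arrow_glue_on_cover\<close>). Taking the total space \<open>P\<close> of a bundle for \<open>A\<close> this
  glues morphisms of bundles, together with all the equations that they have to satisfy; taking
  \<open>G \<times> P\<close> for \<open>A\<close> it glues actions.

  Effective descent needs in addition that the total space exists, and this is where colimits enter.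
  A descent datum amounts to objects \<open>E\<^sub>f\<close> over the domains of the \<open>f \<in> S\<close> and cartesian arrows
  \<open>E\<^bsub>f\<cdot>g\<^esub> \<rightarrow> E\<^sub>f\<close>, functorial in \<open>g\<close>: compose the inverse of \<open>\<phi>\<^bsup>f,g\<^esup>\<close> with the projection of the
  pullback. Choose a small covering family of arrows \<open>f\<^sub>i : U\<^sub>i \<rightarrow> Y\<close> in \<open>S\<close> and let \<open>L\<close> be the colimit of
  the \<open>E\<close> over all \<open>U\<^sub>i\<close> and \<open>U\<^sub>i \<times>\<^sub>Y U\<^sub>j\<close>. For \<open>f : Z \<rightarrow> Y\<close> in \<open>S\<close>, base change along \<open>f\<close> preserves this
  colimit, so an arrow \<open>L \<times>\<^sub>Y Z \<rightarrow> E\<^sub>f\<close> over \<open>Z\<close> may be given on the pieces of the diagram, where it is the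
  transport of a point of one \<open>E\<close> to another along the cartesian arrows. In the other direction there
  is an arrow \<open>E\<^sub>f \<rightarrow> L\<close>, obtained by gluing, because locally the points of \<open>E\<^sub>f\<close> can be transported to
  some \<open>E\<close> over \<open>U\<^sub>i\<close>. The two are inverse to each other over \<open>Z\<close>, so \<open>L \<times>\<^sub>Y Z \<cong> E\<^sub>f\<close> for all \<open>f \<in> S\<close>
  (\<open>objects_glue\<close>). The action of \<open>G\<close> on \<open>L\<close> and the map \<open>L \<rightarrow> X\<close> are then glued as above.

  Local triviality is handled through equivariant cartesian arrows \<open>t : G \<times> U \<rightarrow> P\<close> over \<open>f : U \<rightarrow> Y\<close>.
  The \<open>f\<close> that admit such a \<open>t\<close> form a sieve, and \<open>P\<close> is principal exactly if this sieve covers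
  (\<open>principal_bundle_iff\<close>). By the pasting law for pullbacks and the axioms of a topology, being
  principal is then stable under base change and local on the base (\<open>principal_pullback\<close>,
  \<open>principal_local\<close>).

  Calculations with products and pullbacks are made with generalized elements: two arrows are compared
  after precomposition with an arbitrary \<open>x : W \<rightarrow> A\<close>, and \<open>act P \<cdot> pair C g a\<close> is the result of acting
  with the point \<open>g\<close> of \<open>G\<close> on the point \<open>a\<close> of \<open>P\<close>.\<close>

section \<open>Arrows, pullbacks and products\<close>

context category
begin

abbreviation "arr f \<equiv> f \<in> Arr C"
abbreviation "src \<equiv> Dom C"
abbreviation "tgt \<equiv> Cod C"

lemma Hom_iff: "f \<in> Hom C A B \<longleftrightarrow> f \<in> Arr C \<and> src f = A \<and> tgt f = B"
  by (simp add: Hom_def)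

text \<open>Conditions on composites are stated as equations between domains and codomains, and composites are
  nested to the right. In this form the simplifier discharges all typing conditions.\<close>

lemma ident_simps [simp]:
  assumes "A \<in> Obj C"
  shows "arr (Ident C A)" "src (Ident C A) = A" "tgt (Ident C A) = A"
  using Ident_Hom[OF assms] by (simp_all add: Hom_iff)

lemma comp_simps [simp]:
  assumes "arr f" "arr g" "tgt f = src g"
  shows "arr (g \<cdot> f)" "src (g \<cdot> f) = src f" "tgt (g \<cdot> f) = tgt g"
  using Comp_Hom[of f "src f" "tgt f" g "tgt g"] assms by (simp_all add: Hom_iff)

lemma comp_assoc [simp]:
  assumes "arr f" "arr g" "arr h" "tgt f = src g" "tgt g = src h"
  shows "(h \<cdot> g) \<cdot> f = h \<cdot> (g \<cdot> f)"
  using Comp_assoc[of f "src f" "tgt f" g "tgt g" h "tgt h"] assms by (simp add: Hom_iff)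

lemma ident_left [simp]: "arr f \<Longrightarrow> tgt f = A \<Longrightarrow> Ident C A \<cdot> f = f"
  using Ident_left[of f "src f" A] by (simp add: Hom_iff)

lemma ident_right [simp]: "arr f \<Longrightarrow> src f = A \<Longrightarrow> f \<cdot> Ident C A = f"
  using Ident_right[of f A "tgt f"] by (simp add: Hom_iff)

lemma Dom_in_Obj [simp]: "arr f \<Longrightarrow> src f \<in> Obj C"
  and Cod_in_Obj [simp]: "arr f \<Longrightarrow> tgt f \<in> Obj C"
  by (simp_all add: Dom_Obj Cod_Obj)

lemma comp_eq_comp:
  assumes "g \<cdot> f = g' \<cdot> f'" "arr f" "arr g" "tgt f = src g"
    "arr f'" "arr g'" "tgt f' = src g'" "arr h" "tgt h = src f" "src f = src f'"
  shows "g \<cdot> (f \<cdot> h) = g' \<cdot> (f' \<cdot> h)"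
proof -
  have "(g \<cdot> f) \<cdot> h = (g' \<cdot> f') \<cdot> h" using assms(1) by simp
  then show ?thesis using assms(2-) by simp
qed

text \<open>The simplifier does not see an equation \<open>g \<cdot> f = k\<close> inside a right-nested composite, since there
  \<open>f\<close> is already composed with another arrow; this puts the equation into the form in which it applies.\<close>

lemma comp_eq_arr:
  assumes "g \<cdot> f = k" "arr f" "arr g" "tgt f = src g" "arr h" "tgt h = src f"
  shows "g \<cdot> (f \<cdot> h) = k \<cdot> h"
proof -
  have "(g \<cdot> f) \<cdot> h = k \<cdot> h" using assms(1) by simp
  then show ?thesis using assms(2-) by simp
qed

lemma inverse_arrows_unique:
  assumes "inverse_arrows C f g" "inverse_arrows C f h"
  shows "g = h"
proof -
  have "arr g" "arr h" "arr f" "src g = tgt f" "tgt g = src f"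
    "src h = tgt f" "tgt h = src f" "g \<cdot> f = Ident C (src f)" "f \<cdot> h = Ident C (tgt f)"
    using assms by (simp_all add: inverse_arrows_def Hom_iff)
  then have "(g \<cdot> f) \<cdot> h = h" "g \<cdot> (f \<cdot> h) = g" by simp_all
  then show ?thesis using \<open>g \<in> Arr C\<close> \<open>h \<in> Arr C\<close> \<open>f \<in> Arr C\<close> \<open>src g = tgt f\<close> \<open>tgt h = src f\<close>
    by simp
qed

lemma inv_arrow_eq: "inverse_arrows C f g \<Longrightarrow> inv_arrow C f = g"
  unfolding inv_arrow_def by (rule the_equality) (auto intro: inverse_arrows_unique)

lemma inverse_arrows_inv_arrow: "iso_arrow C f \<Longrightarrow> inverse_arrows C f (inv_arrow C f)"
  using inv_arrow_eq unfolding iso_arrow_def by blast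

text \<open>A pullback in the form that the calculations use: all typing conditions are equations about
  domains and codomains, so that the simplifier can discharge them.\<close>

lemma is_pullback_iff:
  assumes "arr f" "arr g"
  shows "is_pullback C f g P p q \<longleftrightarrow>
    p \<in> Arr C \<and> arr q \<and> src p = P \<and> src q = P \<and> tgt p = src f \<and> tgt q = src g
    \<and> f \<cdot> p = g \<cdot> q
    \<and> (\<forall>a b. arr a \<and> arr b \<and> src a = src b \<and> tgt a = src f \<and> tgt b = src g
         \<and> f \<cdot> a = g \<cdot> b \<longrightarrow> (\<exists>h. arr h \<and> src h = src a \<and> tgt h = P \<and> p \<cdot> h = a \<and> q \<cdot> h = b))
    \<and> (\<forall>h k. arr h \<and> arr k \<and> src h = src k \<and> tgt h = P \<and> tgt k = P
         \<and> p \<cdot> h = p \<cdot> k \<and> q \<cdot> h = q \<cdot> k \<longrightarrow> h = k)" (is "?L \<longleftrightarrow> ?R")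
proof
  assume L: ?L
  then have pq: "arr p" "arr q" "src p = P" "src q = P" "tgt p = src f"
     "tgt q = src g" "f \<cdot> p = g \<cdot> q" by (simp_all add: is_pullback_def Hom_iff)
  have U: "\<And>W a b. a \<in> Hom C W (src f) \<Longrightarrow> b \<in> Hom C W (src g) \<Longrightarrow> f \<cdot> a = g \<cdot> b \<Longrightarrow>
     (\<exists>!h. h \<in> Hom C W P \<and> p \<cdot> h = a \<and> q \<cdot> h = b)" using L by (simp add: is_pullback_def)
  have "h = k" if "arr h \<and> arr k \<and> src h = src k \<and> tgt h = P \<and> tgt k = P
         \<and> p \<cdot> h = p \<cdot> k \<and> q \<cdot> h = q \<cdot> k" for h k
  proof -
    have "f \<cdot> (p \<cdot> h) = g \<cdot> (q \<cdot> h)"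
      by (rule comp_eq_comp) (use that pq assms in auto)
    then show ?thesis
      using U[of "p \<cdot> h" "src h" "q \<cdot> h"] that pq assms by (auto simp: Hom_iff)
  qed
  moreover have "\<exists>h. arr h \<and> src h = src a \<and> tgt h = P \<and> p \<cdot> h = a \<and> q \<cdot> h = b"
    if "arr a \<and> arr b \<and> src a = src b \<and> tgt a = src f \<and> tgt b = src g
         \<and> f \<cdot> a = g \<cdot> b" for a b
    using U[of a "src a" b] that by (auto simp: Hom_iff)
  ultimately show ?R using pq by blast
next
  assume ?R
  then have pq: "arr p" "arr q" "src p = P" "src q = P" "tgt p = src f"
      "tgt q = src g" "f \<cdot> p = g \<cdot> q"
    and fac: "\<And>a b. arr a \<and> arr b \<and> src a = src b \<and> tgt a = src f \<and> tgt b = src g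
       \<and> f \<cdot> a = g \<cdot> b \<Longrightarrow> (\<exists>h. arr h \<and> src h = src a \<and> tgt h = P \<and> p \<cdot> h = a \<and> q \<cdot> h = b)"
    and ext: "\<And>h k. arr h \<and> arr k \<and> src h = src k \<and> tgt h = P \<and> tgt k = P
       \<and> p \<cdot> h = p \<cdot> k \<and> q \<cdot> h = q \<cdot> k \<Longrightarrow> h = k"
    by blast+
  show ?L unfolding is_pullback_def
  proof (intro conjI allI impI)
    fix W a b
    assume ab: "a \<in> Hom C W (src f) \<and> b \<in> Hom C W (src g) \<and> f \<cdot> a = g \<cdot> b"
    then have "\<exists>h. arr h \<and> src h = src a \<and> tgt h = P \<and> p \<cdot> h = a \<and> q \<cdot> h = b"
      by (intro fac) (simp add: Hom_iff)
    then obtain h where h: "arr h" "src h = src a" "tgt h = P" "p \<cdot> h = a" "q \<cdot> h = b"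
      by blast
    show "\<exists>!h. h \<in> Hom C W P \<and> p \<cdot> h = a \<and> q \<cdot> h = b"
    proof (rule ex1I[of _ h])
      show "h \<in> Hom C W P \<and> p \<cdot> h = a \<and> q \<cdot> h = b" using h ab by (simp add: Hom_iff)
      fix k assume "k \<in> Hom C W P \<and> p \<cdot> k = a \<and> q \<cdot> k = b"
      then show "k = h" using h ab by (intro ext) (simp add: Hom_iff)
    qed
  qed (use pq in \<open>simp_all add: Hom_iff\<close>)
qed

lemma is_pullbackD:
  assumes "is_pullback C f g P p q" "arr f" "arr g"
  shows "arr p" "arr q" "src p = P" "src q = P" "tgt p = src f" "tgt q = src g"
    "f \<cdot> p = g \<cdot> q"
  using assms by (simp_all add: is_pullback_iff)

lemma is_pullback_factor:
  assumes "is_pullback C f g P p q" "arr f" "arr g"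
    "arr a" "arr b" "src a = src b" "tgt a = src f" "tgt b = src g" "f \<cdot> a = g \<cdot> b"
  obtains h where "arr h" "src h = src a" "tgt h = P" "p \<cdot> h = a" "q \<cdot> h = b"
  using assms(1,4-) unfolding is_pullback_iff[OF assms(2,3)] by blast

lemma is_pullback_ext:
  assumes "is_pullback C f g P p q" "arr f" "arr g"
    "arr h" "arr k" "src h = src k" "tgt h = P" "tgt k = P"
    "p \<cdot> h = p \<cdot> k" "q \<cdot> h = q \<cdot> k"
  shows "h = k"
  using assms(1,4-) unfolding is_pullback_iff[OF assms(2,3)] by blast

lemma is_pullbackI:
  assumes "arr f" "arr g" "arr p" "arr q" "src p = P" "src q = P"
    "tgt p = src f" "tgt q = src g" "f \<cdot> p = g \<cdot> q"
    "\<And>a b. arr a \<Longrightarrow> arr b \<Longrightarrow> src a = src b \<Longrightarrow> tgt a = src f \<Longrightarrow> tgt b = src g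
         \<Longrightarrow> f \<cdot> a = g \<cdot> b \<Longrightarrow> \<exists>h. arr h \<and> src h = src a \<and> tgt h = P \<and> p \<cdot> h = a \<and> q \<cdot> h = b"
    "\<And>h k. arr h \<Longrightarrow> arr k \<Longrightarrow> src h = src k \<Longrightarrow> tgt h = P \<Longrightarrow> tgt k = P
         \<Longrightarrow> p \<cdot> h = p \<cdot> k \<Longrightarrow> q \<cdot> h = q \<cdot> k \<Longrightarrow> h = k"
  shows "is_pullback C f g P p q"
  unfolding is_pullback_iff[OF assms(1,2)] using assms(3-) by blast

text \<open>The pasting law: in
  \<open>Q \<rightarrow> P \<rightarrow> E\<close> over \<open>W \<rightarrow> Z \<rightarrow> Y\<close>, if the right square is a pullback then the left one is a pullback
  exactly if the outer one is.\<close>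

lemma pullback_paste:
  assumes PB: "is_pullback C \<pi> f P c p" and \<pi>: "arr \<pi>" "arr f" "tgt f = tgt \<pi>"
    and PB': "is_pullback C p g Q d q" and g: "arr g" "tgt g = src f"
  shows "is_pullback C \<pi> (f \<cdot> g) Q (c \<cdot> d) q"
proof -
  note P = is_pullbackD[OF PB \<pi>(1,2)]
  note Q = is_pullbackD[OF PB' P(2) g(1)]
  note [simp] = \<pi> g P(1-6) Q(1-6)
  show ?thesis
  proof (rule is_pullbackI)
    show "\<pi> \<cdot> (c \<cdot> d) = (f \<cdot> g) \<cdot> q"
      using comp_eq_comp[OF P(7), of d] Q(7) by simp
  next
    fix a b assume ab: "arr a" "arr b" "src a = src b" "tgt a = src \<pi>"
      "tgt b = src (f \<cdot> g)" "\<pi> \<cdot> a = (f \<cdot> g) \<cdot> b"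
    note [simp] = ab(1-5)
    obtain h where h: "arr h" "src h = src b" "tgt h = P" "c \<cdot> h = a" "p \<cdot> h = g \<cdot> b"
      by (rule is_pullback_factor[OF PB, of a "g \<cdot> b"]) (use ab in auto)
    obtain k where "arr k" "src k = src b" "tgt k = Q" "d \<cdot> k = h" "q \<cdot> k = b"
      by (rule is_pullback_factor[OF PB', of h b]) (use h ab in auto)
    then show "\<exists>k. arr k \<and> src k = src a \<and> tgt k = Q \<and> (c \<cdot> d) \<cdot> k = a \<and> q \<cdot> k = b"
      using h by (intro exI[of _ k]) auto
  next
    fix h k assume hk: "arr h" "arr k" "src h = src k" "tgt h = Q" "tgt k = Q"
      "(c \<cdot> d) \<cdot> h = (c \<cdot> d) \<cdot> k" "q \<cdot> h = q \<cdot> k"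
    note [simp] = hk(1-5)
    have "p \<cdot> (d \<cdot> h) = p \<cdot> (d \<cdot> k)"
      using comp_eq_comp[OF Q(7), of h] comp_eq_comp[OF Q(7), of k] hk(7) by simp
    then have "d \<cdot> h = d \<cdot> k"
      by - (rule is_pullback_ext[OF PB]; use hk in simp)
    then show "h = k" by - (rule is_pullback_ext[OF PB']; use hk in simp)
  qed simp_all
qed

lemma pullback_cancel:
  assumes PB: "is_pullback C \<pi> f P c p" and \<pi>: "arr \<pi>" "arr f" "tgt f = tgt \<pi>"
    and PB': "is_pullback C \<pi> (f \<cdot> g) Q (c \<cdot> d) q" and g: "arr g" "tgt g = src f"
    and d: "arr d" "src d = Q" "tgt d = P" "p \<cdot> d = g \<cdot> q"
  shows "is_pullback C p g Q d q"
proof -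
  note P = is_pullbackD[OF PB \<pi>(1,2)]
  have fg: "arr (f \<cdot> g)" using \<pi> g by simp
  note Q = is_pullbackD[OF PB' \<pi>(1) fg]
  note [simp] = \<pi> g P(1-6) d(1-3) Q(2,4)
  have [simp]: "tgt q = src g" using Q(6) by simp
  show ?thesis
  proof (rule is_pullbackI)
    fix a b assume ab: "arr a" "arr b" "src a = src b" "tgt a = src p"
      "tgt b = src g" "p \<cdot> a = g \<cdot> b"
    note [simp] = ab(1-5)
    have "\<pi> \<cdot> (c \<cdot> a) = f \<cdot> (g \<cdot> b)" using comp_eq_comp[OF P(7), of a] ab by simp
    then obtain h where h: "arr h" "src h = src b" "tgt h = Q" "(c \<cdot> d) \<cdot> h = c \<cdot> a" "q \<cdot> h = b"
      by - (rule is_pullback_factor[OF PB' _ fg, of "c \<cdot> a" b]; simp)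
    note [simp] = h(1-3)
    have "p \<cdot> (d \<cdot> h) = p \<cdot> a"
      using comp_eq_comp[OF d(4), of h] h(5) ab(6) by simp
    then have "d \<cdot> h = a" by - (rule is_pullback_ext[OF PB]; use h in simp)
    then show "\<exists>h. arr h \<and> src h = src a \<and> tgt h = Q \<and> d \<cdot> h = a \<and> q \<cdot> h = b"
      using h by (intro exI[of _ h]) simp
  next
    fix h k assume hk: "arr h" "arr k" "src h = src k" "tgt h = Q" "tgt k = Q"
      "d \<cdot> h = d \<cdot> k" "q \<cdot> h = q \<cdot> k"
    show "h = k" by (rule is_pullback_ext[OF PB' _ fg]) (use hk in auto)
  qed (use d in simp_all)
qed

lemma pullback_iso:
  assumes PB: "is_pullback C f g P p q" and fg: "arr f" "arr g"
    and i: "inverse_arrows C i j" "tgt i = P" "src i = Q" and fg': "tgt f = tgt g"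
  shows "is_pullback C f g Q (p \<cdot> i) (q \<cdot> i)"
proof -
  note P = is_pullbackD[OF PB fg]
  have [simp]: "arr i" "arr j" "tgt i = P" "src i = Q" "tgt j = Q" "src j = P"
    and ji: "j \<cdot> i = Ident C Q" "i \<cdot> j = Ident C P"
    using i by (auto simp: inverse_arrows_def Hom_iff)
  note [simp] = fg fg' P(1-6)
  show ?thesis
  proof (rule is_pullbackI)
    show "f \<cdot> (p \<cdot> i) = g \<cdot> (q \<cdot> i)" by (rule comp_eq_comp[OF P(7)]) auto
  next
    fix a b assume ab: "arr a" "arr b" "src a = src b" "tgt a = src f"
      "tgt b = src g" "f \<cdot> a = g \<cdot> b"
    obtain h where h: "arr h" "src h = src a" "tgt h = P" "p \<cdot> h = a" "q \<cdot> h = b"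
      by (rule is_pullback_factor[OF PB fg ab])
    have "i \<cdot> (j \<cdot> h) = h" using comp_eq_arr[OF ji(2), of h] h(1-3) by simp
    then show "\<exists>h. arr h \<and> src h = src a \<and> tgt h = Q \<and> (p \<cdot> i) \<cdot> h = a \<and> (q \<cdot> i) \<cdot> h = b"
      using h by (intro exI[of _ "j \<cdot> h"]) auto
  next
    fix h k assume hk: "arr h" "arr k" "src h = src k" "tgt h = Q" "tgt k = Q"
      "(p \<cdot> i) \<cdot> h = (p \<cdot> i) \<cdot> k" "(q \<cdot> i) \<cdot> h = (q \<cdot> i) \<cdot> k"
    have "i \<cdot> h = i \<cdot> k" by (rule is_pullback_ext[OF PB]) (use hk in auto)
    then have "j \<cdot> (i \<cdot> h) = j \<cdot> (i \<cdot> k)" by simp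
    then show "h = k"
      using comp_eq_arr[OF ji(1), of h] comp_eq_arr[OF ji(1), of k] hk(1-5) by simp
  qed simp_all
qed

text \<open>A pullback has no automorphisms over its two projections, so comparison arrows in both directions compose to identities.\<close>

lemma pullback_comparison_iso:
  assumes PB: "is_pullback C f g P p q" and PB': "is_pullback C f g P' p' q'"
    and fg: "arr f" "arr g"
    and h: "arr h" "src h = P" "tgt h = P'" "p' \<cdot> h = p" "q' \<cdot> h = q"
  shows "iso_arrow C h"
proof -
  note P = is_pullbackD[OF PB fg] and P' = is_pullbackD[OF PB' fg]
  note [simp] = P(1-6) P'(1-6) h(1-3)
  obtain k where k: "arr k" "src k = P'" "tgt k = P" "p \<cdot> k = p'" "q \<cdot> k = q'"
    by (rule is_pullback_factor[OF PB fg, of p' q']) (use P'(7) in auto)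
  note [simp] = k(1-3)
  have Obj: "P \<in> Obj C" "P' \<in> Obj C" using Dom_in_Obj[OF h(1)] Cod_in_Obj[OF h(1)] by simp_all
  note [simp] = this
  have "p \<cdot> (k \<cdot> h) = p" "q \<cdot> (k \<cdot> h) = q" "p' \<cdot> (h \<cdot> k) = p'" "q' \<cdot> (h \<cdot> k) = q'"
    using comp_eq_arr[OF k(4), of h] comp_eq_arr[OF k(5), of h]
      comp_eq_arr[OF h(4), of k] comp_eq_arr[OF h(5), of k] h(4,5) k(4,5) by simp_all
  then have "k \<cdot> h = Ident C P"
    by - (rule is_pullback_ext[OF PB fg]; simp)
  moreover have "h \<cdot> k = Ident C P'"
    using \<open>p' \<cdot> (h \<cdot> k) = p'\<close> \<open>q' \<cdot> (h \<cdot> k) = q'\<close> by - (rule is_pullback_ext[OF PB' fg]; simp)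
  ultimately have "inverse_arrows C h k" by (simp add: inverse_arrows_def Hom_iff)
  then show ?thesis by (auto simp: iso_arrow_def)
qed

end

context pullback_category
begin

text \<open>The base change along \<open>g\<close> of \<open>h\<close>, regarded as an arrow from \<open>f\<close> to \<open>f'\<close> in a slice category.\<close>

abbreviation "pbmap g f h f' \<equiv> lift C f' g (h \<cdot> pb1 C f g) (pb2 C f g)"

lemma pb_simps [simp]:
  assumes "arr f" "arr g" "tgt f = tgt g"
  shows "arr (pb1 C f g)" "arr (pb2 C f g)" "src (pb1 C f g) = pb C f g"
    "src (pb2 C f g) = pb C f g" "tgt (pb1 C f g) = src f" "tgt (pb2 C f g) = src g"
  using is_pullbackD[OF pb[OF assms] assms(1,2)] by simp_all

lemma pb_Obj [simp]: "arr f \<Longrightarrow> arr g \<Longrightarrow> tgt f = tgt g \<Longrightarrow> pb C f g \<in> Obj C"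
  using Dom_in_Obj[OF pb_simps(1)] by simp

lemma pb_square:
  assumes "arr f" "arr g" "tgt f = tgt g"
  shows "f \<cdot> pb1 C f g = g \<cdot> pb2 C f g"
  using is_pullbackD[OF pb[OF assms] assms(1,2)] by simp

lemma pb_square_comp:
  assumes "arr f" "arr g" "tgt f = tgt g" "arr h" "tgt h = pb C f g"
  shows "f \<cdot> (pb1 C f g \<cdot> h) = g \<cdot> (pb2 C f g \<cdot> h)"
  by (rule comp_eq_comp[OF pb_square]) (use assms in auto)

lemma pb_ext:
  assumes "pb1 C f g \<cdot> h = pb1 C f g \<cdot> k" "pb2 C f g \<cdot> h = pb2 C f g \<cdot> k"
    "arr f" "arr g" "tgt f = tgt g"
    "arr h" "arr k" "src h = src k" "tgt h = pb C f g" "tgt k = pb C f g"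
  shows "h = k"
  by (rule is_pullback_ext[OF pb]) (use assms in auto)

lemma lift_unique:
  assumes "arr f" "arr g" "tgt f = tgt g" "arr h" "src h = src a"
    "tgt h = pb C f g" "pb1 C f g \<cdot> h = a" "pb2 C f g \<cdot> h = b"
  shows "lift C f g a b = h"
  unfolding lift_def by (rule the_equality) (use assms in \<open>auto simp: Hom_iff intro!: pb_ext[of f g]\<close>)

lemma lift_simps [simp]:
  assumes "arr f" "arr g" "tgt f = tgt g" "arr a" "arr b" "src a = src b"
    "tgt a = src f" "tgt b = src g" "f \<cdot> a = g \<cdot> b"
  shows "arr (lift C f g a b)" "src (lift C f g a b) = src a" "tgt (lift C f g a b) = pb C f g"
    "pb1 C f g \<cdot> lift C f g a b = a" "pb2 C f g \<cdot> lift C f g a b = b"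
proof -
  obtain h where "arr h" "src h = src a" "tgt h = pb C f g" "pb1 C f g \<cdot> h = a" "pb2 C f g \<cdot> h = b"
    by (rule is_pullback_factor[OF pb[OF assms(1-3)] assms(1,2,4-9)])
  then show "arr (lift C f g a b)" "src (lift C f g a b) = src a" "tgt (lift C f g a b) = pb C f g"
    "pb1 C f g \<cdot> lift C f g a b = a" "pb2 C f g \<cdot> lift C f g a b = b"
    using lift_unique[of f g h a b] assms(1-3) by simp_all
qed

lemma lift_comp_simps [simp]:
  assumes "arr f" "arr g" "tgt f = tgt g" "arr a" "arr b" "src a = src b"
    "tgt a = src f" "tgt b = src g" "f \<cdot> a = g \<cdot> b" "arr h" "tgt h = src a"
  shows "pb1 C f g \<cdot> (lift C f g a b \<cdot> h) = a \<cdot> h" "pb2 C f g \<cdot> (lift C f g a b \<cdot> h) = b \<cdot> h"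
  using comp_eq_arr[OF lift_simps(4)[OF assms(1-9)], of h]
    comp_eq_arr[OF lift_simps(5)[OF assms(1-9)], of h] assms by simp_all

lemma lift_comp:
  assumes "arr f" "arr g" "tgt f = tgt g" "arr a" "arr b" "src a = src b"
    "tgt a = src f" "tgt b = src g" "f \<cdot> a = g \<cdot> b" "arr h" "tgt h = src a"
  shows "lift C f g a b \<cdot> h = lift C f g (a \<cdot> h) (b \<cdot> h)"
  by (rule lift_unique[symmetric]) (use assms in auto)

lemma Term_Obj [simp]: "Term C \<in> Obj C"
  using Term by (simp add: is_terminal_def)

lemma to_Term_simps [simp]:
  assumes "A \<in> Obj C"
  shows "arr (to_Term C A)" "src (to_Term C A) = A" "tgt (to_Term C A) = Term C"
proof -
  have "\<exists>!t. t \<in> Hom C A (Term C)" using Term assms by (simp add: is_terminal_def)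
  from theI'[OF this] show "arr (to_Term C A)" "src (to_Term C A) = A" "tgt (to_Term C A) = Term C"
    unfolding to_Term_def by (simp_all add: Hom_iff)
qed

lemma Term_ext:
  "arr h \<Longrightarrow> arr k \<Longrightarrow> src h = src k \<Longrightarrow> tgt h = Term C \<Longrightarrow> tgt k = Term C \<Longrightarrow> h = k"
  using Term Dom_in_Obj[of h] unfolding is_terminal_def by (metis Hom_iff)

lemma to_Term_comp [simp]: "arr h \<Longrightarrow> tgt h = A \<Longrightarrow> to_Term C A \<cdot> h = to_Term C (src h)"
  using Cod_in_Obj[of h] by (auto intro: Term_ext)

lemma pr_simps [simp]:
  assumes "A \<in> Obj C" "B \<in> Obj C"
  shows "arr (pr1 C A B)" "arr (pr2 C A B)" "src (pr1 C A B) = Prod C A B"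
    "src (pr2 C A B) = Prod C A B" "tgt (pr1 C A B) = A" "tgt (pr2 C A B) = B"
    "Prod C A B \<in> Obj C"
  using assms by (simp_all add: pr1_def pr2_def Prod_def)

lemma pair_simps [simp]:
  assumes "arr a" "arr b" "src a = src b"
  shows "arr (pair C a b)" "src (pair C a b) = src a" "tgt (pair C a b) = Prod C (tgt a) (tgt b)"
  using assms by (simp_all add: pair_def Prod_def)

lemma pr_pair [simp]:
  assumes "arr a" "arr b" "src a = src b" "tgt a = A" "tgt b = B"
  shows "pr1 C A B \<cdot> pair C a b = a" "pr2 C A B \<cdot> pair C a b = b"
  using assms by (auto simp add: pair_def pr1_def pr2_def)

lemma pr_pair_comp [simp]:
  assumes "arr a" "arr b" "src a = src b" "tgt a = A" "tgt b = B" "arr h" "tgt h = src a"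
  shows "pr1 C A B \<cdot> (pair C a b \<cdot> h) = a \<cdot> h" "pr2 C A B \<cdot> (pair C a b \<cdot> h) = b \<cdot> h"
  using assms by (auto simp add: pair_def pr1_def pr2_def)

lemma pair_ext:
  assumes "pr1 C A B \<cdot> h = pr1 C A B \<cdot> k" "pr2 C A B \<cdot> h = pr2 C A B \<cdot> k"
    "A \<in> Obj C" "B \<in> Obj C" "arr h" "arr k" "src h = src k"
    "tgt h = Prod C A B" "tgt k = Prod C A B"
  shows "h = k"
  by (rule pb_ext[of "to_Term C A" "to_Term C B"]) (use assms in \<open>auto simp: pr1_def pr2_def Prod_def\<close>)

lemma pair_comp [simp]:
  assumes "arr a" "arr b" "src a = src b" "arr h" "tgt h = src a"
  shows "pair C a b \<cdot> h = pair C (a \<cdot> h) (b \<cdot> h)"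
  by (rule pair_ext[of "tgt a" "tgt b"]) (use assms in auto)

lemma pair_eta [simp]:
  assumes "A \<in> Obj C" "B \<in> Obj C" "arr h" "tgt h = Prod C A B"
  shows "pair C (pr1 C A B \<cdot> h) (pr2 C A B \<cdot> h) = h"
  by (rule pair_ext[of A B]) (use assms in auto)

lemma pair_pr [simp]:
  assumes "A \<in> Obj C" "B \<in> Obj C"
  shows "pair C (pr1 C A B) (pr2 C A B) = Ident C (Prod C A B)"
  by (rule pair_ext[of A B]) (use assms in auto)

lemma prod_map_simps [simp]:
  assumes "arr f" "arr g"
  shows "arr (prod_map C f g)" "src (prod_map C f g) = Prod C (src f) (src g)"
    "tgt (prod_map C f g) = Prod C (tgt f) (tgt g)"
  using assms by (simp_all add: prod_map_def)

lemma prod_map_pair [simp]: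
  assumes "arr f" "arr g" "arr a" "arr b" "src a = src b"
    "tgt a = src f" "tgt b = src g"
  shows "prod_map C f g \<cdot> pair C a b = pair C (f \<cdot> a) (g \<cdot> b)"
  using assms by (simp add: prod_map_def)

lemma assoc_simps [simp]:
  assumes "A \<in> Obj C" "B \<in> Obj C" "D \<in> Obj C"
  shows "arr (assoc C A B D)" "src (assoc C A B D) = Prod C A (Prod C B D)"
    "tgt (assoc C A B D) = Prod C (Prod C A B) D"
  using assms by (simp_all add: assoc_def)

lemma assoc_pair [simp]:
  assumes "arr a" "arr b" "arr d" "src a = src d" "src b = src d"
    "tgt a = A" "tgt b = B" "tgt d = D"
  shows "assoc C A B D \<cdot> pair C a (pair C b d) = pair C (pair C a b) d"
proof -
  have "A \<in> Obj C" "B \<in> Obj C" "D \<in> Obj C" using assms by auto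
  then show ?thesis using assms by (simp add: assoc_def)
qed

end


section \<open>Group actions on generalized elements\<close>

locale group_in_category = pullback_category C
  for C :: "('o, 'a, 'm) pcat_scheme" (structure) +
  fixes G :: "('o, 'a) grp"
  assumes group: "group_object C G"
begin

abbreviation "K \<equiv> Gobj G"

lemma group_simps [simp]:
  "K \<in> Obj C" "arr (Gmult G)" "src (Gmult G) = Prod C K K" "tgt (Gmult G) = K"
  "arr (Gunit G)" "src (Gunit G) = Term C" "tgt (Gunit G) = K"
  using group by (simp_all add: group_object_def Let_def Hom_iff)

text \<open>An equation between arrows out of \<open>G \<times> X\<close> can be tested on points \<open>(g, a)\<close>: the universal point,
  given by the two projections, recovers the equation itself. This replaces \<open>prod_map\<close> and \<open>assoc\<close> by the
  usual formulas for actions.\<close>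

lemma equivariant_iff:
  assumes "arr x" "src x = Prod C K X" "tgt x = X"
    "arr y" "src y = Prod C K Y" "tgt y = Y"
  shows "equivariant C G X x Y y f \<longleftrightarrow> f \<in> Arr C \<and> src f = X \<and> tgt f = Y \<and>
     (\<forall>g a. arr g \<longrightarrow> arr a \<longrightarrow> src g = src a \<longrightarrow> tgt g = K \<longrightarrow> tgt a = X \<longrightarrow>
        f \<cdot> (x \<cdot> pair C g a) = y \<cdot> pair C g (f \<cdot> a))"
proof -
  have [simp]: "X \<in> Obj C" "Y \<in> Obj C" using assms Cod_in_Obj by metis+
  note [simp] = assms
  show ?thesis
  proof (cases "arr f \<and> src f = X \<and> tgt f = Y")
    case True
    then have [simp]: "arr f" "src f = X" "tgt f = Y" by simp_all
    have "f \<cdot> x = y \<cdot> prod_map C (Ident C K) f \<longleftrightarrow>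
     (\<forall>g a. arr g \<longrightarrow> arr a \<longrightarrow> src g = src a \<longrightarrow> tgt g = K \<longrightarrow> tgt a = X \<longrightarrow>
        f \<cdot> (x \<cdot> pair C g a) = y \<cdot> pair C g (f \<cdot> a))" (is "?L \<longleftrightarrow> ?R")
    proof
      assume L: ?L
      show ?R
      proof (intro allI impI)
        fix g a assume [simp]: "arr g" "arr a" "src g = src a" "tgt g = K" "tgt a = X"
        have "(f \<cdot> x) \<cdot> pair C g a = (y \<cdot> prod_map C (Ident C K) f) \<cdot> pair C g a" using L by (rule arg_cong)
        then show "f \<cdot> (x \<cdot> pair C g a) = y \<cdot> pair C g (f \<cdot> a)" by simp
      qed
    next
      assume ?R
      from this[rule_format, of "pr1 C K X" "pr2 C K X"]
      show ?L by (simp add: prod_map_def)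
    qed
    then show ?thesis by (simp add: equivariant_def Hom_iff)
  qed (auto simp: equivariant_def Hom_iff)
qed

lemma action_iff:
  "action C G X x \<longleftrightarrow> X \<in> Obj C \<and> arr x \<and> src x = Prod C K X \<and> tgt x = X \<and>
     (\<forall>g h a. arr g \<longrightarrow> arr h \<longrightarrow> arr a \<longrightarrow> src g = src a \<longrightarrow> src h = src a \<longrightarrow>
        tgt g = K \<longrightarrow> tgt h = K \<longrightarrow> tgt a = X \<longrightarrow>
        x \<cdot> pair C g (x \<cdot> pair C h a) = x \<cdot> pair C (Gmult G \<cdot> pair C g h) a) \<and>
     (\<forall>a. arr a \<longrightarrow> tgt a = X \<longrightarrow> x \<cdot> pair C (Gunit G \<cdot> to_Term C (src a)) a = a)"
proof (cases "X \<in> Obj C \<and> arr x \<and> src x = Prod C K X \<and> tgt x = X")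
  case True
  then have [simp]: "X \<in> Obj C" "arr x" "src x = Prod C K X" "tgt x = X" by auto
  have 1: "x \<cdot> prod_map C (Ident C K) x = x \<cdot> (prod_map C (Gmult G) (Ident C X) \<cdot> assoc C K K X) \<longleftrightarrow>
      (\<forall>g h a. arr g \<longrightarrow> arr h \<longrightarrow> arr a \<longrightarrow> src g = src a \<longrightarrow> src h = src a \<longrightarrow>
        tgt g = K \<longrightarrow> tgt h = K \<longrightarrow> tgt a = X \<longrightarrow>
        x \<cdot> pair C g (x \<cdot> pair C h a) = x \<cdot> pair C (Gmult G \<cdot> pair C g h) a)" (is "?L \<longleftrightarrow> ?R")
  proof
    assume L: ?L
    show ?R
    proof (intro allI impI)
      fix g h a assume [simp]: "arr g" "arr h" "arr a" "src g = src a" "src h = src a"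
        "tgt g = K" "tgt h = K" "tgt a = X"
      have "(x \<cdot> prod_map C (Ident C K) x) \<cdot> pair C g (pair C h a)
          = (x \<cdot> (prod_map C (Gmult G) (Ident C X) \<cdot> assoc C K K X)) \<cdot> pair C g (pair C h a)"
        using L by (rule arg_cong)
      then show "x \<cdot> pair C g (x \<cdot> pair C h a) = x \<cdot> pair C (Gmult G \<cdot> pair C g h) a"
        by (simp del: pair_comp)
    qed
  next
    assume ?R
    from this[rule_format, of "pr1 C K (Prod C K X)" "pr1 C K X \<cdot> pr2 C K (Prod C K X)"
        "pr2 C K X \<cdot> pr2 C K (Prod C K X)"]
    show ?L by (simp add: prod_map_def assoc_def)
  qed
  have 2: "x \<cdot> prod_map C (Gunit G) (Ident C X) = pr2 C (Term C) X \<longleftrightarrow>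
     (\<forall>a. arr a \<longrightarrow> tgt a = X \<longrightarrow> x \<cdot> pair C (Gunit G \<cdot> to_Term C (src a)) a = a)" (is "?L \<longleftrightarrow> ?R")
  proof
    assume L: ?L
    show ?R
    proof (intro allI impI)
      fix a assume [simp]: "arr a" "tgt a = X"
      have "(x \<cdot> prod_map C (Gunit G) (Ident C X)) \<cdot> pair C (to_Term C (src a)) a
          = pr2 C (Term C) X \<cdot> pair C (to_Term C (src a)) a"
        using L by (rule arg_cong)
      then show "x \<cdot> pair C (Gunit G \<cdot> to_Term C (src a)) a = a" by (simp del: pair_comp)
    qed
  next
    assume ?R
    have [simp]: "to_Term C (Prod C (Term C) X) = pr1 C (Term C) X" by (rule Term_ext) simp_all
    from \<open>?R\<close>[rule_format, of "pr2 C (Term C) X"] show ?L by (simp add: prod_map_def)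
  qed
  show ?thesis unfolding action_def 1 2 by (simp add: Hom_iff)
qed (auto simp: action_def Hom_iff)

lemma equivariant_comp:
  assumes "equivariant C G X x Y y f" "equivariant C G Y y Z z h"
    "arr x" "src x = Prod C K X" "tgt x = X"
    "arr y" "src y = Prod C K Y" "tgt y = Y"
    "arr z" "src z = Prod C K Z" "tgt z = Z"
  shows "equivariant C G X x Z z (h \<cdot> f)"
  using assms by (simp add: equivariant_iff)

lemma equivariant_inverse:
  assumes "equivariant C G X x Y y f" "inverse_arrows C f h"
    "arr x" "src x = Prod C K X" "tgt x = X"
    "arr y" "src y = Prod C K Y" "tgt y = Y"
  shows "equivariant C G Y y X x h"
proof -
  have f: "arr f" "src f = X" "tgt f = Y" using assms by (simp_all add: equivariant_iff)
  then have h: "arr h" "src h = Y" "tgt h = X" "h \<cdot> f = Ident C X" "f \<cdot> h = Ident C Y"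
    using assms by (auto simp: inverse_arrows_def Hom_iff)
  note [simp] = f h(1-3) assms(3-)
  have "h \<cdot> (y \<cdot> pair C g b) = x \<cdot> pair C g (h \<cdot> b)"
    if [simp]: "arr g" "arr b" "src g = src b" "tgt g = K" "tgt b = Y" for g b
  proof -
    have "f \<cdot> (h \<cdot> b) = b" using comp_eq_arr[OF h(5), of b] by simp
    then have "f \<cdot> (x \<cdot> pair C g (h \<cdot> b)) = y \<cdot> pair C g b"
      using assms(1) by (simp add: equivariant_iff)
    then have "h \<cdot> (f \<cdot> (x \<cdot> pair C g (h \<cdot> b))) = h \<cdot> (y \<cdot> pair C g b)" by simp
    then show ?thesis using comp_eq_arr[OF h(4), of "x \<cdot> pair C g (h \<cdot> b)"] by simp
  qed
  then show ?thesis by (simp add: equivariant_iff)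
qed

lemma trivial_action_simps [simp]:
  assumes "Y \<in> Obj C"
  shows "arr (trivial_action C G Y)" "src (trivial_action C G Y) = Prod C K Y"
    "tgt (trivial_action C G Y) = Y"
  using assms by (simp_all add: trivial_action_def)

lemma trivial_action_pair [simp]:
  assumes "arr g" "arr a" "src g = src a" "tgt g = K" "tgt a = Y"
  shows "trivial_action C G Y \<cdot> pair C g a = a"
  using assms by (simp add: trivial_action_def)

lemma mult_action_simps [simp]:
  assumes "U \<in> Obj C"
  shows "arr (mult_action C G U)" "src (mult_action C G U) = Prod C K (Prod C K U)"
    "tgt (mult_action C G U) = Prod C K U"
  using assms by (simp_all add: mult_action_def)

lemma mult_action_pair [simp]:
  assumes "arr g" "arr a" "src g = src a" "tgt g = K" "tgt a = Prod C K U" "U \<in> Obj C"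
  shows "mult_action C G U \<cdot> pair C g a = pair C (Gmult G \<cdot> pair C g (pr1 C K U \<cdot> a)) (pr2 C K U \<cdot> a)"
proof -
  have "mult_action C G U \<cdot> pair C g a = mult_action C G U \<cdot> pair C g (pair C (pr1 C K U \<cdot> a) (pr2 C K U \<cdot> a))"
    using assms by (simp del: pair_comp)
  also have "\<dots> = pair C (Gmult G \<cdot> pair C g (pr1 C K U \<cdot> a)) (pr2 C K U \<cdot> a)"
    using assms by (simp add: mult_action_def del: pair_eta pair_comp)
  finally show ?thesis .
qed

text \<open>A principal bundle without local triviality: a \<open>G\<close>-object with an invariant projection. The base is
  the codomain of the projection.\<close>

definition G_object :: "('o, 'a) gbundle \<Rightarrow> bool" where
  "G_object P \<longleftrightarrow> action C G (total P) (act P) \<and> arr (proj P) \<and>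
     equivariant C G (total P) (act P) (tgt (proj P)) (trivial_action C G (tgt (proj P))) (proj P)"

lemma G_object_simps [simp]:
  assumes "G_object P"
  shows "total P \<in> Obj C" "arr (act P)" "src (act P) = Prod C K (total P)" "tgt (act P) = total P"
    "arr (proj P)" "src (proj P) = total P"
  using assms unfolding G_object_def by (auto simp: action_iff equivariant_def Hom_iff)

lemma G_object_act [simp]:
  assumes "G_object P" "arr g" "arr a" "src g = src a" "tgt g = K" "tgt a = total P"
  shows "proj P \<cdot> (act P \<cdot> pair C g a) = proj P \<cdot> a"
proof -
  have [simp]: "tgt (proj P) \<in> Obj C" using assms G_object_simps by simp
  have "equivariant C G (total P) (act P) (tgt (proj P)) (trivial_action C G (tgt (proj P))) (proj P)"
    using assms(1) by (simp add: G_object_def)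
  then show ?thesis using assms by (simp add: equivariant_iff)
qed

lemma G_object_action:
  assumes "G_object P" shows "action C G (total P) (act P)"
  using assms by (simp add: G_object_def)

lemma G_object_act_assoc:
  assumes "G_object P" "arr g" "arr h" "arr a" "src g = src a" "src h = src a"
    "tgt g = K" "tgt h = K" "tgt a = total P"
  shows "act P \<cdot> pair C g (act P \<cdot> pair C h a) = act P \<cdot> pair C (Gmult G \<cdot> pair C g h) a"
  using G_object_action[OF assms(1)] assms(2-) unfolding action_iff by blast

lemma G_object_act_unit:
  assumes "G_object P" "arr a" "tgt a = total P"
  shows "act P \<cdot> pair C (Gunit G \<cdot> to_Term C (src a)) a = a"
  using G_object_action[OF assms(1)] assms(2-) unfolding action_iff by blast

lemma G_objectI:
  assumes "action C G (total P) (act P)" "arr (proj P)" "src (proj P) = total P"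
    "\<And>g a. arr g \<Longrightarrow> arr a \<Longrightarrow> src g = src a \<Longrightarrow> tgt g = K \<Longrightarrow> tgt a = total P
       \<Longrightarrow> proj P \<cdot> (act P \<cdot> pair C g a) = proj P \<cdot> a"
  shows "G_object P"
proof -
  have "tgt (proj P) \<in> Obj C" using assms by simp
  then show ?thesis using assms unfolding G_object_def by (auto simp: action_iff equivariant_iff)
qed

lemma equivariant_G_object_iff:
  assumes "G_object P" "G_object Q"
  shows "equivariant C G (total P) (act P) (total Q) (act Q) f \<longleftrightarrow>
     f \<in> Arr C \<and> src f = total P \<and> tgt f = total Q \<and>
     (\<forall>g a. arr g \<longrightarrow> arr a \<longrightarrow> src g = src a \<longrightarrow> tgt g = K \<longrightarrow> tgt a = total P \<longrightarrow>
        f \<cdot> (act P \<cdot> pair C g a) = act Q \<cdot> pair C g (f \<cdot> a))"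
  by (rule equivariant_iff) (use assms in simp_all)

lemma pullback_bundle_simps:
  "total (pullback_bundle C G f P) = pb C (proj P) f"
  "proj (pullback_bundle C G f P) = pb2 C (proj P) f"
  by (simp_all add: pullback_bundle_def)

text \<open>The pullback action moves the first component of a point of \<open>P \<times>\<^sub>Y Z\<close> and fixes the second.\<close>

lemma pullback_act_arr:
  assumes "G_object P" "arr f" "tgt f = tgt (proj P)"
  shows "arr (act (pullback_bundle C G f P))" 
    "src (act (pullback_bundle C G f P)) = Prod C K (pb C (proj P) f)"
    "tgt (act (pullback_bundle C G f P)) = pb C (proj P) f"
    "pb1 C (proj P) f \<cdot> act (pullback_bundle C G f P)
       = act P \<cdot> pair C (pr1 C K (pb C (proj P) f)) (pb1 C (proj P) f \<cdot> pr2 C K (pb C (proj P) f))"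
    "pb2 C (proj P) f \<cdot> act (pullback_bundle C G f P) = pb2 C (proj P) f \<cdot> pr2 C K (pb C (proj P) f)"
  using assms
  by (simp_all add: pullback_bundle_def pullback_action_def prod_map_def pb_square_comp)

lemma pullback_act [simp]:
  assumes "G_object P" "arr f" "tgt f = tgt (proj P)"
    "arr g" "arr a" "src g = src a" "tgt g = K" "tgt a = pb C (proj P) f"
  shows "pb1 C (proj P) f \<cdot> (act (pullback_bundle C G f P) \<cdot> pair C g a) = act P \<cdot> pair C g (pb1 C (proj P) f \<cdot> a)"
    "pb2 C (proj P) f \<cdot> (act (pullback_bundle C G f P) \<cdot> pair C g a) = pb2 C (proj P) f \<cdot> a"
  using comp_eq_arr[OF pullback_act_arr(4)[OF assms(1-3)], of "pair C g a"] 
    comp_eq_arr[OF pullback_act_arr(5)[OF assms(1-3)], of "pair C g a"] pullback_act_arr(1-3)[OF assms(1-3)] assms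
  by simp_all

lemma G_object_pullback [simp]:
  assumes P: "G_object P" and f: "arr f" "tgt f = tgt (proj P)"
  shows "G_object (pullback_bundle C G f P)"
proof -
  note [simp] = assms pullback_act_arr(1-3)[OF assms] pullback_bundle_simps
  show ?thesis
  proof (rule G_objectI)
    show "action C G (total (pullback_bundle C G f P)) (act (pullback_bundle C G f P))"
      unfolding action_iff
    proof (intro conjI allI impI)
      fix g h a assume [simp]: "arr g" "arr h" "arr a" "src g = src a" "src h = src a"
        "tgt g = K" "tgt h = K" "tgt a = total (pullback_bundle C G f P)"
      show "act (pullback_bundle C G f P) \<cdot> pair C g (act (pullback_bundle C G f P) \<cdot> pair C h a)
        = act (pullback_bundle C G f P) \<cdot> pair C (Gmult G \<cdot> pair C g h) a"
        by (rule pb_ext[of "proj P" f]) (simp_all add: G_object_act_assoc)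
    next
      fix a assume [simp]: "arr a" "tgt a = total (pullback_bundle C G f P)"
      show "act (pullback_bundle C G f P) \<cdot> pair C (Gunit G \<cdot> to_Term C (src a)) a = a"
        using G_object_act_unit[OF P, of "pb1 C (proj P) f \<cdot> a"]
        by - (rule pb_ext[of "proj P" f]; simp)
    qed simp_all
  qed simp_all
qed

lemma pb1_equivariant:
  assumes "G_object P" "arr f" "tgt f = tgt (proj P)"
  shows "equivariant C G (pb C (proj P) f) (act (pullback_bundle C G f P)) (total P) (act P) (pb1 C (proj P) f)"
  using equivariant_G_object_iff[OF G_object_pullback[OF assms] assms(1)] assms by (simp add: pullback_bundle_simps)

lemma lift_equivariant:
  assumes P: "G_object P" "arr f" "tgt f = tgt (proj P)"
    and a: "arr a" "src a = Prod C K A" "tgt a = A"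
    and t: "equivariant C G A a (total P) (act P) t"
    and u: "equivariant C G A a (src f) (trivial_action C G (src f)) u"
    and sq: "proj P \<cdot> t = f \<cdot> u"
  shows "equivariant C G A a (pb C (proj P) f) (act (pullback_bundle C G f P)) (lift C (proj P) f t u)"
  unfolding equivariant_iff[OF a pullback_act_arr(1-3)[OF P]]
proof (intro conjI allI impI)
  note [simp] = P a pullback_act_arr(1-3)[OF P] sq
  have f: "src f \<in> Obj C" by simp
  have t' [simp]: "arr t" "src t = A" "tgt t = total P"
    "\<And>g y. arr g \<Longrightarrow> arr y \<Longrightarrow> src g = src y \<Longrightarrow> tgt g = K \<Longrightarrow> tgt y = A \<Longrightarrow> t \<cdot> (a \<cdot> pair C g y) = act P \<cdot> pair C g (t \<cdot> y)"
    using t by (simp_all add: equivariant_iff)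
  have u' [simp]: "arr u" "src u = A" "tgt u = src f"
    "\<And>g y. arr g \<Longrightarrow> arr y \<Longrightarrow> src g = src y \<Longrightarrow> tgt g = K \<Longrightarrow> tgt y = A \<Longrightarrow> u \<cdot> (a \<cdot> pair C g y) = u \<cdot> y"
    using u by (simp_all add: equivariant_iff[OF a trivial_action_simps[OF f]])
  show "arr (lift C (proj P) f t u)" "src (lift C (proj P) f t u) = A" "tgt (lift C (proj P) f t u) = pb C (proj P) f"
    by simp_all
  fix g y assume [simp]: "arr g" "arr y" "src g = src y" "tgt g = K" "tgt y = A"
  show "lift C (proj P) f t u \<cdot> (a \<cdot> pair C g y) = act (pullback_bundle C G f P) \<cdot> pair C g (lift C (proj P) f t u \<cdot> y)"
    by (rule pb_ext[of "proj P" f]) simp_all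
qed

lemma pr2_equivariant:
  assumes "arr h" "src h = U" "tgt h = V"
  shows "equivariant C G (Prod C K U) (mult_action C G U) V (trivial_action C G V) (h \<cdot> pr2 C K U)"
proof -
  have "U \<in> Obj C" "V \<in> Obj C" using assms by auto
  then show ?thesis using assms by (simp add: equivariant_iff)
qed

text \<open>A trivialization over \<open>f : U \<rightarrow> Y\<close>, seen as an equivariant cartesian arrow \<open>G \<times> U \<rightarrow> P\<close>.
  In this form restriction and change of base are the pasting law.\<close>

definition trivializes :: "('o, 'a) gbundle \<Rightarrow> 'a \<Rightarrow> 'a \<Rightarrow> bool" where
  "trivializes P f t \<longleftrightarrow> is_pullback C (proj P) f (Prod C K (src f)) t (pr2 C K (src f)) \<and>
     equivariant C G (Prod C K (src f)) (mult_action C G (src f)) (total P) (act P) t"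

text \<open>An isomorphism \<open>\<phi> : f\<^sup>*P \<rightarrow> G \<times> U\<close> corresponds to the first component of its inverse; since the inverse is
  equivariant, so is this component, and it is cartesian because pullbacks are unique up to
  isomorphism.\<close>

lemma trivial_bundle_iso_iff:
  assumes P: "G_object P" and f: "arr f" "tgt f = tgt (proj P)"
  shows "(\<exists>\<phi>. iso_arrow C \<phi> \<and>
      bundle_morphism C G (pullback_bundle C G f P) (trivial_bundle C G (src f)) \<phi>) \<longleftrightarrow> (\<exists>t. trivializes P f t)"
    (is "?L \<longleftrightarrow> ?R")
proof
  note [simp] = assms pullback_act_arr(1-3)[OF assms] pullback_bundle_simps
  have sq: "is_pullback C (proj P) f (pb C (proj P) f) (pb1 C (proj P) f) (pb2 C (proj P) f)"
    by (rule pb) simp_all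
  {
    assume ?L
    then obtain \<phi> j where \<phi>: "inverse_arrows C \<phi> j"
      "equivariant C G (pb C (proj P) f) (act (pullback_bundle C G f P)) (Prod C K (src f)) (mult_action C G (src f)) \<phi>"
      "pr2 C K (src f) \<cdot> \<phi> = pb2 C (proj P) f"
      by (auto simp: iso_arrow_def bundle_morphism_def trivial_bundle_def)
    then have [simp]: "arr \<phi>" "src \<phi> = pb C (proj P) f" "tgt \<phi> = Prod C K (src f)"
      by (simp_all add: equivariant_iff)
    have [simp]: "arr j" "tgt j = pb C (proj P) f" "src j = Prod C K (src f)"
      and j: "inverse_arrows C j \<phi>" "\<phi> \<cdot> j = Ident C (Prod C K (src f))"
      using \<phi>(1) by (simp_all add: inverse_arrows_def Hom_iff)
    have pr: "pb2 C (proj P) f \<cdot> j = pr2 C K (src f)"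
      using comp_eq_arr[OF \<phi>(3), of j] j(2) by simp
    have "is_pullback C (proj P) f (Prod C K (src f)) (pb1 C (proj P) f \<cdot> j) (pb2 C (proj P) f \<cdot> j)"
      by (rule pullback_iso[OF sq _ _ j(1)]) simp_all
    moreover have "equivariant C G (Prod C K (src f)) (mult_action C G (src f)) (total P) (act P) (pb1 C (proj P) f \<cdot> j)"
      by (rule equivariant_comp[OF equivariant_inverse[OF \<phi>(2,1)] pb1_equivariant[OF P f]]) simp_all
    ultimately show ?R unfolding trivializes_def pr by blast
  }
  {
    assume ?R
    then obtain t where t: "is_pullback C (proj P) f (Prod C K (src f)) t (pr2 C K (src f))"
     "equivariant C G (Prod C K (src f)) (mult_action C G (src f)) (total P) (act P) t"
      by (auto simp: trivializes_def)
    note t1 = is_pullbackD[OF t(1)]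
    have [simp]: "arr t" "src t = Prod C K (src f)" "tgt t = total P"
      and e: "proj P \<cdot> t = f \<cdot> pr2 C K (src f)"
      using t1 by simp_all
    define i where "i = lift C (proj P) f t (pr2 C K (src f))"
    have i [simp]: "arr i" "src i = Prod C K (src f)" "tgt i = pb C (proj P) f"
      "pb1 C (proj P) f \<cdot> i = t" "pb2 C (proj P) f \<cdot> i = pr2 C K (src f)"
      using e by (simp_all add: i_def)
    have "iso_arrow C i"
      by (rule pullback_comparison_iso[OF t(1) sq]) simp_all
    then obtain \<phi> where \<phi>: "inverse_arrows C i \<phi>" by (auto simp: iso_arrow_def)
    then have [simp]: "arr \<phi>" "tgt \<phi> = Prod C K (src f)" "src \<phi> = pb C (proj P) f"
      and j: "inverse_arrows C \<phi> i" "i \<cdot> \<phi> = Ident C (pb C (proj P) f)"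
      by (simp_all add: inverse_arrows_def Hom_iff)
    have "equivariant C G (Prod C K (src f)) (mult_action C G (src f)) (src f) (trivial_action C G (src f)) (pr2 C K (src f))"
      using pr2_equivariant[of "Ident C (src f)" "src f" "src f"] by simp
    then have "equivariant C G (Prod C K (src f)) (mult_action C G (src f)) (pb C (proj P) f) (act (pullback_bundle C G f P)) i"
      unfolding i_def by (intro lift_equivariant t(2) e) simp_all
    from equivariant_inverse[OF this \<phi>]
    have "equivariant C G (pb C (proj P) f) (act (pullback_bundle C G f P)) (Prod C K (src f)) (mult_action C G (src f)) \<phi>"
      by simp
    moreover have "pr2 C K (src f) \<cdot> \<phi> = pb2 C (proj P) f"
      using comp_eq_arr[OF i(5), of \<phi>] j(2) by simp
    ultimately show ?L using j(1) by (auto simp: iso_arrow_def bundle_morphism_def trivial_bundle_def)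
  }
qed

text \<open>\<open>id \<times> h\<close> is the base change of the projection \<open>G \<times> V \<rightarrow> V\<close> along \<open>h\<close>. This is what makes trivial bundles
  stable under restriction.\<close>

lemma product_square:
  assumes "arr h"
  shows "is_pullback C (pr2 C K (tgt h)) h (Prod C K (src h))
    (prod_map C (Ident C K) h) (pr2 C K (src h))"
proof (rule is_pullbackI)
  note [simp] = assms
  fix a b assume [simp]: "arr a" "arr b" "src a = src b"
    and ab: "tgt a = src (pr2 C K (tgt h))" "tgt b = src h" "pr2 C K (tgt h) \<cdot> a = h \<cdot> b"
  have [simp]: "tgt a = Prod C K (tgt h)" "tgt b = src h" using ab by simp_all
  have "pair C (pr1 C K (tgt h) \<cdot> a) (h \<cdot> b) = a" unfolding ab(3)[symmetric] by (simp del: pair_comp)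
  then show "\<exists>k. arr k \<and> src k = src a \<and> tgt k = Prod C K (src h) \<and>
      prod_map C (Ident C K) h \<cdot> k = a \<and> pr2 C K (src h) \<cdot> k = b"
    by (intro exI[of _ "pair C (pr1 C K (tgt h) \<cdot> a) b"]) (simp del: pair_comp)
next
  note [simp] = assms
  fix a b assume ab [simp]: "arr a" "arr b" "src a = src b" "tgt a = Prod C K (src h)" "tgt b = Prod C K (src h)"
    and e: "prod_map C (Ident C K) h \<cdot> a = prod_map C (Ident C K) h \<cdot> b" "pr2 C K (src h) \<cdot> a = pr2 C K (src h) \<cdot> b"
  have "pr1 C K (tgt h) \<cdot> (prod_map C (Ident C K) h \<cdot> a) = pr1 C K (tgt h) \<cdot> (prod_map C (Ident C K) h \<cdot> b)"
    using e(1) by simp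
  then have "pr1 C K (src h) \<cdot> a = pr1 C K (src h) \<cdot> b"
    by (simp add: prod_map_def del: pair_comp)
  then show "a = b" using e(2) by - (rule pair_ext[of K "src h"]; simp)
qed (use assms in \<open>simp_all add: prod_map_def\<close>)

lemma trivializes_restrict:
  assumes P: "G_object P" and f: "arr f" "tgt f = tgt (proj P)" and h: "arr h" "tgt h = src f"
    and t: "trivializes P f t"
  shows "trivializes P (f \<cdot> h) (t \<cdot> prod_map C (Ident C K) h)"
proof -
  note [simp] = P f h
  have sq: "is_pullback C (proj P) f (Prod C K (src f)) t (pr2 C K (src f))"
   and e: "equivariant C G (Prod C K (src f)) (mult_action C G (src f)) (total P) (act P) t"
    using t by (auto simp: trivializes_def)
  have "is_pullback C (proj P) (f \<cdot> h) (Prod C K (src h)) (t \<cdot> prod_map C (Ident C K) h) (pr2 C K (src h))"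
    by (rule pullback_paste[OF sq]) (use product_square[of h] in simp_all)
  moreover have "equivariant C G (Prod C K (src h)) (mult_action C G (src h)) (Prod C K (src f)) (mult_action C G (src f))
      (prod_map C (Ident C K) h)"
  proof -
    have "src f \<in> Obj C" by simp
    then show ?thesis by (simp add: equivariant_iff prod_map_def)
  qed
  ultimately show ?thesis unfolding trivializes_def
    using equivariant_comp[OF _ e] by simp
qed

text \<open>By the pasting law a trivialization of \<open>Q\<close> over \<open>h\<close> gives one of \<open>P\<close> over \<open>f \<cdot> h\<close>, if \<open>Q\<close> is the
  base change of \<open>P\<close> along \<open>f\<close>, and by cancellation the converse holds as well.\<close>

lemma trivializes_push:
  assumes P: "G_object P" "G_object Q" and f: "arr f" "tgt f = tgt (proj P)" "src f = tgt (proj Q)"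
    and c: "is_pullback C (proj P) f (total Q) c (proj Q)" "equivariant C G (total Q) (act Q) (total P) (act P) c"
    and h: "arr h" "tgt h = src f" and t: "trivializes Q h t"
  shows "trivializes P (f \<cdot> h) (c \<cdot> t)"
proof -
  note [simp] = P f h
  have "is_pullback C (proj P) (f \<cdot> h) (Prod C K (src h)) (c \<cdot> t) (pr2 C K (src h))"
    by (rule pullback_paste[OF c(1)]) (use t in \<open>simp_all add: trivializes_def\<close>)
  then show ?thesis using t equivariant_comp[OF _ c(2)] unfolding trivializes_def by simp
qed

lemma trivializes_pullback:
  assumes P: "G_object P" and f: "arr f" "tgt f = tgt (proj P)" and h: "arr h" "tgt h = src f"
    and t: "trivializes P (f \<cdot> h) t"
  shows "\<exists>s. trivializes (pullback_bundle C G f P) h s"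
proof -
  note [simp] = assms(1-5) pullback_act_arr(1-3)[OF assms(1-3)] pullback_bundle_simps
  have sq: "is_pullback C (proj P) (f \<cdot> h) (Prod C K (src h)) t (pr2 C K (src h))"
    and e: "equivariant C G (Prod C K (src h)) (mult_action C G (src h)) (total P) (act P) t"
    using t by (auto simp: trivializes_def)
  have [simp]: "arr t" "src t = Prod C K (src h)" "tgt t = total P"
    and pt: "proj P \<cdot> t = f \<cdot> (h \<cdot> pr2 C K (src h))"
    using is_pullbackD[OF sq] by simp_all
  define s where "s = lift C (proj P) f t (h \<cdot> pr2 C K (src h))"
  have s [simp]: "arr s" "src s = Prod C K (src h)" "tgt s = pb C (proj P) f"
    "pb1 C (proj P) f \<cdot> s = t" "pb2 C (proj P) f \<cdot> s = h \<cdot> pr2 C K (src h)"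
    using pt by (simp_all add: s_def)
  have "is_pullback C (pb2 C (proj P) f) h (Prod C K (src h)) s (pr2 C K (src h))"
    by (rule pullback_cancel[where \<pi> = "proj P" and f = f and c = "pb1 C (proj P) f" and P = "pb C (proj P) f"])
      (use pb[of "proj P" f] sq in simp_all)
  moreover have "equivariant C G (Prod C K (src h)) (mult_action C G (src h)) (pb C (proj P) f) (act (pullback_bundle C G f P)) s"
    unfolding s_def by (intro lift_equivariant e pt pr2_equivariant) simp_all
  ultimately show ?thesis by (auto simp: trivializes_def)
qed

end

section \<open>Gluing arrows along covers\<close>

locale subcanonical_site = pullback_category C
  for C :: "('o, 'a, 'm) pcat_scheme" (structure) +
  fixes \<kappa> :: "'k rel" and \<tau> :: "'o \<Rightarrow> 'a set set"
  assumes site: "site \<kappa> C \<tau>" and subcanonical: "subcanonical C \<tau>"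
begin

lemma topology: "grothendieck_topology C \<tau>"
  using site by (simp add: site_def)

lemma cover_sieve: "S \<in> \<tau> Y \<Longrightarrow> Y \<in> Obj C \<Longrightarrow> sieve C Y S"
  using topology by (simp add: grothendieck_topology_def)

lemma cover_arr: "S \<in> \<tau> Y \<Longrightarrow> Y \<in> Obj C \<Longrightarrow> f \<in> S \<Longrightarrow> arr f \<and> tgt f = Y"
  using cover_sieve by (force simp: sieve_def)

lemma cover_comp: "S \<in> \<tau> Y \<Longrightarrow> Y \<in> Obj C \<Longrightarrow> f \<in> S \<Longrightarrow> arr g \<Longrightarrow> tgt g = src f \<Longrightarrow> f \<cdot> g \<in> S"
  using cover_sieve by (force simp: sieve_def)

lemma cover_pullback: "arr f \<Longrightarrow> S \<in> \<tau> (tgt f) \<Longrightarrow> pullback_sieve C f S \<in> \<tau> (src f)"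
  using topology by (simp add: grothendieck_topology_def)

lemma cover_local:
  assumes "Y \<in> Obj C" "S \<in> \<tau> Y" "sieve C Y R" "\<And>f. f \<in> S \<Longrightarrow> pullback_sieve C f R \<in> \<tau> (src f)"
  shows "R \<in> \<tau> Y"
proof -
  have "\<forall>Y \<in> Obj C. \<forall>S \<in> \<tau> Y. \<forall>R. sieve C Y R \<and> (\<forall>f \<in> S. pullback_sieve C f R \<in> \<tau> (src f)) \<longrightarrow> R \<in> \<tau> Y"
    using topology unfolding grothendieck_topology_def by (elim conjE)
  then show ?thesis using assms by simp
qed

lemma cover_max: "Y \<in> Obj C \<Longrightarrow> {f \<in> Arr C. tgt f = Y} \<in> \<tau> Y"
  using topology by (simp add: grothendieck_topology_def)

text \<open>The local character of the topology gives this, because the larger sieve pulls back to the maximal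
  sieve along every arrow of the smaller one.\<close>

lemma cover_superset:
  assumes "Y \<in> Obj C" "S \<in> \<tau> Y" "sieve C Y R" "S \<subseteq> R"
  shows "R \<in> \<tau> Y"
proof (rule cover_local[OF assms(1-3)])
  fix f assume f: "f \<in> S"
  then have "arr f" using cover_arr assms by blast
  moreover have "pullback_sieve C f R = {g \<in> Arr C. tgt g = src f}"
    using cover_comp[OF assms(2,1) f] assms(4) by (auto simp: pullback_sieve_def)
  ultimately show "pullback_sieve C f R \<in> \<tau> (src f)" using cover_max by simp
qed

text \<open>The sheaf property of the representable presheaf of \<open>M\<close>, applied to the covering sieve that \<open>S\<close>
  induces on the domain of \<open>a\<close>. Since \<open>a\<close> is arbitrary, covers of the base can be used for the total space of
  a bundle and for its products with \<open>G\<close>.\<close>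

lemma arrow_ext_on_cover:
  assumes S: "S \<in> \<tau> (tgt a)" and a: "arr a"
    and h: "arr h" "arr k" "src h = src a" "src k = src a" "tgt h = tgt k"
    and eq: "\<And>x. arr x \<Longrightarrow> tgt x = src a \<Longrightarrow> a \<cdot> x \<in> S \<Longrightarrow> h \<cdot> x = k \<cdot> x"
  shows "h = k"
proof -
  note [simp] = a h
  have M: "tgt k \<in> Obj C" by simp
  have U: "is_sheaf C \<tau> (representable C (tgt k))" using subcanonical M by (simp add: subcanonical_def)
  have "\<exists>!t. t \<in> sections (representable C (tgt k)) (src a) \<and>
     (\<forall>f \<in> pullback_sieve C a S. restriction (representable C (tgt k)) f t = k \<cdot> f)"
    by (rule U[unfolded is_sheaf_def, rule_format])
      (use cover_pullback[OF a S] in \<open>auto simp: representable_def Hom_iff pullback_sieve_def\<close>)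
  then have "\<exists>!t. t \<in> Hom C (src a) (tgt k) \<and> (\<forall>f \<in> pullback_sieve C a S. t \<cdot> f = k \<cdot> f)"
    by (simp add: representable_def)
  moreover have "h \<in> Hom C (src a) (tgt k) \<and> (\<forall>f \<in> pullback_sieve C a S. h \<cdot> f = k \<cdot> f)"
    using eq by (auto simp: Hom_iff pullback_sieve_def)
  moreover have "k \<in> Hom C (src a) (tgt k) \<and> (\<forall>f \<in> pullback_sieve C a S. k \<cdot> f = k \<cdot> f)"
    by (simp add: Hom_iff)
  ultimately show "h = k" by blast
qed

lemma arrow_glue_on_cover:
  assumes S: "S \<in> \<tau> (tgt a)" and a: "arr a" and M: "M \<in> Obj C"
    and k: "\<And>x. arr x \<Longrightarrow> tgt x = src a \<Longrightarrow> a \<cdot> x \<in> S \<Longrightarrow> arr (k x) \<and> src (k x) = src x \<and> tgt (k x) = M"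
    and nat: "\<And>x w. arr x \<Longrightarrow> tgt x = src a \<Longrightarrow> a \<cdot> x \<in> S \<Longrightarrow> arr w \<Longrightarrow> tgt w = src x \<Longrightarrow> k (x \<cdot> w) = k x \<cdot> w"
  obtains h where "arr h" "src h = src a" "tgt h = M"
    "\<And>x. arr x \<Longrightarrow> tgt x = src a \<Longrightarrow> a \<cdot> x \<in> S \<Longrightarrow> h \<cdot> x = k x"
proof -
  note [simp] = a M
  have U: "is_sheaf C \<tau> (representable C M)" using subcanonical M by (simp add: subcanonical_def)
  have "\<exists>!t. t \<in> sections (representable C M) (src a) \<and>
     (\<forall>f \<in> pullback_sieve C a S. restriction (representable C M) f t = k f)"
    by (rule U[unfolded is_sheaf_def, rule_format])
      (use cover_pullback[OF a S] k nat in \<open>auto simp: representable_def Hom_iff pullback_sieve_def\<close>)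
  then obtain h where "h \<in> sections (representable C M) (src a) \<and>
     (\<forall>f \<in> pullback_sieve C a S. restriction (representable C M) f h = k f)" by blast
  then show ?thesis by (intro that[of h]) (auto simp: representable_def Hom_iff pullback_sieve_def)
qed

lemma generated_sieve_iff:
  assumes "\<And>i. i \<in> I \<Longrightarrow> arr (F i)"
  shows "y \<in> generated_sieve C I F \<longleftrightarrow>
    (\<exists>i u. i \<in> I \<and> arr u \<and> tgt u = src (F i) \<and> src u = src y \<and> F i \<cdot> u = y)"
proof
  assume "y \<in> generated_sieve C I F"
  then obtain i u where "i \<in> I" "arr u" "tgt u = src (F i)" "y = F i \<cdot> u"
    unfolding generated_sieve_def by blast
  then show "\<exists>i u. i \<in> I \<and> arr u \<and> tgt u = src (F i) \<and> src u = src y \<and> F i \<cdot> u = y"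
    using assms by (intro exI[of _ i] exI[of _ u]) simp
qed (auto simp: generated_sieve_def)

text \<open>The same two facts for a covering family \<open>F\<close>: an arrow out of the domain of \<open>a\<close> is determined by
  its values on the \<open>x\<close> for which \<open>a \<cdot> x\<close> factors through some \<open>F i\<close>.\<close>

lemma arrow_ext_on_family:
  assumes cov: "covering_family \<kappa> C \<tau> (tgt a) I F" and a: "arr a"
    and h: "arr h" "arr k" "src h = src a" "src k = src a" "tgt h = tgt k"
    and eq: "\<And>i x u. i \<in> I \<Longrightarrow> arr x \<Longrightarrow> tgt x = src a \<Longrightarrow> arr u \<Longrightarrow> tgt u = src (F i)
       \<Longrightarrow> src u = src x \<Longrightarrow> F i \<cdot> u = a \<cdot> x \<Longrightarrow> h \<cdot> x = k \<cdot> x"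
  shows "h = k"
proof (rule arrow_ext_on_cover[OF _ a h])
  show "generated_sieve C I F \<in> \<tau> (tgt a)" using cov by (simp add: covering_family_def)
next
  fix x assume "arr x" "tgt x = src a" "a \<cdot> x \<in> generated_sieve C I F"
  then show "h \<cdot> x = k \<cdot> x"
    using eq[of _ x] cov a generated_sieve_iff[of I F "a \<cdot> x"] by (fastforce simp: covering_family_def)
qed

text \<open>The family \<open>k\<close> may depend on the chosen factorization \<open>F i \<cdot> u\<close> of \<open>a \<cdot> x\<close>, as gluing data given on the
  members of a covering family do; the agreement on overlaps is the independence assumption.\<close>

lemma arrow_glue_on_family:
  assumes cov: "covering_family \<kappa> C \<tau> (tgt a) I F" and a: "arr a" and M: "M \<in> Obj C"
    and k: "\<And>i x u. i \<in> I \<Longrightarrow> arr x \<Longrightarrow> tgt x = src a \<Longrightarrow> arr u \<Longrightarrow> tgt u = src (F i)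
       \<Longrightarrow> src u = src x \<Longrightarrow> F i \<cdot> u = a \<cdot> x \<Longrightarrow> arr (k i x u) \<and> src (k i x u) = src x \<and> tgt (k i x u) = M"
    and indep: "\<And>i j x u v. i \<in> I \<Longrightarrow> j \<in> I \<Longrightarrow> arr x \<Longrightarrow> tgt x = src a \<Longrightarrow> arr u \<Longrightarrow> tgt u = src (F i)
       \<Longrightarrow> src u = src x \<Longrightarrow> F i \<cdot> u = a \<cdot> x \<Longrightarrow> arr v \<Longrightarrow> tgt v = src (F j)
       \<Longrightarrow> src v = src x \<Longrightarrow> F j \<cdot> v = a \<cdot> x \<Longrightarrow> k i x u = k j x v"
    and nat: "\<And>i x u w. i \<in> I \<Longrightarrow> arr x \<Longrightarrow> tgt x = src a \<Longrightarrow> arr u \<Longrightarrow> tgt u = src (F i)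
       \<Longrightarrow> src u = src x \<Longrightarrow> F i \<cdot> u = a \<cdot> x \<Longrightarrow> arr w \<Longrightarrow> tgt w = src x
       \<Longrightarrow> k i (x \<cdot> w) (u \<cdot> w) = k i x u \<cdot> w"
  obtains h where "arr h" "src h = src a" "tgt h = M"
    "\<And>i x u. i \<in> I \<Longrightarrow> arr x \<Longrightarrow> tgt x = src a \<Longrightarrow> arr u \<Longrightarrow> tgt u = src (F i)
       \<Longrightarrow> src u = src x \<Longrightarrow> F i \<cdot> u = a \<cdot> x \<Longrightarrow> h \<cdot> x = k i x u"
proof -
  let ?R = "generated_sieve C I F"
  have F: "\<And>i. i \<in> I \<Longrightarrow> arr (F i)" "\<And>i. i \<in> I \<Longrightarrow> tgt (F i) = tgt a" and R: "?R \<in> \<tau> (tgt a)"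
    using cov by (simp_all add: covering_family_def)
  have R_iff: "y \<in> ?R \<longleftrightarrow> (\<exists>i u. i \<in> I \<and> arr u \<and> tgt u = src (F i) \<and> src u = src y \<and> F i \<cdot> u = y)" for y
    by (rule generated_sieve_iff) (rule F(1))
  define P where "P x = (\<lambda>(i, u). i \<in> I \<and> arr u \<and> tgt u = src (F i) \<and> src u = src x \<and> F i \<cdot> u = a \<cdot> x)" for x
  define k' where "k' x = (case SOME iu. P x iu of (i, u) \<Rightarrow> k i x u)" for x
  have k': "k' x = k i x u" if x: "arr x" "tgt x = src a" and P: "P x (i, u)" for x i u
  proof -
    obtain j v where jv: "(SOME iu. P x iu) = (j, v)" by fastforce
    then have "P x (j, v)" using someI[of "P x", OF P] by simp
    then have "k i x u = k j x v" using P x by (intro indep) (simp_all add: P_def)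
    then show ?thesis by (simp add: k'_def jv)
  qed
  have PR: "\<exists>i u. P x (i, u)" if "arr x" "tgt x = src a" "a \<cdot> x \<in> ?R" for x
    using that a R_iff[of "a \<cdot> x"] by (auto simp: P_def)
  obtain h where h: "arr h" "src h = src a" "tgt h = M"
    and hx: "\<And>x. arr x \<Longrightarrow> tgt x = src a \<Longrightarrow> a \<cdot> x \<in> ?R \<Longrightarrow> h \<cdot> x = k' x"
  proof (rule arrow_glue_on_cover[OF R a M, of k'])
    fix x assume x: "arr x" "tgt x = src a" "a \<cdot> x \<in> ?R"
    then obtain i u where P: "P x (i, u)" using PR by blast
    then show "arr (k' x) \<and> src (k' x) = src x \<and> tgt (k' x) = M"
      using k[of i x u] x(1,2) unfolding k'[OF x(1,2) P] P_def by simp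
  next
    fix x w assume x: "arr x" "tgt x = src a" "a \<cdot> x \<in> ?R" and w: "arr w" "tgt w = src x"
    then obtain i u where P: "P x (i, u)" using PR by blast
    then have u: "i \<in> I" "arr u" "tgt u = src (F i)" "src u = src x" "F i \<cdot> u = a \<cdot> x"
      by (simp_all add: P_def)
    have "P (x \<cdot> w) (i, u \<cdot> w)" using comp_eq_comp[OF u(5), of w] x w u(1-4) F a by (simp add: P_def)
    then have "k' (x \<cdot> w) = k i (x \<cdot> w) (u \<cdot> w)" using x w by (intro k') simp_all
    then show "k' (x \<cdot> w) = k' x \<cdot> w" using nat[of i x u w] k'[OF x(1,2) P] u x w by simp
  qed (rule that)
  show ?thesis
  proof (rule that[OF h])
    fix i x u assume A: "i \<in> I" "arr x" "tgt x = src a" "arr u" "tgt u = src (F i)"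
       "src u = src x" "F i \<cdot> u = a \<cdot> x"
    then have "a \<cdot> x \<in> ?R" unfolding R_iff
      using a by (intro exI[of _ i] exI[of _ u]) simp
    then show "h \<cdot> x = k i x u" using hx[of x] k'[of x i u] A by (simp add: P_def)
  qed
qed

end


section \<open>Small colimits and base change\<close>

text \<open>Cocompleteness and preservation of colimits speak of index categories inside the type that carries
  \<open>\<kappa>\<close>. A small category of any type can be moved there along injections \<open>u\<close>, \<open>v\<close> of its objects and arrows,
  and cocones and colimits are the same before and after.\<close>

definition reindexed_category :: "('i \<Rightarrow> 'k) \<Rightarrow> ('j \<Rightarrow> 'k) \<Rightarrow> ('i, 'j, 'n) cat_scheme \<Rightarrow> ('k, 'k) cat" where
  "reindexed_category u v J = \<lparr>Obj = u ` Obj J, Arr = v ` Arr J,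
     Dom = (\<lambda>a. u (Dom J (inv_into (Arr J) v a))), Cod = (\<lambda>a. u (Cod J (inv_into (Arr J) v a))),
     Ident = (\<lambda>i. v (Ident J (inv_into (Obj J) u i))),
     Comp = (\<lambda>b a. v (Comp J (inv_into (Arr J) v b) (inv_into (Arr J) v a)))\<rparr>"

definition reindexed_functor :: "('i \<Rightarrow> 'k) \<Rightarrow> ('j \<Rightarrow> 'k) \<Rightarrow> ('i, 'j, 'n) cat_scheme
    \<Rightarrow> ('i, 'j, 'o, 'a) cfunctor \<Rightarrow> ('k, 'k, 'o, 'a) cfunctor" where
  "reindexed_functor u v J D = \<lparr>omap = omap D \<circ> inv_into (Obj J) u, amap = amap D \<circ> inv_into (Arr J) v\<rparr>"

locale reindexing =
  fixes J :: "('i, 'j, 'n) cat_scheme" and u :: "'i \<Rightarrow> 'k" and v :: "'j \<Rightarrow> 'k"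
  assumes J: "category J" and u: "inj_on u (Obj J)" and v: "inj_on v (Arr J)"
begin

abbreviation "R \<equiv> reindexed_category u v J"
abbreviation "reindexed D \<equiv> reindexed_functor u v J D"

lemma reindexed_simps [simp]:
  "Obj R = u ` Obj J" "Arr R = v ` Arr J"
  "a \<in> Arr J \<Longrightarrow> Dom R (v a) = u (Dom J a)" "a \<in> Arr J \<Longrightarrow> Cod R (v a) = u (Cod J a)"
  "i \<in> Obj J \<Longrightarrow> Ident R (u i) = v (Ident J i)"
  "a \<in> Arr J \<Longrightarrow> b \<in> Arr J \<Longrightarrow> Comp R (v b) (v a) = v (Comp J b a)"
  "i \<in> Obj J \<Longrightarrow> omap (reindexed D) (u i) = omap D i"
  "a \<in> Arr J \<Longrightarrow> amap (reindexed D) (v a) = amap D a"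
  using u v by (simp_all add: reindexed_category_def reindexed_functor_def)

lemma Hom_reindexedE:
  assumes "f \<in> Hom R A B"
  obtains a where "a \<in> Arr J" "f = v a" "A = u (Dom J a)" "B = u (Cod J a)"
  using assms by (auto simp: Hom_def)

lemma u_eq_iff: "i \<in> Obj J \<Longrightarrow> j \<in> Obj J \<Longrightarrow> u i = u j \<longleftrightarrow> i = j"
  using u by (auto dest: inj_onD)

lemma category_reindexed: "category R"
proof -
  interpret J: category J by (rule J)
  show ?thesis
  proof
    fix f assume "f \<in> Arr R" then show "Dom R f \<in> Obj R" "Cod R f \<in> Obj R" by auto
  next
    fix A assume "A \<in> Obj R" then show "Ident R A \<in> Hom R A A" by (auto simp: Hom_def)
  next
    fix f A B g D assume fg: "f \<in> Hom R A B" "g \<in> Hom R B D"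
    obtain a where a: "a \<in> Arr J" "f = v a" "A = u (Dom J a)" "B = u (Cod J a)" by (rule Hom_reindexedE[OF fg(1)])
    obtain b where b: "b \<in> Arr J" "g = v b" "B = u (Dom J b)" "D = u (Cod J b)" by (rule Hom_reindexedE[OF fg(2)])
    have "Cod J a = Dom J b" using a b u_eq_iff by simp
    then show "Comp R g f \<in> Hom R A D" using a b by (simp add: Hom_def)
  next
    fix f A B g D h E assume fg: "f \<in> Hom R A B" "g \<in> Hom R B D" "h \<in> Hom R D E"
    obtain a where a: "a \<in> Arr J" "f = v a" "A = u (Dom J a)" "B = u (Cod J a)" by (rule Hom_reindexedE[OF fg(1)])
    obtain b where b: "b \<in> Arr J" "g = v b" "B = u (Dom J b)" "D = u (Cod J b)" by (rule Hom_reindexedE[OF fg(2)])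
    obtain c where c: "c \<in> Arr J" "h = v c" "D = u (Dom J c)" "E = u (Cod J c)" by (rule Hom_reindexedE[OF fg(3)])
    have "Cod J a = Dom J b" "Cod J b = Dom J c" using a b c u_eq_iff by simp_all
    then show "Comp R h (Comp R g f) = Comp R (Comp R h g) f" using a b c by simp
  next
    fix f A B assume "f \<in> Hom R A B"
    then obtain a where a: "a \<in> Arr J" "f = v a" "A = u (Dom J a)" "B = u (Cod J a)" by (rule Hom_reindexedE)
    then show "Comp R (Ident R B) f = f" "Comp R f (Ident R A) = f" by simp_all
  qed
qed

lemma functor_reindexed:
  assumes "is_functor J C D" shows "is_functor R C (reindexed D)"
proof -
  interpret J: category J by (rule J)
  show ?thesis using assms u_eq_iff unfolding is_functor_def by simp
qed

lemma cocone_reindexed_iff: "cocone C R (reindexed D) L l \<longleftrightarrow> cocone C J D L (l \<circ> u)"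
proof -
  interpret J: category J by (rule J)
  show ?thesis unfolding cocone_def by simp
qed

lemma cocone_cong:
  assumes "\<And>i. i \<in> Obj J \<Longrightarrow> l i = l' i" shows "cocone C J D L l \<longleftrightarrow> cocone C J D L l'"
proof -
  interpret J: category J by (rule J)
  show ?thesis unfolding cocone_def using assms by simp
qed

lemma colimit_cong:
  assumes "\<And>i. i \<in> Obj J \<Longrightarrow> l i = l' i" shows "colimit C J D L l \<longleftrightarrow> colimit C J D L l'"
  unfolding colimit_def using assms cocone_cong[of l l' C D L] by simp

lemma colimit_reindexed_iff: "colimit C R (reindexed D) L l \<longleftrightarrow> colimit C J D L (l \<circ> u)"
proof -
  have "(\<forall>M k. cocone C J D M k \<longrightarrow> Q M k) \<longleftrightarrow> (\<forall>M k. cocone C R (reindexed D) M k \<longrightarrow> Q M (k \<circ> u))"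
    if Q: "\<And>M k k'. (\<And>i. i \<in> Obj J \<Longrightarrow> k i = k' i) \<Longrightarrow> Q M k = Q M k'" for Q
  proof (intro iffI allI impI)
    \<comment> \<open>A cocone on the original diagram is one on the reindexed diagram, precomposed with the inverse of \<open>u\<close>.\<close>
    fix M k assume A: "\<forall>M k. cocone C R (reindexed D) M k \<longrightarrow> Q M (k \<circ> u)" "cocone C J D M k"
    have e: "k i = (k \<circ> inv_into (Obj J) u \<circ> u) i" if "i \<in> Obj J" for i using u that by simp
    have "cocone C R (reindexed D) M (k \<circ> inv_into (Obj J) u)"
      unfolding cocone_reindexed_iff using A(2) cocone_cong[of k "k \<circ> inv_into (Obj J) u \<circ> u" C D M, OF e] by blast
    then have "Q M (k \<circ> inv_into (Obj J) u \<circ> u)" using A(1) by blast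
    then show "Q M k" using Q[of k "k \<circ> inv_into (Obj J) u \<circ> u" M, OF e] by blast
  qed (simp add: cocone_reindexed_iff)
  from this[of "\<lambda>M k. \<exists>!h. h \<in> Hom C L M \<and> (\<forall>i \<in> Obj J. Comp C h (l (u i)) = k i)"]
  show ?thesis unfolding colimit_def cocone_reindexed_iff by simp
qed

end

lemma small_inj:
  fixes \<kappa> :: "'k rel"
  assumes "smallness_cardinal \<kappa>" "small \<kappa> A"
  obtains u :: "'x \<Rightarrow> 'k" where "inj_on u A"
proof -
  have "Card_order \<kappa>" using assms(1) by (simp add: smallness_cardinal_def cinfinite_def)
  then have "(card_of A, card_of (Field \<kappa>)) \<in> ordLeq"
    using assms(2) card_of_Field_ordIso ordIso_symmetric ordLess_imp_ordLeq ordLeq_ordIso_trans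
    unfolding small_def by blast
  then have "\<exists>u :: 'x \<Rightarrow> 'k. inj_on u A \<and> u ` A \<subseteq> Field \<kappa>" by (simp only: card_of_ordLeq)
  then show ?thesis using that by (elim exE conjE)
qed

lemma small_image: "small \<kappa> A \<Longrightarrow> small \<kappa> (f ` A)"
  unfolding small_def using card_of_image ordLeq_ordLess_trans by blast

lemma small_reindexing:
  fixes \<kappa> :: "'k rel" and J :: "('i, 'j, 'n) cat_scheme"
  assumes "smallness_cardinal \<kappa>" "small_category \<kappa> J"
  obtains u :: "'i \<Rightarrow> 'k" and v :: "'j \<Rightarrow> 'k" where "reindexing J u v" "small_category \<kappa> (reindexed_category u v J)"
proof -
  obtain u :: "'i \<Rightarrow> 'k" and v :: "'j \<Rightarrow> 'k" where uv: "inj_on u (Obj J)" "inj_on v (Arr J)"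
    using assms small_inj unfolding small_category_def by metis
  interpret reindexing J u v
    using assms uv by (simp add: reindexing_def small_category_def)
  show ?thesis
    by (rule that[of u v, OF reindexing_axioms])
      (use assms category_reindexed in \<open>simp add: small_category_def small_image\<close>)
qed

lemma cocomplete_colimit:
  fixes \<kappa> :: "'k rel" and J :: "('i, 'j, 'n) cat_scheme"
  assumes "smallness_cardinal \<kappa>" "cocomplete \<kappa> C" "small_category \<kappa> J" "is_functor J C D"
  obtains L l where "colimit C J D L l"
proof -
  obtain u :: "'i \<Rightarrow> 'k" and v :: "'j \<Rightarrow> 'k" where uv: "reindexing J u v" "small_category \<kappa> (reindexed_category u v J)"
    by (rule small_reindexing[OF assms(1,3)])
  interpret reindexing J u v by (rule uv)
  obtain L l where "colimit C R (reindexed D) L l"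
    using assms(2) uv(2) functor_reindexed[OF assms(4)] unfolding cocomplete_def by blast
  then show ?thesis using that unfolding colimit_reindexed_iff by blast
qed

lemma preserves_small_colimit:
  fixes \<kappa> :: "'k rel" and J :: "('i, 'j, 'n) cat_scheme"
  assumes "smallness_cardinal \<kappa>" "preserves_colimits \<kappa> A B F" "small_category \<kappa> J" "is_functor J A D"
    "colimit A J D L l"
  shows "colimit B J (comp_functor F D) (omap F L) (\<lambda>i. amap F (l i))"
proof -
  obtain u :: "'i \<Rightarrow> 'k" and v :: "'j \<Rightarrow> 'k" where uv: "reindexing J u v" "small_category \<kappa> (reindexed_category u v J)"
    by (rule small_reindexing[OF assms(1,3)])
  interpret reindexing J u v by (rule uv)
  have e: "l i = (l \<circ> inv_into (Obj J) u \<circ> u) i" if "i \<in> Obj J" for i using u that by simp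
  have "colimit A J D L (l \<circ> inv_into (Obj J) u \<circ> u)"
    using assms(5) colimit_cong[of l "l \<circ> inv_into (Obj J) u \<circ> u" A D L, OF e] by blast
  then have "colimit A R (reindexed D) L (l \<circ> inv_into (Obj J) u)"
    unfolding colimit_reindexed_iff .
  then have "colimit B R (comp_functor F (reindexed D)) (omap F L) (\<lambda>i. amap F ((l \<circ> inv_into (Obj J) u) i))"
    using assms(2) uv(2) functor_reindexed[OF assms(4)] unfolding preserves_colimits_def by blast
  moreover have "comp_functor F (reindexed D) = reindexed (comp_functor F D)"
    by (simp add: comp_functor_def reindexed_functor_def o_assoc)
  ultimately have "colimit B J (comp_functor F D) (omap F L) ((\<lambda>i. amap F ((l \<circ> inv_into (Obj J) u) i)) \<circ> u)"
    using colimit_reindexed_iff by metis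
  then show ?thesis
    using colimit_cong[of "(\<lambda>i. amap F ((l \<circ> inv_into (Obj J) u) i)) \<circ> u" "\<lambda>i. amap F (l i)"] u by fastforce
qed

context category
begin

text \<open>A diagram with colimit \<open>L\<close> becomes a diagram over \<open>Y\<close> by composing its cocone with \<open>\<pi> : L \<rightarrow> Y\<close>.\<close>

definition slice_diagram :: "('i, 'j, 'n) cat_scheme \<Rightarrow> ('i, 'j, 'o, 'a) cfunctor \<Rightarrow> ('i \<Rightarrow> 'a) \<Rightarrow> 'a
    \<Rightarrow> ('i, 'j, 'a, 'a \<times> 'a \<times> 'a) cfunctor" where
  "slice_diagram J D l \<pi> = \<lparr>omap = (\<lambda>i. \<pi> \<cdot> l i), amap = (\<lambda>a. (\<pi> \<cdot> l (Dom J a), amap D a, \<pi> \<cdot> l (Cod J a)))\<rparr>"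

lemma slice_Hom_iff:
  "h \<in> Hom (slice C Y) f f' \<longleftrightarrow> (\<exists>k. h = (f, k, f') \<and> arr f \<and> tgt f = Y \<and> arr f' \<and> tgt f' = Y
     \<and> arr k \<and> src k = src f \<and> tgt k = src f' \<and> f' \<cdot> k = f)"
  by (auto simp: slice_def Hom_def)

lemma slice_Comp [simp]: "Comp (slice C Y) (f1, k, f2) (f0, h, f3) = (f0, k \<cdot> h, f2)"
  by (simp add: slice_def)

lemma slice_Obj [simp]: "f \<in> Obj (slice C Y) \<longleftrightarrow> arr f \<and> tgt f = Y"
  by (simp add: slice_def)

text \<open>The forgetful functor from a slice category creates colimits: an arrow out of \<open>L\<close> that is compatible
  with the cocones lies over \<open>Y\<close>, because both ways to \<open>Y\<close> agree on the diagram.\<close>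

lemma
  assumes J: "category J" and D: "is_functor J C D" and L: "colimit C J D L l"
    and \<pi>: "arr \<pi>" "src \<pi> = L" "tgt \<pi> = Y"
  shows slice_diagram_functor: "is_functor J (slice C Y) (slice_diagram J D l \<pi>)"
    and slice_diagram_colimit: "colimit (slice C Y) J (slice_diagram J D l \<pi>) \<pi> (\<lambda>i. (\<pi> \<cdot> l i, l i, \<pi>))"
proof -
  interpret J: category J by (rule J)
  have D': "\<And>i. i \<in> Obj J \<Longrightarrow> omap D i \<in> Obj C"
    "\<And>a. a \<in> Arr J \<Longrightarrow> arr (amap D a)" "\<And>a. a \<in> Arr J \<Longrightarrow> src (amap D a) = omap D (Dom J a)"
    "\<And>a. a \<in> Arr J \<Longrightarrow> tgt (amap D a) = omap D (Cod J a)"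
    "\<And>i. i \<in> Obj J \<Longrightarrow> amap D (Ident J i) = Ident C (omap D i)"
    "\<And>a b. a \<in> Arr J \<Longrightarrow> b \<in> Arr J \<Longrightarrow> Cod J a = Dom J b \<Longrightarrow> amap D (Comp J b a) = amap D b \<cdot> amap D a"
    using D by (auto simp: is_functor_def Hom_iff)
  have l: "\<And>i. i \<in> Obj J \<Longrightarrow> arr (l i)" "\<And>i. i \<in> Obj J \<Longrightarrow> src (l i) = omap D i"
    "\<And>i. i \<in> Obj J \<Longrightarrow> tgt (l i) = L" "\<And>a. a \<in> Arr J \<Longrightarrow> l (Cod J a) \<cdot> amap D a = l (Dom J a)"
    using L by (auto simp: colimit_def cocone_def Hom_iff)
  note [simp] = D' l \<pi>
  show "is_functor J (slice C Y) (slice_diagram J D l \<pi>)"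
    unfolding is_functor_def slice_Hom_iff slice_diagram_def by (simp add: slice_def)
  show "colimit (slice C Y) J (slice_diagram J D l \<pi>) \<pi> (\<lambda>i. (\<pi> \<cdot> l i, l i, \<pi>))"
    unfolding colimit_def
  proof (intro conjI allI impI)
    show "cocone (slice C Y) J (slice_diagram J D l \<pi>) \<pi> (\<lambda>i. (\<pi> \<cdot> l i, l i, \<pi>))"
      unfolding cocone_def slice_diagram_def slice_Hom_iff by simp
  next
    fix m k assume k: "cocone (slice C Y) J (slice_diagram J D l \<pi>) m k"
    define k' where "k' i = fst (snd (k i))" for i
    have m: "arr m" "tgt m = Y" using k by (simp_all add: cocone_def)
    have k': "k i = (\<pi> \<cdot> l i, k' i, m)" "arr (k' i)" "src (k' i) = omap D i" "tgt (k' i) = src m" 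
       "m \<cdot> k' i = \<pi> \<cdot> l i" if "i \<in> Obj J" for i
      using k that unfolding cocone_def slice_Hom_iff k'_def slice_diagram_def by auto
    have "k' (Cod J a) \<cdot> amap D a = k' (Dom J a)" if "a \<in> Arr J" for a
    proof -
      have "Comp (slice C Y) (k (Cod J a)) (\<pi> \<cdot> l (Dom J a), amap D a, \<pi> \<cdot> l (Cod J a)) = k (Dom J a)"
        using k that by (simp add: cocone_def slice_diagram_def)
      then show ?thesis using that k'(1)[of "Cod J a"] k'(1)[of "Dom J a"] by simp
    qed
    then have "cocone C J D (src m) k'" using k' m by (simp add: cocone_def Hom_iff)
    then have ex: "\<exists>!h. h \<in> Hom C L (src m) \<and> (\<forall>i \<in> Obj J. h \<cdot> l i = k' i)"
      using L by (simp add: colimit_def)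
    then obtain h where h: "arr h" "src h = L" "tgt h = src m" "\<And>i. i \<in> Obj J \<Longrightarrow> h \<cdot> l i = k' i"
      by (auto simp: Hom_iff)
    note [simp] = h(1-3) m
    have "cocone C J D Y (\<lambda>i. \<pi> \<cdot> l i)" unfolding cocone_def using Cod_in_Obj[OF \<pi>(1)] by (simp add: Hom_iff)
    then have "\<exists>!h. h \<in> Hom C L Y \<and> (\<forall>i \<in> Obj J. h \<cdot> l i = \<pi> \<cdot> l i)"
      using L by (simp add: colimit_def)
    moreover have "\<pi> \<in> Hom C L Y \<and> (\<forall>i \<in> Obj J. \<pi> \<cdot> l i = \<pi> \<cdot> l i)" by (simp add: Hom_iff)
    moreover have "m \<cdot> h \<in> Hom C L Y \<and> (\<forall>i \<in> Obj J. (m \<cdot> h) \<cdot> l i = \<pi> \<cdot> l i)"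
      using h(4) k'(5) by (simp add: Hom_iff)
    ultimately have mh: "m \<cdot> h = \<pi>" by blast
    show "\<exists>!h. h \<in> Hom (slice C Y) \<pi> m \<and> (\<forall>i \<in> Obj J. Comp (slice C Y) h (\<pi> \<cdot> l i, l i, \<pi>) = k i)"
    proof (rule ex1I[of _ "(\<pi>, h, m)"])
      show "(\<pi>, h, m) \<in> Hom (slice C Y) \<pi> m \<and> (\<forall>i \<in> Obj J. Comp (slice C Y) (\<pi>, h, m) (\<pi> \<cdot> l i, l i, \<pi>) = k i)"
        using mh h(4) k'(1) by (simp add: slice_Hom_iff)
    next
      fix h' assume h': "h' \<in> Hom (slice C Y) \<pi> m \<and> (\<forall>i \<in> Obj J. Comp (slice C Y) h' (\<pi> \<cdot> l i, l i, \<pi>) = k i)"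
      then obtain h2 where h2: "h' = (\<pi>, h2, m)" "h2 \<in> Hom C L (src m)"
        by (auto simp: slice_Hom_iff Hom_iff)
      then have "h2 \<in> Hom C L (src m) \<and> (\<forall>i \<in> Obj J. h2 \<cdot> l i = k' i)" using h' k'(1) by simp
      moreover have "h \<in> Hom C L (src m) \<and> (\<forall>i \<in> Obj J. h \<cdot> l i = k' i)" using h by (simp add: Hom_iff)
      ultimately have "h2 = h" using ex by blast
      then show "h' = (\<pi>, h, m)" using h2 by simp
    qed
  qed
qed

end

text \<open>The shape of the diagram by which an object is glued from pieces: a vertex for each member of a
  covering family, and for each pair of members an edge object with arrows to both vertices.\<close>

datatype 'k span_obj = Vertex 'k | Edge 'k 'k
datatype 'k span_arr = Id "'k span_obj" | Source 'k 'k | Target 'k 'k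

definition span_category :: "'k set \<Rightarrow> ('k span_obj, 'k span_arr) cat" where
  "span_category I = \<lparr>
     Obj = Vertex ` I \<union> (\<lambda>(i, j). Edge i j) ` (I \<times> I),
     Arr = Id ` (Vertex ` I \<union> (\<lambda>(i, j). Edge i j) ` (I \<times> I))
       \<union> (\<lambda>(i, j). Source i j) ` (I \<times> I) \<union> (\<lambda>(i, j). Target i j) ` (I \<times> I),
     Dom = (\<lambda>a. case a of Id x \<Rightarrow> x | Source i j \<Rightarrow> Edge i j | Target i j \<Rightarrow> Edge i j),
     Cod = (\<lambda>a. case a of Id x \<Rightarrow> x | Source i j \<Rightarrow> Vertex i | Target i j \<Rightarrow> Vertex j),
     Ident = Id,
     Comp = (\<lambda>b a. case a of Id x \<Rightarrow> b | _ \<Rightarrow> a)\<rparr>"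

lemma small_Un:
  fixes \<kappa> :: "'k rel" and A B :: "'x set"
  assumes "smallness_cardinal \<kappa>" "small \<kappa> A" "small \<kappa> B"
  shows "small \<kappa> (A \<union> B)"
  using assms card_of_Un_ordLess_infinite_Field[of \<kappa> A B]
  unfolding small_def smallness_cardinal_def cinfinite_def by blast

text \<open>A finite set is small because \<open>\<kappa>\<close> is infinite, and an infinite one is as large as its square.\<close>

lemma small_square:
  fixes \<kappa> :: "'k rel"
  assumes "smallness_cardinal \<kappa>" "small \<kappa> A"
  shows "small \<kappa> (A \<times> A)"
proof (cases "finite A")
  case True
  have "Card_order \<kappa>" "\<not> finite (Field \<kappa>)"
    using assms(1) by (simp_all add: smallness_cardinal_def cinfinite_def)
  moreover have "finite (Field (card_of (A \<times> A)))" using True by (simp add: Field_card_of)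
  ultimately show ?thesis unfolding small_def
    using finite_ordLess_infinite card_of_Well_order card_order_on_well_order_on by blast
next
  case False
  then have "(card_of (A \<times> A), card_of A) \<in> ordIso" by (rule card_of_Times_same_infinite)
  then show ?thesis using assms(2) unfolding small_def by (rule ordIso_ordLess_trans)
qed

lemma small_span_category:
  assumes "smallness_cardinal \<kappa>" "small \<kappa> I"
  shows "small_category \<kappa> (span_category I)"
proof -
  have "category (span_category I)"
    by unfold_locales (auto simp: span_category_def Hom_def split: span_arr.splits)
  moreover have "small \<kappa> (Obj (span_category I))" "small \<kappa> (Arr (span_category I))"
    unfolding span_category_def by (simp_all add: small_Un small_image small_square assms)
  ultimately show ?thesis by (simp add: small_category_def)
qed

context pullback_category
begin

text \<open>The colimit \<open>L\<close>, regarded over the codomain of \<open>\<pi>\<close>, stays a colimit after base change along \<open>g\<close>. Its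
  universal property is used only for targets \<open>m\<close> over the domain of \<open>g\<close>, so that it can be taken
  directly from the slice category.\<close>

lemma base_change_universal:
  fixes \<kappa> :: "'k rel"
  assumes \<kappa>: "smallness_cardinal \<kappa>" and pres: "pullbacks_preserve_colimits \<kappa> C"
    and J: "small_category \<kappa> J" and D: "is_functor J C D" and L: "colimit C J D L l"
    and \<pi>: "arr \<pi>" "src \<pi> = L" and g: "arr g" "tgt g = tgt \<pi>"
    and m: "arr m" "tgt m = src g"
    and k: "\<And>i. i \<in> Obj J \<Longrightarrow> arr (k i)" "\<And>i. i \<in> Obj J \<Longrightarrow> src (k i) = pb C (\<pi> \<cdot> l i) g"
      "\<And>i. i \<in> Obj J \<Longrightarrow> tgt (k i) = src m" "\<And>i. i \<in> Obj J \<Longrightarrow> m \<cdot> k i = pb2 C (\<pi> \<cdot> l i) g"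
    and compat: "\<And>a. a \<in> Arr J \<Longrightarrow>
      k (Cod J a) \<cdot> pbmap g (\<pi> \<cdot> l (Dom J a)) (amap D a) (\<pi> \<cdot> l (Cod J a))
        = k (Dom J a)"
  shows "\<exists>!h. (arr h \<and> src h = pb C \<pi> g \<and> tgt h = src m \<and> m \<cdot> h = pb2 C \<pi> g) \<and>
    (\<forall>i \<in> Obj J. h \<cdot> pbmap g (\<pi> \<cdot> l i) (l i) \<pi> = k i)"
proof -
  have Jcat: "category J" using J by (simp add: small_category_def)
  interpret J: category J by (rule Jcat)
  let ?Z = "src g"
  let ?E = "comp_functor (base_change C g) (slice_diagram J D l \<pi>)"
  have l: "\<And>i. i \<in> Obj J \<Longrightarrow> arr (l i)" "\<And>i. i \<in> Obj J \<Longrightarrow> tgt (l i) = L"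
    using L by (auto simp: colimit_def cocone_def Hom_iff)
  note [simp] = \<pi> g m l k
  have "colimit (slice C ?Z) J ?E (omap (base_change C g) \<pi>) (\<lambda>i. amap (base_change C g) (\<pi> \<cdot> l i, l i, \<pi>))"
  proof (rule preserves_small_colimit[OF \<kappa> _ J])
    show "preserves_colimits \<kappa> (slice C (tgt g)) (slice C (src g)) (base_change C g)"
      using pres g(1) unfolding pullbacks_preserve_colimits_def by blast
  qed (use slice_diagram_functor[OF Jcat D L \<pi>] slice_diagram_colimit[OF Jcat D L \<pi>] in simp_all)
  moreover have "cocone (slice C ?Z) J ?E m (\<lambda>i. (pb2 C (\<pi> \<cdot> l i) g, k i, m))"
    unfolding cocone_def slice_Hom_iff
    by (simp add: comp_functor_def base_change_def slice_diagram_def compat)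
  ultimately have "\<exists>!h. h \<in> Hom (slice C ?Z) (pb2 C \<pi> g) m \<and> (\<forall>i \<in> Obj J. Comp (slice C ?Z) h
      (pb2 C (\<pi> \<cdot> l i) g, pbmap g (\<pi> \<cdot> l i) (l i) \<pi>, pb2 C \<pi> g)
       = (pb2 C (\<pi> \<cdot> l i) g, k i, m))" (is "\<exists>!h. ?P h")
    unfolding colimit_def by (simp add: base_change_def)
  then obtain h where h: "?P h" "\<And>h'. ?P h' \<Longrightarrow> h' = h" by blast
  obtain h0 where h0: "h = (pb2 C \<pi> g, h0, m)" using conjunct1[OF h(1)] unfolding slice_Hom_iff by blast
  show ?thesis
  proof (rule ex1I[of _ h0])
    show "(arr h0 \<and> src h0 = pb C \<pi> g \<and> tgt h0 = src m \<and> m \<cdot> h0 = pb2 C \<pi> g) \<and>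
      (\<forall>i \<in> Obj J. h0 \<cdot> pbmap g (\<pi> \<cdot> l i) (l i) \<pi> = k i)"
      using h(1) unfolding h0 slice_Hom_iff by simp
  next
    fix h' assume "(arr h' \<and> src h' = pb C \<pi> g \<and> tgt h' = src m \<and> m \<cdot> h' = pb2 C \<pi> g) \<and>
      (\<forall>i \<in> Obj J. h' \<cdot> pbmap g (\<pi> \<cdot> l i) (l i) \<pi> = k i)"
    then have "?P (pb2 C \<pi> g, h', m)" unfolding slice_Hom_iff by simp
    from h(2)[OF this] show "h' = h0" using h0 by simp
  qed
qed

end


section \<open>Descent of objects\<close>

locale descent_site = subcanonical_site C \<kappa> \<tau>
  for C :: "('o, 'a, 'm) pcat_scheme" (structure) and \<kappa> :: "'k rel" and \<tau> :: "'o \<Rightarrow> 'a set set" +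
  assumes smallness: "smallness_cardinal \<kappa>" and cocomplete: "cocomplete \<kappa> C"
    and stable_colimits: "pullbacks_preserve_colimits \<kappa> C"

text \<open>A descent datum for objects, without the choice of pullbacks: \<open>E (f \<cdot> g)\<close> is required to be a pullback
  of \<open>E f\<close> along \<open>g\<close>, and the cocycle condition becomes functoriality in \<open>g\<close>.\<close>

locale cartesian_descent = descent_site C \<kappa> \<tau>
  for C :: "('o, 'a, 'm) pcat_scheme" (structure) and \<kappa> :: "'k rel" and \<tau> :: "'o \<Rightarrow> 'a set set" +
  fixes Y :: 'o and S :: "'a set" and E :: "'a \<Rightarrow> 'o" and p :: "'a \<Rightarrow> 'a" and e :: "'a \<Rightarrow> 'a \<Rightarrow> 'a"
  assumes Y: "Y \<in> Obj C" and S: "S \<in> \<tau> Y"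
    and p: "f \<in> S \<Longrightarrow> p f \<in> Hom C (E f) (src f)"
    and e_cartesian: "f \<in> S \<Longrightarrow> arr g \<Longrightarrow> tgt g = src f
      \<Longrightarrow> is_pullback C (p f) g (E (f \<cdot> g)) (e f g) (p (f \<cdot> g))"
    and e_comp: "f \<in> S \<Longrightarrow> arr g \<Longrightarrow> tgt g = src f \<Longrightarrow> arr h \<Longrightarrow> tgt h = src g
      \<Longrightarrow> e f g \<cdot> e (f \<cdot> g) h = e f (g \<cdot> h)"
begin

lemma S_simps [simp]: "f \<in> S \<Longrightarrow> arr f" "f \<in> S \<Longrightarrow> tgt f = Y"
  using cover_arr[OF S Y] by simp_all

lemma S_comp [simp]: "f \<in> S \<Longrightarrow> arr g \<Longrightarrow> tgt g = src f \<Longrightarrow> f \<cdot> g \<in> S"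
  by (rule cover_comp[OF S Y])

lemma p_simps [simp]: "f \<in> S \<Longrightarrow> arr (p f)" "f \<in> S \<Longrightarrow> src (p f) = E f" "f \<in> S \<Longrightarrow> tgt (p f) = src f"
  using p by (simp_all add: Hom_iff)

lemma E_Obj [simp]: "f \<in> S \<Longrightarrow> E f \<in> Obj C"
  using Dom_in_Obj[OF p_simps(1)] by simp

lemma e_simps [simp]:
  assumes "f \<in> S" "arr g" "tgt g = src f"
  shows "arr (e f g)" "src (e f g) = E (f \<cdot> g)" "tgt (e f g) = E f" "p f \<cdot> e f g = g \<cdot> p (f \<cdot> g)"
  using is_pullbackD[OF e_cartesian[OF assms]] assms by simp_all

lemma p_e_comp:
  assumes "f \<in> S" "arr g" "tgt g = src f" "arr x" "tgt x = E (f \<cdot> g)"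
  shows "p f \<cdot> (e f g \<cdot> x) = g \<cdot> (p (f \<cdot> g) \<cdot> x)"
  by (rule comp_eq_comp[OF e_simps(4)]) (use assms in simp_all)

lemma e_e_comp:
  assumes "f \<in> S" "arr g" "tgt g = src f" "arr h" "tgt h = src g" "arr x" "tgt x = E (f \<cdot> (g \<cdot> h))"
  shows "e f g \<cdot> (e (f \<cdot> g) h \<cdot> x) = e f (g \<cdot> h) \<cdot> x"
  by (rule comp_eq_arr[OF e_comp]) (use assms in simp_all)

lemma e_ext:
  assumes "e f g \<cdot> x = e f g \<cdot> y" "p (f \<cdot> g) \<cdot> x = p (f \<cdot> g) \<cdot> y" "f \<in> S" "arr g" "tgt g = src f"
    "arr x" "arr y" "src x = src y" "tgt x = E (f \<cdot> g)" "tgt y = E (f \<cdot> g)"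
  shows "x = y"
  by (rule is_pullback_ext[OF e_cartesian]) (use assms in simp_all)

text \<open>A point \<open>x : W \<rightarrow> E f\<close> is determined by its image \<open>b = f \<cdot> (p f \<cdot> x)\<close> in \<open>Y\<close> and a section of \<open>E b \<rightarrow> W\<close>.
  The object \<open>E b\<close> depends on \<open>b\<close> alone and not on \<open>f\<close>, which makes it possible to compare points of
  different \<open>E f\<close>.\<close>

definition sect :: "'a \<Rightarrow> 'a \<Rightarrow> 'a" where
  "sect f x = (THE s. arr s \<and> src s = src x \<and> tgt s = E (f \<cdot> (p f \<cdot> x))
     \<and> e f (p f \<cdot> x) \<cdot> s = x \<and> p (f \<cdot> (p f \<cdot> x)) \<cdot> s = Ident C (src x))"

lemma sect_unique:
  assumes "f \<in> S" "arr x" "tgt x = E f" "arr s" "src s = src x" "tgt s = E (f \<cdot> (p f \<cdot> x))"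
    "e f (p f \<cdot> x) \<cdot> s = x" "p (f \<cdot> (p f \<cdot> x)) \<cdot> s = Ident C (src x)"
  shows "sect f x = s"
  unfolding sect_def
proof (rule the_equality)
  fix s' assume "arr s' \<and> src s' = src x \<and> tgt s' = E (f \<cdot> (p f \<cdot> x))
     \<and> e f (p f \<cdot> x) \<cdot> s' = x \<and> p (f \<cdot> (p f \<cdot> x)) \<cdot> s' = Ident C (src x)"
  then show "s' = s" using assms by - (rule e_ext[of f "p f \<cdot> x"]; simp)
qed (use assms in simp)

lemma sect_simps [simp]:
  assumes "f \<in> S" "arr x" "tgt x = E f"
  shows "arr (sect f x)" "src (sect f x) = src x" "tgt (sect f x) = E (f \<cdot> (p f \<cdot> x))"
    "e f (p f \<cdot> x) \<cdot> sect f x = x" "p (f \<cdot> (p f \<cdot> x)) \<cdot> sect f x = Ident C (src x)"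
proof -
  have "arr (p f \<cdot> x)" "tgt (p f \<cdot> x) = src f" using assms by simp_all
  note c = e_cartesian[OF assms(1) this]
  obtain s where "arr s" "src s = src x" "tgt s = E (f \<cdot> (p f \<cdot> x))"
    "e f (p f \<cdot> x) \<cdot> s = x" "p (f \<cdot> (p f \<cdot> x)) \<cdot> s = Ident C (src x)"
    by (rule is_pullback_factor[OF c, of x "Ident C (src x)"]) (use assms in simp_all)
  with sect_unique[OF assms this]
  show "arr (sect f x)" "src (sect f x) = src x" "tgt (sect f x) = E (f \<cdot> (p f \<cdot> x))"
    "e f (p f \<cdot> x) \<cdot> sect f x = x" "p (f \<cdot> (p f \<cdot> x)) \<cdot> sect f x = Ident C (src x)"
    by simp_all
qed

text \<open>The transport of the point \<open>x\<close> of \<open>E f\<close> to \<open>E f'\<close>, defined if \<open>u\<close> is a point of the domain of \<open>f'\<close> with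
  the same image in \<open>Y\<close> as \<open>x\<close>: the point over \<open>u\<close> with the same section. In the glued object both
  points have to become equal.\<close>

definition tr :: "'a \<Rightarrow> 'a \<Rightarrow> 'a \<Rightarrow> 'a \<Rightarrow> 'a" where
  "tr f x f' u = e f' u \<cdot> sect f x"

lemma tr_simps [simp]:
  assumes "f \<in> S" "arr x" "tgt x = E f" "f' \<in> S" "arr u" "tgt u = src f'" "src u = src x"
    "f' \<cdot> u = f \<cdot> (p f \<cdot> x)"
  shows "arr (tr f x f' u)" "src (tr f x f' u) = src x" "tgt (tr f x f' u) = E f'"
    "p f' \<cdot> tr f x f' u = u"
proof -
  have [simp]: "tgt (sect f x) = E (f' \<cdot> u)" "p (f' \<cdot> u) \<cdot> sect f x = Ident C (src x)"
    using assms sect_simps[OF assms(1-3)] by simp_all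
  show "arr (tr f x f' u)" "src (tr f x f' u) = src x" "tgt (tr f x f' u) = E f'"
    "p f' \<cdot> tr f x f' u = u"
    using assms(1-7) by (simp_all add: tr_def p_e_comp del: sect_simps(3,5))
qed

lemma sect_tr:
  assumes "f \<in> S" "arr x" "tgt x = E f" "f' \<in> S" "arr u" "tgt u = src f'" "src u = src x"
    "f' \<cdot> u = f \<cdot> (p f \<cdot> x)"
  shows "sect f' (tr f x f' u) = sect f x"
proof -
  note t = tr_simps[OF assms]
  note s = sect_simps[OF assms(1-3), folded assms(8)]
  show ?thesis
    by (rule sect_unique) (use assms(1-7) s t in \<open>simp_all add: tr_def\<close>)
qed

lemma tr_tr:
  assumes "f \<in> S" "arr x" "tgt x = E f" "f' \<in> S" "arr u" "tgt u = src f'" "src u = src x"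
    "f' \<cdot> u = f \<cdot> (p f \<cdot> x)"
  shows "tr f' (tr f x f' u) f'' v = tr f x f'' v"
  using sect_tr[OF assms] by (simp add: tr_def)

lemma tr_self: "f \<in> S \<Longrightarrow> arr x \<Longrightarrow> tgt x = E f \<Longrightarrow> u = p f \<cdot> x \<Longrightarrow> tr f x f u = x"
  by (simp add: tr_def)

lemma sect_comp:
  assumes "f \<in> S" "arr x" "tgt x = E f" "arr w" "tgt w = src x"
  shows "e (f \<cdot> (p f \<cdot> x)) w \<cdot> sect f (x \<cdot> w) = sect f x \<cdot> w"
proof -
  note [simp] = assms
  have "arr (sect f (x \<cdot> w))" "src (sect f (x \<cdot> w)) = src w" "tgt (sect f (x \<cdot> w)) = E (f \<cdot> (p f \<cdot> (x \<cdot> w)))"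
    and es: "e f (p f \<cdot> (x \<cdot> w)) \<cdot> sect f (x \<cdot> w) = x \<cdot> w"
      "p (f \<cdot> (p f \<cdot> (x \<cdot> w))) \<cdot> sect f (x \<cdot> w) = Ident C (src w)"
    using sect_simps[of f "x \<cdot> w"] by simp_all
  note [simp] = this(1-3)
  show ?thesis
  proof (rule e_ext[of f "p f \<cdot> x"])
    show "e f (p f \<cdot> x) \<cdot> (e (f \<cdot> (p f \<cdot> x)) w \<cdot> sect f (x \<cdot> w)) = e f (p f \<cdot> x) \<cdot> (sect f x \<cdot> w)"
      using e_e_comp[of f "p f \<cdot> x" w "sect f (x \<cdot> w)"] es(1) comp_eq_arr[OF sect_simps(4)[OF assms(1-3)], of w] by simp
    show "p (f \<cdot> (p f \<cdot> x)) \<cdot> (e (f \<cdot> (p f \<cdot> x)) w \<cdot> sect f (x \<cdot> w)) = p (f \<cdot> (p f \<cdot> x)) \<cdot> (sect f x \<cdot> w)"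
      using p_e_comp[of "f \<cdot> (p f \<cdot> x)" w "sect f (x \<cdot> w)"] es(2) comp_eq_arr[OF sect_simps(5)[OF assms(1-3)], of w] by simp
  qed simp_all
qed

lemma tr_comp:
  assumes "f \<in> S" "arr x" "tgt x = E f" "f' \<in> S" "arr u" "tgt u = src f'" "src u = src x"
    "f' \<cdot> u = f \<cdot> (p f \<cdot> x)" "arr w" "tgt w = src x"
  shows "tr f x f' u \<cdot> w = tr f (x \<cdot> w) f' (u \<cdot> w)"
proof -
  note [simp] = assms(1-7,9,10)
  have fw: "f' \<cdot> (u \<cdot> w) = f \<cdot> (p f \<cdot> (x \<cdot> w))" using comp_eq_comp[OF assms(8), of w] by simp
  have [simp]: "tgt (sect f x) = E (f' \<cdot> u)" "tgt (sect f (x \<cdot> w)) = E (f' \<cdot> (u \<cdot> w))"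
    using sect_simps[OF assms(1-3)] sect_simps[of f "x \<cdot> w"] assms(8) fw by simp_all
  have "tr f x f' u \<cdot> w = e f' u \<cdot> (sect f x \<cdot> w)" by (simp add: tr_def del: sect_simps(3))
  also have "sect f x \<cdot> w = e (f' \<cdot> u) w \<cdot> sect f (x \<cdot> w)"
    using sect_comp[OF assms(1-3,9,10)] assms(8) by simp
  also have "e f' u \<cdot> (e (f' \<cdot> u) w \<cdot> sect f (x \<cdot> w)) = e f' (u \<cdot> w) \<cdot> sect f (x \<cdot> w)"
    by (rule e_e_comp) (simp_all del: sect_simps(3))
  finally show ?thesis by (simp add: tr_def)
qed

text \<open>The structure arrows \<open>e\<close> are transports. Together with \<open>tr_tr\<close>, \<open>tr_self\<close> and \<open>tr_comp\<close> this reduces all equations below to the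
  comparison of two images in \<open>Y\<close>.\<close>

lemma tr_e:
  assumes "f \<in> S" "arr g" "tgt g = src f" "arr x" "tgt x = E (f \<cdot> g)" "u = g \<cdot> (p (f \<cdot> g) \<cdot> x)"
  shows "tr (f \<cdot> g) x f u = e f g \<cdot> x"
proof -
  note [simp] = assms
  have "e f g \<cdot> x = e f g \<cdot> (e (f \<cdot> g) (p (f \<cdot> g) \<cdot> x) \<cdot> sect (f \<cdot> g) x)" by simp
  also have "\<dots> = e f (g \<cdot> (p (f \<cdot> g) \<cdot> x)) \<cdot> sect (f \<cdot> g) x"
    using sect_simps(3)[of "f \<cdot> g" x] by (intro e_e_comp) simp_all
  finally show ?thesis by (simp add: tr_def)
qed

lemma e_Ident:
  assumes "f \<in> S" shows "e f (Ident C (src f)) = Ident C (E f)"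
  using e_comp[of f "Ident C (src f)" "Ident C (src f)"] e_simps[of f "Ident C (src f)"] assms
  by - (rule e_ext[of f "Ident C (src f)"]; simp)

end

text \<open>A sieve may be too large for a colimit, so the object is glued from the members of a small covering
  family inside it.\<close>

locale descent_cover = cartesian_descent C \<kappa> \<tau> Y S E p e
  for C :: "('o, 'a, 'm) pcat_scheme" (structure) and \<kappa> :: "'k rel" and \<tau> :: "'o \<Rightarrow> 'a set set"
    and Y :: 'o and S :: "'a set" and E :: "'a \<Rightarrow> 'o" and p :: "'a \<Rightarrow> 'a" and e :: "'a \<Rightarrow> 'a \<Rightarrow> 'a" +
  fixes I :: "'k set" and F :: "'k \<Rightarrow> 'a"
  assumes cov: "covering_family \<kappa> C \<tau> Y I F" and F_S: "F ` I \<subseteq> S"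
begin

abbreviation "J \<equiv> span_category I"

text \<open>The diagram of the \<open>E\<close> over the \<open>U\<^sub>i\<close> and \<open>U\<^sub>i \<times>\<^sub>Y U\<^sub>j\<close>. All its vertices are values of \<open>E\<close> at arrows in \<open>S\<close> and all
  its arrows are values of \<open>e\<close>, so that vertices and edges can be treated alike.\<close>

definition leg :: "'k span_obj \<Rightarrow> 'a" where
  "leg v = (case v of Vertex i \<Rightarrow> F i | Edge i j \<Rightarrow> F i \<cdot> pb1 C (F i) (F j))"

definition step :: "'k span_arr \<Rightarrow> 'a" where
  "step a = (case a of Id v \<Rightarrow> Ident C (src (leg v)) | Source i j \<Rightarrow> pb1 C (F i) (F j) | Target i j \<Rightarrow> pb2 C (F i) (F j))"

definition diagram :: "('k span_obj, 'k span_arr, 'o, 'a) cfunctor" where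
  "diagram = \<lparr>omap = (\<lambda>v. E (leg v)), amap = (\<lambda>a. e (leg (Cod J a)) (step a))\<rparr>"

lemma diagram_simps [simp]: "omap diagram v = E (leg v)" "amap diagram a = e (leg (Cod J a)) (step a)"
  by (simp_all add: diagram_def)

lemma F_simps [simp]: "i \<in> I \<Longrightarrow> F i \<in> S"
  using F_S by blast

lemma J_small: "small_category \<kappa> J"
  by (rule small_span_category[OF smallness]) (use cov in \<open>simp add: covering_family_def\<close>)

lemma J_Obj: "v \<in> Obj J \<longleftrightarrow> (\<exists>i \<in> I. v = Vertex i) \<or> (\<exists>i \<in> I. \<exists>j \<in> I. v = Edge i j)"
  by (auto simp: span_category_def)

lemma J_Arr: "a \<in> Arr J \<longleftrightarrow> (\<exists>v \<in> Obj J. a = Id v) \<or> (\<exists>i \<in> I. \<exists>j \<in> I. a = Source i j \<or> a = Target i j)"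
  by (auto simp: span_category_def)

lemma J_simps [simp]:
  "Dom J (Id v) = v" "Cod J (Id v) = v" "Dom J (Source i j) = Edge i j" "Cod J (Source i j) = Vertex i"
  "Dom J (Target i j) = Edge i j" "Cod J (Target i j) = Vertex j" "Ident J v = Id v"
  by (simp_all add: span_category_def)

lemma J_Dom_Cod [simp]: "a \<in> Arr J \<Longrightarrow> Dom J a \<in> Obj J" "a \<in> Arr J \<Longrightarrow> Cod J a \<in> Obj J"
  by (auto simp: J_Arr J_Obj)

lemma leg_simps [simp]: "leg (Vertex i) = F i" "v \<in> Obj J \<Longrightarrow> leg v \<in> S"
  by (auto simp: leg_def J_Obj)

lemma leg_Edge: "leg (Edge i j) = F i \<cdot> pb1 C (F i) (F j)"
  by (simp add: leg_def)

lemma step_simps [simp]: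
  assumes "a \<in> Arr J"
  shows "arr (step a)" "tgt (step a) = src (leg (Cod J a))" "leg (Cod J a) \<cdot> step a = leg (Dom J a)" "src (step a) = src (leg (Dom J a))"
proof -
  show 1: "arr (step a)" "tgt (step a) = src (leg (Cod J a))" "leg (Cod J a) \<cdot> step a = leg (Dom J a)"
    using assms by (auto simp: J_Arr step_def leg_Edge pb_square[symmetric])
  then show "src (step a) = src (leg (Dom J a))"
    using comp_simps(2)[of "step a" "leg (Cod J a)"] assms by simp
qed

lemma diagram_functor: "is_functor J C diagram"
proof -
  have comp: "step (Comp J b a) = step b \<cdot> step a \<and> Cod J (Comp J b a) = Cod J b" if "a \<in> Arr J" "b \<in> Arr J" "Cod J a = Dom J b" for a b
    using that step_simps[OF that(1)] step_simps[OF that(2)]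
    by (cases a; cases b) (auto simp: span_category_def step_def J_Arr)
  have "e (leg (Cod J b)) (step b) \<cdot> e (leg (Cod J a)) (step a) = e (leg (Cod J b)) (step b \<cdot> step a)"
    if "a \<in> Arr J" "b \<in> Arr J" "Cod J a = Dom J b" for a b
    using e_comp[of "leg (Cod J b)" "step b" "step a"] that by simp
  moreover have "step (Id v) = Ident C (src (leg v))" for v by (simp add: step_def)
  ultimately show ?thesis
    unfolding is_functor_def using comp by (simp add: Hom_iff e_Ident)
qed

text \<open>Write \<open>L\<close> for the colimit. The two arrows between \<open>E f\<close> and \<open>L \<times>\<^sub>Y Z\<close> are \<open>c'\<close>, glued from transports into
  the diagram, and \<open>h\<close>, given on the diagram by transports out of it. That they are inverse is the
  fact that transporting there and back is the identity: on a cover of \<open>E f\<close> for one composite, and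
  on the pieces of the base-changed colimit for the other.\<close>

theorem glued_object:
  obtains L \<pi> c where "\<pi> \<in> Hom C L Y" "\<And>f. f \<in> S \<Longrightarrow> is_pullback C \<pi> f (E f) (c f) (p f)"
    "\<And>f g. f \<in> S \<Longrightarrow> arr g \<Longrightarrow> tgt g = src f \<Longrightarrow> c f \<cdot> e f g = c (f \<cdot> g)"
proof -
  obtain L l where colim: "colimit C J diagram L l"
    by (rule cocomplete_colimit[OF smallness cocomplete J_small diagram_functor])
  then have L [simp]: "L \<in> Obj C" and l [simp]: "\<And>v. v \<in> Obj J \<Longrightarrow> arr (l v)" "\<And>v. v \<in> Obj J \<Longrightarrow> src (l v) = E (leg v)"
    "\<And>v. v \<in> Obj J \<Longrightarrow> tgt (l v) = L" and le: "\<And>a. a \<in> Arr J \<Longrightarrow> l (Cod J a) \<cdot> e (leg (Cod J a)) (step a) = l (Dom J a)"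
    unfolding colimit_def cocone_def by (simp_all add: Hom_iff)
  have "cocone C J diagram Y (\<lambda>v. leg v \<cdot> p (leg v))"
    unfolding cocone_def
  proof (intro conjI ballI)
    fix a assume a [simp]: "a \<in> Arr J"
    show "(leg (Cod J a) \<cdot> p (leg (Cod J a))) \<cdot> amap diagram a = leg (Dom J a) \<cdot> p (leg (Dom J a))"
      using comp_eq_arr[OF step_simps(3)[OF a], of "p (leg (Dom J a))"] by simp
  qed (simp_all add: Y Hom_iff)
  then obtain \<pi> where \<pi> [simp]: "arr \<pi>" "src \<pi> = L" "tgt \<pi> = Y" and \<pi>l: "\<And>v. v \<in> Obj J \<Longrightarrow> \<pi> \<cdot> l v = leg v \<cdot> p (leg v)"
    using colim unfolding colimit_def Hom_iff by blast
  have \<pi>l_comp: "\<pi> \<cdot> (l v \<cdot> x) = leg v \<cdot> (p (leg v) \<cdot> x)" if "v \<in> Obj J" "arr x" "tgt x = E (leg v)" for v x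
    by (rule comp_eq_comp[OF \<pi>l]) (use that in simp_all)
  have l_tr: "l (Dom J a) \<cdot> z = l (Cod J a) \<cdot> tr (leg (Dom J a)) z (leg (Cod J a)) (step a \<cdot> (p (leg (Dom J a)) \<cdot> z))"
    if a [simp]: "a \<in> Arr J" and z [simp]: "arr z" "tgt z = E (leg (Dom J a))" for a z
    using comp_eq_arr[OF le[OF a], of z] tr_e[of "leg (Cod J a)" "step a" z, OF _ _ _ _ _ refl] by simp
  \<comment> \<open>Points of \<open>E (F i)\<close> and \<open>E (F j)\<close> that correspond to each other are both images of one point over
    \<open>U\<^sub>i \<times>\<^sub>Y U\<^sub>j\<close>, and so the colimit identifies them.\<close>
  have vertex_tr: "l (Vertex i) \<cdot> x = l (Vertex j) \<cdot> tr (F i) x (F j) u"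
    if [simp]: "i \<in> I" "j \<in> I" "arr x" "tgt x = E (F i)" "arr u" "tgt u = src (F j)" "src u = src x"
      and eq: "F j \<cdot> u = F i \<cdot> (p (F i) \<cdot> x)" for i j x u
  proof -
    have a: "Source i j \<in> Arr J" "Target i j \<in> Arr J" by (simp_all add: J_Arr)
    define f where "f = leg (Edge i j)"
    have f [simp]: "f \<in> S" "leg (Edge i j) = f" "F i \<cdot> pb1 C (F i) (F j) = f" "src f = pb C (F i) (F j)"
      by (simp_all add: f_def leg_def)
    have fv: "F j \<cdot> pb2 C (F i) (F j) = f" by (simp add: pb_square[symmetric])
    define v where "v = lift C (F i) (F j) (p (F i) \<cdot> x) u"
    have v [simp]: "arr v" "src v = src x" "tgt v = pb C (F i) (F j)"
      "pb1 C (F i) (F j) \<cdot> v = p (F i) \<cdot> x" "pb2 C (F i) (F j) \<cdot> v = u" using eq by (simp_all add: v_def)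
    have fv': "f \<cdot> v = F i \<cdot> (p (F i) \<cdot> x)" using comp_eq_arr[OF f(3), of v] by simp
    define z where "z = tr (F i) x f v"
    have z [simp]: "arr z" "src z = src x" "tgt z = E f" "p f \<cdot> z = v"
      using fv' by (simp_all add: z_def)
    have "l (Edge i j) \<cdot> z = l (Vertex i) \<cdot> tr f z (F i) (p (F i) \<cdot> x)"
      using l_tr[OF a(1), of z] by (simp add: step_def)
    moreover have "l (Edge i j) \<cdot> z = l (Vertex j) \<cdot> tr f z (F j) u"
      using l_tr[OF a(2), of z] by (simp add: step_def)
    moreover have "tr f z g t = tr (F i) x g t" for g t unfolding z_def by (rule tr_tr) (use fv' in simp_all)
    ultimately show ?thesis by (simp add: tr_self)
  qed
  have "\<exists>c. c \<in> Hom C (E f) L \<and> (\<forall>x i u. arr x \<longrightarrow> tgt x = E f \<longrightarrow> i \<in> I \<longrightarrow> arr u \<longrightarrow> tgt u = src (F i)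
     \<longrightarrow> src u = src x \<longrightarrow> F i \<cdot> u = f \<cdot> (p f \<cdot> x) \<longrightarrow> c \<cdot> x = l (Vertex i) \<cdot> tr f x (F i) u)" if f [simp]: "f \<in> S" for f
  proof -
    have cov': "covering_family \<kappa> C \<tau> (tgt (f \<cdot> p f)) I F" using cov by simp
    have [simp]: "i \<in> I \<Longrightarrow> Vertex i \<in> Obj J" for i by (simp add: J_Obj)
    obtain c where "arr c" "src c = src (f \<cdot> p f)" "tgt c = L"
      "\<And>i x u. i \<in> I \<Longrightarrow> arr x \<Longrightarrow> tgt x = src (f \<cdot> p f) \<Longrightarrow> arr u \<Longrightarrow> tgt u = src (F i)
       \<Longrightarrow> src u = src x \<Longrightarrow> F i \<cdot> u = (f \<cdot> p f) \<cdot> x \<Longrightarrow> c \<cdot> x = l (Vertex i) \<cdot> tr f x (F i) u"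
    proof (rule arrow_glue_on_family[OF cov', of L "\<lambda>i x u. l (Vertex i) \<cdot> tr f x (F i) u"])
      fix i j x u v assume [simp]: "i \<in> I" "j \<in> I" "arr x" "tgt x = src (f \<cdot> p f)" "arr u" "tgt u = src (F i)"
        "src u = src x" "arr v" "tgt v = src (F j)" "src v = src x"
        and eq: "F i \<cdot> u = (f \<cdot> p f) \<cdot> x" "F j \<cdot> v = (f \<cdot> p f) \<cdot> x"
      have "l (Vertex i) \<cdot> tr f x (F i) u = l (Vertex j) \<cdot> tr (F i) (tr f x (F i) u) (F j) v"
        by (rule vertex_tr) (use eq in simp_all)
      then show "l (Vertex i) \<cdot> tr f x (F i) u = l (Vertex j) \<cdot> tr f x (F j) v" using eq by (simp add: tr_tr)
    qed (simp_all add: tr_comp that)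
    then show ?thesis by (intro exI[of _ c]) (simp add: Hom_iff)
  qed
  then obtain c where c0: "\<And>f. f \<in> S \<Longrightarrow> c f \<in> Hom C (E f) L"
    and c_vertex: "\<And>f x i u. f \<in> S \<Longrightarrow> arr x \<Longrightarrow> tgt x = E f \<Longrightarrow> i \<in> I \<Longrightarrow> arr u \<Longrightarrow> tgt u = src (F i)
     \<Longrightarrow> src u = src x \<Longrightarrow> F i \<cdot> u = f \<cdot> (p f \<cdot> x) \<Longrightarrow> c f \<cdot> x = l (Vertex i) \<cdot> tr f x (F i) u"
    by metis
  have c [simp]: "arr (c f)" "src (c f) = E f" "tgt (c f) = L" if "f \<in> S" for f
    using c0[OF that] by (simp_all add: Hom_iff)
  \<comment> \<open>The values of \<open>c f\<close> were prescribed at the vertices; the arrow from an edge to its first vertex gives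
    the same formula there.\<close>
  have c_tr: "c f \<cdot> x = l v \<cdot> tr f x (leg v) u"
    if [simp]: "f \<in> S" "arr x" "tgt x = E f" "v \<in> Obj J" "arr u" "tgt u = src (leg v)" "src u = src x"
      and eq: "leg v \<cdot> u = f \<cdot> (p f \<cdot> x)" for f x v u
  proof (cases v)
    case (Vertex i)
    then show ?thesis using c_vertex[of f x i u] that by (simp add: J_Obj)
  next
    case (Edge i j)
    then have a [simp]: "Source i j \<in> Arr J" and i [simp]: "i \<in> I" using that(4) by (auto simp: J_Arr J_Obj)
    have wu: "F i \<cdot> (step (Source i j) \<cdot> u) = f \<cdot> (p f \<cdot> x)"
      using comp_eq_arr[OF step_simps(3)[OF a], of u] step_simps[OF a] eq that(5-7) by (simp add: Edge[symmetric])
    have "l v \<cdot> tr f x (leg v) u = l (Vertex i) \<cdot> tr (leg v) (tr f x (leg v) u) (F i) (step (Source i j) \<cdot> u)"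
      using l_tr[OF a, of "tr f x (leg v) u"] eq by (simp add: Edge[symmetric])
    also have "tr (leg v) (tr f x (leg v) u) (F i) (step (Source i j) \<cdot> u) = tr f x (F i) (step (Source i j) \<cdot> u)"
      by (rule tr_tr) (use eq in simp_all)
    also have "l (Vertex i) \<cdot> \<dots> = c f \<cdot> x"
      by (rule c_vertex[symmetric]) (use wu step_simps[OF a] that(5-7) in \<open>simp_all add: Edge[symmetric]\<close>)
    finally show ?thesis ..
  qed
  have on_cover: "h = k"
    if "f \<in> S" "arr h" "arr k" "src h = E f" "src k = E f" "tgt h = tgt k"
      and eq: "\<And>x v u. arr x \<Longrightarrow> tgt x = E f \<Longrightarrow> v \<in> Obj J \<Longrightarrow> arr u \<Longrightarrow> tgt u = src (leg v)
       \<Longrightarrow> src u = src x \<Longrightarrow> leg v \<cdot> u = f \<cdot> (p f \<cdot> x) \<Longrightarrow> h \<cdot> x = k \<cdot> x" for f h k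
  proof (rule arrow_ext_on_family[of "f \<cdot> p f" I F])
    fix i u x assume "i \<in> I" "arr x" "tgt x = src (f \<cdot> p f)" "arr u" "tgt u = src (F i)"
      "src u = src x" "F i \<cdot> u = (f \<cdot> p f) \<cdot> x"
    then show "h \<cdot> x = k \<cdot> x" using eq[of x "Vertex i" u] that(1) by (simp add: J_Obj)
  qed (use that cov in simp_all)
  have \<pi>c: "\<pi> \<cdot> c f = f \<cdot> p f" if "f \<in> S" for f
  proof (rule on_cover[OF that])
    fix x v u assume "arr x" "tgt x = E f" "v \<in> Obj J" "arr u" "tgt u = src (leg v)" "src u = src x" "leg v \<cdot> u = f \<cdot> (p f \<cdot> x)"
    then show "(\<pi> \<cdot> c f) \<cdot> x = (f \<cdot> p f) \<cdot> x" using that c_tr[of f x v u] by (simp add: \<pi>l_comp)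
  qed (use that in simp_all)
  show ?thesis
  proof (rule that[of \<pi> L c])
    show "\<pi> \<in> Hom C L Y" by (simp add: Hom_iff)
  next
    fix f g assume [simp]: "f \<in> S" "arr g" "tgt g = src f"
    show "c f \<cdot> e f g = c (f \<cdot> g)"
    proof (rule on_cover[of "f \<cdot> g"])
      fix x v u assume [simp]: "arr x" "tgt x = E (f \<cdot> g)" "v \<in> Obj J" "arr u" "tgt u = src (leg v)"
       "src u = src x" and eq: "leg v \<cdot> u = (f \<cdot> g) \<cdot> (p (f \<cdot> g) \<cdot> x)"
      have "c f \<cdot> (e f g \<cdot> x) = l v \<cdot> tr f (e f g \<cdot> x) (leg v) u"
        by (rule c_tr) (use eq in \<open>simp_all add: p_e_comp\<close>)
      also have "tr f (e f g \<cdot> x) (leg v) u = tr (f \<cdot> g) x (leg v) u"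
        using tr_e[of f g x, OF _ _ _ _ _ refl] tr_tr[of "f \<cdot> g" x f "g \<cdot> (p (f \<cdot> g) \<cdot> x)" "leg v" u] by simp
      also have "l v \<cdot> tr (f \<cdot> g) x (leg v) u = c (f \<cdot> g) \<cdot> x" by (rule c_tr[symmetric]) (use eq in simp_all)
      finally show "(c f \<cdot> e f g) \<cdot> x = c (f \<cdot> g) \<cdot> x" by simp
    qed simp_all
  next
    fix f assume f [simp]: "f \<in> S"
    let ?q = "\<lambda>v. pb1 C (\<pi> \<cdot> l v) f" and ?r = "\<lambda>v. pb2 C (\<pi> \<cdot> l v) f"
    let ?l = "\<lambda>v. pbmap f (\<pi> \<cdot> l v) (l v) \<pi>"
    have qr: "f \<cdot> ?r v = leg v \<cdot> (p (leg v) \<cdot> ?q v)" if "v \<in> Obj J" for v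
      using pb_square[of "\<pi> \<cdot> l v" f] that by (simp add: \<pi>l_comp)
    have l' [simp]: "arr (?l v)" "src (?l v) = pb C (\<pi> \<cdot> l v) f" "tgt (?l v) = pb C \<pi> f"
      "pb1 C \<pi> f \<cdot> ?l v = l v \<cdot> ?q v" "pb2 C \<pi> f \<cdot> ?l v = ?r v" if "v \<in> Obj J" for v
      using that qr[OF that] by (simp_all add: \<pi>l_comp)
    have stable: "\<exists>!h. (arr h \<and> src h = pb C \<pi> f \<and> tgt h = src m \<and> m \<cdot> h = pb2 C \<pi> f) \<and> (\<forall>v \<in> Obj J. h \<cdot> ?l v = k v)"
      if "arr m" "tgt m = src f" "\<And>v. v \<in> Obj J \<Longrightarrow> arr (k v)" "\<And>v. v \<in> Obj J \<Longrightarrow> src (k v) = pb C (\<pi> \<cdot> l v) f"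
        "\<And>v. v \<in> Obj J \<Longrightarrow> tgt (k v) = src m" "\<And>v. v \<in> Obj J \<Longrightarrow> m \<cdot> k v = ?r v"
        "\<And>a. a \<in> Arr J \<Longrightarrow> k (Cod J a) \<cdot> pbmap f (\<pi> \<cdot> l (Dom J a)) (e (leg (Cod J a)) (step a)) (\<pi> \<cdot> l (Cod J a)) = k (Dom J a)" for m k
      by (rule base_change_universal[OF smallness stable_colimits J_small diagram_functor colim]) (use that in simp_all)
    let ?X = "\<lambda>a. pbmap f (\<pi> \<cdot> l (Dom J a)) (e (leg (Cod J a)) (step a)) (\<pi> \<cdot> l (Cod J a))"
    have X [simp]: "arr (?X a)" "src (?X a) = pb C (\<pi> \<cdot> l (Dom J a)) f" "tgt (?X a) = pb C (\<pi> \<cdot> l (Cod J a)) f"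
      "?q (Cod J a) \<cdot> ?X a = e (leg (Cod J a)) (step a) \<cdot> ?q (Dom J a)" "?r (Cod J a) \<cdot> ?X a = ?r (Dom J a)"
      if "a \<in> Arr J" for a
    proof -
      have "\<pi> \<cdot> (l (Cod J a) \<cdot> (e (leg (Cod J a)) (step a) \<cdot> ?q (Dom J a))) = f \<cdot> ?r (Dom J a)"
        using comp_eq_arr[OF le[OF that], of "?q (Dom J a)"] pb_square[of "\<pi> \<cdot> l (Dom J a)" f] that by simp
      then show "arr (?X a)" "src (?X a) = pb C (\<pi> \<cdot> l (Dom J a)) f" "tgt (?X a) = pb C (\<pi> \<cdot> l (Cod J a)) f"
        "?q (Cod J a) \<cdot> ?X a = e (leg (Cod J a)) (step a) \<cdot> ?q (Dom J a)" "?r (Cod J a) \<cdot> ?X a = ?r (Dom J a)"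
        using that by simp_all
    qed
    \<comment> \<open>On a piece \<open>E (leg v) \<times>\<^sub>Y Z\<close> of the base-changed colimit, \<open>h\<close> transports the first component to the
      point of \<open>E f\<close> over the second one.\<close>
    define k where "k v = tr (leg v) (?q v) f (?r v)" for v
    have k [simp]: "arr (k v)" "src (k v) = pb C (\<pi> \<cdot> l v) f" "tgt (k v) = E f" "p f \<cdot> k v = ?r v" if "v \<in> Obj J" for v
      using that qr[OF that] by (simp_all add: k_def)
    have "\<exists>!h. (arr h \<and> src h = pb C \<pi> f \<and> tgt h = src (p f) \<and> p f \<cdot> h = pb2 C \<pi> f) \<and> (\<forall>v \<in> Obj J. h \<cdot> ?l v = k v)"
    proof (rule stable)
      fix a assume a [simp]: "a \<in> Arr J"
      have "k (Cod J a) \<cdot> ?X a = tr (leg (Cod J a)) (e (leg (Cod J a)) (step a) \<cdot> ?q (Dom J a)) f (?r (Dom J a))"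
        unfolding k_def using qr[of "Cod J a"] X[OF a] by (subst tr_comp) (simp_all del: lift_simps)
      also have "\<dots> = k (Dom J a)"
        unfolding k_def using tr_e[of "leg (Cod J a)" "step a" "?q (Dom J a)", OF _ _ _ _ _ refl]
          tr_tr[of "leg (Dom J a)" "?q (Dom J a)" "leg (Cod J a)" "step a \<cdot> (p (leg (Dom J a)) \<cdot> ?q (Dom J a))" f "?r (Dom J a)"]
          comp_eq_arr[OF step_simps(3)[OF a], of "p (leg (Dom J a)) \<cdot> ?q (Dom J a)"] by simp
      finally show "k (Cod J a) \<cdot> ?X a = k (Dom J a)" .
    qed simp_all
    then obtain h where h [simp]: "arr h" "src h = pb C \<pi> f" "tgt h = E f" "p f \<cdot> h = pb2 C \<pi> f"
      and hk: "\<And>v. v \<in> Obj J \<Longrightarrow> h \<cdot> ?l v = k v" by (metis p_simps(2) f)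
    define c' where "c' = lift C \<pi> f (c f) (p f)"
    have c' [simp]: "arr c'" "src c' = E f" "tgt c' = pb C \<pi> f" "pb1 C \<pi> f \<cdot> c' = c f" "pb2 C \<pi> f \<cdot> c' = p f"
      using \<pi>c[OF f] by (simp_all add: c'_def)
    have c'_comp: "pb1 C \<pi> f \<cdot> (c' \<cdot> x) = c f \<cdot> x" "pb2 C \<pi> f \<cdot> (c' \<cdot> x) = p f \<cdot> x" if "arr x" "tgt x = E f" for x
      using comp_eq_arr[OF c'(4), of x] comp_eq_arr[OF c'(5), of x] that by simp_all
    have hc': "h \<cdot> c' = Ident C (E f)"
    proof (rule on_cover[OF f])
      fix x v u assume [simp]: "arr x" "tgt x = E f" "v \<in> Obj J" "arr u" "tgt u = src (leg v)"
       "src u = src x" and eq: "leg v \<cdot> u = f \<cdot> (p f \<cdot> x)"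
      define y where "y = tr f x (leg v) u"
      have y [simp]: "arr y" "src y = src x" "tgt y = E (leg v)" "p (leg v) \<cdot> y = u"
        using eq by (simp_all add: y_def)
      define z where "z = lift C (\<pi> \<cdot> l v) f y (p f \<cdot> x)"
      have z [simp]: "arr z" "src z = src x" "tgt z = pb C (\<pi> \<cdot> l v) f" "?q v \<cdot> z = y" "?r v \<cdot> z = p f \<cdot> x"
        using eq by (simp_all add: z_def \<pi>l_comp)
      have "c f \<cdot> x = l v \<cdot> y" unfolding y_def by (rule c_tr) (use eq in simp_all)
      then have "c' \<cdot> x = ?l v \<cdot> z"
        using comp_eq_arr[OF l'(4), of v z] comp_eq_arr[OF l'(5), of v z]
        by - (rule pb_ext[of \<pi> f]; simp add: c'_comp del: lift_simps lift_comp_simps)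
      then have "h \<cdot> (c' \<cdot> x) = (h \<cdot> ?l v) \<cdot> z" by (simp del: lift_simps)
      also have "\<dots> = k v \<cdot> z" using hk[of v] by simp
      also have "\<dots> = tr (leg v) y f (p f \<cdot> x)" unfolding k_def using qr[of v] by (subst tr_comp) simp_all
      also have "\<dots> = x" unfolding y_def using eq by (simp add: tr_tr tr_self)
      finally show "(h \<cdot> c') \<cdot> x = Ident C (E f) \<cdot> x" by simp
    qed simp_all
    \<comment> \<open>Both \<open>c' \<cdot> h\<close> and the identity are the unique arrow that extends the cocone of \<open>L \<times>\<^sub>Y Z\<close> itself.\<close>
    have "\<exists>!h. (arr h \<and> src h = pb C \<pi> f \<and> tgt h = src (pb2 C \<pi> f) \<and> pb2 C \<pi> f \<cdot> h = pb2 C \<pi> f) \<and>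
         (\<forall>v \<in> Obj J. h \<cdot> ?l v = ?l v)"
    proof (rule stable)
      fix a assume a [simp]: "a \<in> Arr J"
      show "?l (Cod J a) \<cdot> ?X a = ?l (Dom J a)"
        using comp_eq_arr[OF l'(4)[of "Cod J a"], of "?X a"] comp_eq_arr[OF l'(5)[of "Cod J a"], of "?X a"]
          comp_eq_arr[OF le[OF a], of "?q (Dom J a)"]
        by - (rule pb_ext[of \<pi> f]; simp del: lift_simps lift_comp_simps)
    qed (simp_all del: lift_simps)
    moreover have "(c' \<cdot> h) \<cdot> ?l v = ?l v" if v [simp]: "v \<in> Obj J" for v
    proof -
      have "c f \<cdot> k v = l v \<cdot> tr f (k v) (leg v) (p (leg v) \<cdot> ?q v)"
        by (rule c_tr) (use qr[OF v] in simp_all)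
      also have "tr f (k v) (leg v) (p (leg v) \<cdot> ?q v) = ?q v"
        unfolding k_def using qr[OF v] by (simp add: tr_tr tr_self)
      finally have "c' \<cdot> k v = ?l v"
        by - (rule pb_ext[of \<pi> f]; simp add: c'_comp del: lift_simps lift_comp_simps)
      then show ?thesis using hk[OF v] by (simp del: lift_simps)
    qed
    moreover have "pb2 C \<pi> f \<cdot> (c' \<cdot> h) = pb2 C \<pi> f" by (simp add: c'_comp)
    moreover have "arr (Ident C (pb C \<pi> f)) \<and> src (Ident C (pb C \<pi> f)) = pb C \<pi> f \<and>
      tgt (Ident C (pb C \<pi> f)) = src (pb2 C \<pi> f) \<and> pb2 C \<pi> f \<cdot> Ident C (pb C \<pi> f) = pb2 C \<pi> f"
      "\<And>v. v \<in> Obj J \<Longrightarrow> Ident C (pb C \<pi> f) \<cdot> ?l v = ?l v"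
      by (simp_all del: lift_simps)
    moreover have "arr (c' \<cdot> h)" "src (c' \<cdot> h) = pb C \<pi> f" "tgt (c' \<cdot> h) = src (pb2 C \<pi> f)" by simp_all
    ultimately have c'h: "c' \<cdot> h = Ident C (pb C \<pi> f)" by blast
    have inv: "inverse_arrows C c' h" using hc' c'h by (simp add: inverse_arrows_def Hom_iff)
    have "is_pullback C \<pi> f (E f) (pb1 C \<pi> f \<cdot> c') (pb2 C \<pi> f \<cdot> c')"
      by (rule pullback_iso[OF pb _ _ inv]) simp_all
    then show "is_pullback C \<pi> f (E f) (c f) (p f)" by simp
  qed
qed

end

theorem (in cartesian_descent) objects_glue:
  obtains L \<pi> c where "\<pi> \<in> Hom C L Y" "\<And>f. f \<in> S \<Longrightarrow> is_pullback C \<pi> f (E f) (c f) (p f)"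
    "\<And>f g. f \<in> S \<Longrightarrow> arr g \<Longrightarrow> tgt g = src f \<Longrightarrow> c f \<cdot> e f g = c (f \<cdot> g)"
proof -
  obtain I F where "covering_family \<kappa> C \<tau> Y I F" "F ` I \<subseteq> S"
    using site Y S unfolding site_def by blast
  then interpret descent_cover C \<kappa> \<tau> Y S E p e I F by unfold_locales
  show ?thesis by (rule glued_object) (rule that)
qed


section \<open>Principal bundles are local on the base\<close>

locale principal_bundles = descent_site C \<kappa> \<tau> + group_in_category C G
  for C :: "('o, 'a, 'm) pcat_scheme" (structure) and \<kappa> :: "'k rel" and \<tau> :: "'o \<Rightarrow> 'a set set"
    and G :: "('o, 'a) grp"
begin

definition trivializing_sieve :: "('o, 'a) gbundle \<Rightarrow> 'a set" where
  "trivializing_sieve P = {f \<in> Arr C. tgt f = tgt (proj P) \<and> (\<exists>t. trivializes P f t)}"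

lemma trivializing_sieve_sieve:
  assumes "G_object P" shows "sieve C (tgt (proj P)) (trivializing_sieve P)"
  using trivializes_restrict[OF assms] unfolding sieve_def trivializing_sieve_def by fastforce

text \<open>A covering family that trivializes \<open>P\<close> generates a subsieve of the trivializing sieve; conversely a
  covering sieve contains a small covering family, by the second axiom of a site.\<close>

lemma principal_bundle_iff:
  "principal_bundle \<kappa> C \<tau> G Y P \<longleftrightarrow> G_object P \<and> tgt (proj P) = Y \<and> trivializing_sieve P \<in> \<tau> Y"
proof
  assume A: "principal_bundle \<kappa> C \<tau> G Y P"
  then have Y: "tgt (proj P) = Y" "Y \<in> Obj C" by (simp_all add: principal_bundle_def equivariant_def Hom_iff)
  have P: "G_object P"
    using A unfolding principal_bundle_def G_object_def Y(1) by (simp add: equivariant_def Hom_iff)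
  obtain I f where cov: "covering_family \<kappa> C \<tau> Y I f"
    and "\<And>i. i \<in> I \<Longrightarrow> \<exists>\<phi>. iso_arrow C \<phi> \<and>
       bundle_morphism C G (pullback_bundle C G (f i) P) (trivial_bundle C G (src (f i))) \<phi>"
    using A unfolding principal_bundle_def by blast
  moreover have f: "\<And>i. i \<in> I \<Longrightarrow> arr (f i) \<and> tgt (f i) = tgt (proj P)"
    using cov Y(1) by (simp add: covering_family_def)
  ultimately have "\<And>i. i \<in> I \<Longrightarrow> f i \<in> trivializing_sieve P"
    using trivial_bundle_iso_iff[OF P] by (simp add: trivializing_sieve_def)
  then have "generated_sieve C I f \<subseteq> trivializing_sieve P"
    using trivializing_sieve_sieve[OF P] by (auto simp: generated_sieve_def sieve_def)
  then have "trivializing_sieve P \<in> \<tau> Y"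
    using cov trivializing_sieve_sieve[OF P] cover_superset[OF Y(2), of "generated_sieve C I f" "trivializing_sieve P"]
    unfolding Y(1) covering_family_def by blast
  then show "G_object P \<and> tgt (proj P) = Y \<and> trivializing_sieve P \<in> \<tau> Y" using P Y by simp
next
  assume A: "G_object P \<and> tgt (proj P) = Y \<and> trivializing_sieve P \<in> \<tau> Y"
  then have P: "G_object P" and Y: "tgt (proj P) = Y" "Y \<in> Obj C" by auto
  obtain I f where cov: "covering_family \<kappa> C \<tau> Y I f" "f ` I \<subseteq> trivializing_sieve P"
    using site A Y(2) unfolding site_def by blast
  have "\<exists>\<phi>. iso_arrow C \<phi> \<and>
       bundle_morphism C G (pullback_bundle C G (f i) P) (trivial_bundle C G (src (f i))) \<phi>" if "i \<in> I" for i
  proof -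
    have "f i \<in> trivializing_sieve P" using that cov(2) by blast
    then show ?thesis using trivial_bundle_iso_iff[OF P] by (simp add: trivializing_sieve_def)
  qed
  then show "principal_bundle \<kappa> C \<tau> G Y P"
    using A cov(1) Y P unfolding principal_bundle_def G_object_def by auto
qed

lemma principal_pullback:
  assumes P: "principal_bundle \<kappa> C \<tau> G Y P" and f: "arr f" "tgt f = Y"
  shows "principal_bundle \<kappa> C \<tau> G (src f) (pullback_bundle C G f P)"
proof -
  have P': "G_object P" "tgt (proj P) = Y" "trivializing_sieve P \<in> \<tau> Y"
    using P by (simp_all add: principal_bundle_iff)
  note [simp] = P'(1,2) f
  let ?Q = "pullback_bundle C G f P"
  have [simp]: "tgt (proj ?Q) = src f" by (simp add: pullback_bundle_simps)
  have Q: "G_object ?Q" by simp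
  have "pullback_sieve C f (trivializing_sieve P) \<subseteq> trivializing_sieve ?Q"
    using trivializes_pullback[of P f] by (auto simp: pullback_sieve_def trivializing_sieve_def)
  moreover have "pullback_sieve C f (trivializing_sieve P) \<in> \<tau> (src f)"
    by (rule cover_pullback) (use P' in simp_all)
  ultimately have "trivializing_sieve ?Q \<in> \<tau> (src f)"
    using trivializing_sieve_sieve[OF Q]
      cover_superset[of "src f" "pullback_sieve C f (trivializing_sieve P)" "trivializing_sieve ?Q"] by simp
  then show ?thesis by (simp add: principal_bundle_iff)
qed

text \<open>For \<open>f \<in> S\<close> the trivializations of \<open>Q\<close> are pushed forward to \<open>P\<close>, so the trivializing sieve of \<open>P\<close> covers
  after pullback along every \<open>f \<in> S\<close>, and hence covers.\<close>

lemma principal_local: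
  assumes P: "G_object P" "tgt (proj P) = Y" and S: "S \<in> \<tau> Y"
    and loc: "\<And>f. f \<in> S \<Longrightarrow> \<exists>Q c. principal_bundle \<kappa> C \<tau> G (src f) Q \<and>
      is_pullback C (proj P) f (total Q) c (proj Q) \<and> equivariant C G (total Q) (act Q) (total P) (act P) c"
  shows "principal_bundle \<kappa> C \<tau> G Y P"
proof -
  have Y: "Y \<in> Obj C" using P by auto
  have "trivializing_sieve P \<in> \<tau> Y"
  proof (rule cover_local[OF Y S])
    show "sieve C Y (trivializing_sieve P)" using trivializing_sieve_sieve[OF P(1)] P(2) by simp
  next
    fix f assume f: "f \<in> S"
    then have f' [simp]: "arr f" "tgt f = tgt (proj P)" using cover_arr[OF S Y] P(2) by auto
    obtain Q c where Q: "principal_bundle \<kappa> C \<tau> G (src f) Q"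
      "is_pullback C (proj P) f (total Q) c (proj Q)" "equivariant C G (total Q) (act Q) (total P) (act P) c"
      using loc[OF f] by blast
    then have Q': "G_object Q" "tgt (proj Q) = src f" "trivializing_sieve Q \<in> \<tau> (src f)"
      by (simp_all add: principal_bundle_iff)
    have s: "sieve C (src f) (pullback_sieve C f (trivializing_sieve P))"
      using trivializing_sieve_sieve[OF P(1)] unfolding sieve_def pullback_sieve_def by force
    have "trivializing_sieve Q \<subseteq> pullback_sieve C f (trivializing_sieve P)"
      using trivializes_push[OF P(1) Q'(1) f' Q'(2)[symmetric] Q(2,3)] Q'(2)
      unfolding trivializing_sieve_def pullback_sieve_def by fastforce
    then show "pullback_sieve C f (trivializing_sieve P) \<in> \<tau> (src f)"
      using Q'(3) s cover_superset[of "src f" "trivializing_sieve Q"] by simp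
  qed
  then show ?thesis using P by (simp add: principal_bundle_iff)
qed

end

section \<open>The quotient prestack\<close>

locale quotient = principal_bundles C \<kappa> \<tau> G
  for C :: "('o, 'a, 'm) pcat_scheme" (structure) and \<kappa> :: "'k rel" and \<tau> :: "'o \<Rightarrow> 'a set set"
    and G :: "('o, 'a) grp" +
  fixes X :: 'o and x :: 'a
  assumes X_action: "action C G X x"
begin

abbreviation "qobj \<equiv> quotient_obj \<kappa> C \<tau> G X x"
abbreviation "qfib \<equiv> quotient_fib \<kappa> C \<tau> G X x"
abbreviation "pullq \<equiv> quotient_pull_obj C G"
abbreviation tot :: "('o, 'a) qobj \<Rightarrow> 'o" where "tot A \<equiv> total (fst A)"
abbreviation pj :: "('o, 'a) qobj \<Rightarrow> 'a" where "pj A \<equiv> proj (fst A)"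
abbreviation ac :: "('o, 'a) qobj \<Rightarrow> 'a" where "ac A \<equiv> act (fst A)"

lemma X_simps [simp]: "X \<in> Obj C" "arr x" "src x = Prod C K X" "tgt x = X"
  using X_action by (simp_all add: action_iff)

lemma qobj_iff:
  "A \<in> qobj Y \<longleftrightarrow> principal_bundle \<kappa> C \<tau> G Y (fst A) \<and> arr (snd A) \<and> src (snd A) = tot A \<and> tgt (snd A) = X \<and>
     (\<forall>g a. arr g \<longrightarrow> arr a \<longrightarrow> src g = src a \<longrightarrow> tgt g = K \<longrightarrow> tgt a = tot A \<longrightarrow>
        snd A \<cdot> (ac A \<cdot> pair C g a) = x \<cdot> pair C g (snd A \<cdot> a))"
proof (cases "principal_bundle \<kappa> C \<tau> G Y (fst A)")
  case True
  then have "G_object (fst A)" by (simp add: principal_bundle_iff)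
  then show ?thesis using True by (simp add: quotient_obj_def equivariant_iff split_beta)
qed (auto simp: quotient_obj_def)

lemma qobj_simps:
  assumes "A \<in> qobj Y"
  shows "G_object (fst A)" "tgt (pj A) = Y" "arr (snd A)" "src (snd A) = tot A" "tgt (snd A) = X"
  using assms by (simp_all add: qobj_iff principal_bundle_iff)

lemma qobj_base: "A \<in> qobj Y \<Longrightarrow> Y \<in> Obj C"
  using qobj_simps[of A Y] by auto

text \<open>Maps of bundles with a map to \<open>X\<close> that lie over an arrow \<open>f\<close> of base objects. They correspond to
  morphisms into the pullback along \<open>f\<close>, and they compose. The functors of the prestack and
  its coherence arrows are all obtained from them by \<open>qmor_lift\<close>, without further calculation
  with the pullback action.\<close>

definition over :: "'a \<Rightarrow> ('o, 'a) qobj \<Rightarrow> 'a \<Rightarrow> ('o, 'a) qobj \<Rightarrow> bool" where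
  "over f B c A \<longleftrightarrow> arr c \<and> src c = tot B \<and> tgt c = tot A \<and>
     (\<forall>g a. arr g \<longrightarrow> arr a \<longrightarrow> src g = src a \<longrightarrow> tgt g = K \<longrightarrow> tgt a = tot B \<longrightarrow>
        c \<cdot> (ac B \<cdot> pair C g a) = ac A \<cdot> pair C g (c \<cdot> a)) \<and>
     pj A \<cdot> c = f \<cdot> pj B \<and> snd A \<cdot> c = snd B"

definition qmor :: "('o, 'a) qobj \<Rightarrow> 'a \<Rightarrow> ('o, 'a) qobj \<Rightarrow> bool" where
  "qmor A \<phi> B \<longleftrightarrow> bundle_morphism C G (fst A) (fst B) \<phi> \<and> snd B \<cdot> \<phi> = snd A"

lemma qmor_iff:
  assumes "A \<in> qobj Y" "B \<in> qobj Y"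
  shows "qmor A \<phi> B \<longleftrightarrow> over (Ident C Y) A \<phi> B"
  using qobj_simps[OF assms(1)] qobj_simps[OF assms(2)]
  unfolding qmor_def bundle_morphism_def over_def by (auto simp: equivariant_G_object_iff)

lemma qmorD:
  assumes "qmor A \<phi> B" "A \<in> qobj Y" "B \<in> qobj Y"
  shows "arr \<phi>" "src \<phi> = tot A" "tgt \<phi> = tot B" "pj B \<cdot> \<phi> = pj A" "snd B \<cdot> \<phi> = snd A"
  using assms qobj_simps[OF assms(2)] by (simp_all add: qmor_iff over_def)

lemma overD:
  assumes "over f B c A"
  shows "arr c" "src c = tot B" "tgt c = tot A" "pj A \<cdot> c = f \<cdot> pj B" "snd A \<cdot> c = snd B"
    "\<And>g a. arr g \<Longrightarrow> arr a \<Longrightarrow> src g = src a \<Longrightarrow> tgt g = K \<Longrightarrow> tgt a = tot B \<Longrightarrow>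
        c \<cdot> (ac B \<cdot> pair C g a) = ac A \<cdot> pair C g (c \<cdot> a)"
  using assms by (simp_all add: over_def)

lemma over_comp:
  assumes c: "over f B c A" and d: "over g D d B" and A: "A \<in> qobj Y" and B: "B \<in> qobj (src f)" and D: "D \<in> qobj (src g)"
    and f: "arr f" "arr g" "tgt g = src f"
  shows "over (f \<cdot> g) D (c \<cdot> d) A"
proof -
  note [simp] = qobj_simps[OF A] qobj_simps[OF B] qobj_simps[OF D] overD(1-3)[OF c] overD(1-3)[OF d] f
  have "pj A \<cdot> (c \<cdot> d) = f \<cdot> (g \<cdot> pj D)"
    using comp_eq_comp[OF overD(4)[OF c], of d] overD(4)[OF d] by simp
  moreover have "snd A \<cdot> (c \<cdot> d) = snd D"
    using comp_eq_arr[OF overD(5)[OF c], of d] overD(5)[OF d] by simp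
  moreover have "c \<cdot> (d \<cdot> (ac D \<cdot> pair C k a)) = ac A \<cdot> pair C k (c \<cdot> (d \<cdot> a))"
    if "arr k" "arr a" "src k = src a" "tgt k = K" "tgt a = tot D" for k a
    using overD(6)[OF c, of k "d \<cdot> a"] overD(6)[OF d, of k a] that by simp
  ultimately show ?thesis by (simp add: over_def)
qed

lemma over_Ident_left: "over f B c A \<Longrightarrow> A \<in> qobj Y \<Longrightarrow> B \<in> qobj (src f) \<Longrightarrow> arr f \<Longrightarrow> tgt f = Y \<Longrightarrow> qmor A \<phi> A'
    \<Longrightarrow> A' \<in> qobj Y \<Longrightarrow> over f B (\<phi> \<cdot> c) A'"
  using over_comp[of "Ident C Y" A \<phi> A' f B c] qobj_base[of A Y] by (simp add: qmor_iff)

lemma over_Ident_right: "over f B c A \<Longrightarrow> A \<in> qobj Y \<Longrightarrow> B \<in> qobj (src f) \<Longrightarrow> arr f \<Longrightarrow> tgt f = Y \<Longrightarrow> qmor B' \<phi> B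
    \<Longrightarrow> B' \<in> qobj (src f) \<Longrightarrow> over f B' (c \<cdot> \<phi>) A"
  using over_comp[of f B c A "Ident C (src f)" B' \<phi>] by (simp add: qmor_iff)

lemma pullq_simps [simp]:
  "fst (pullq f A) = pullback_bundle C G f (fst A)" "snd (pullq f A) = snd A \<cdot> pb1 C (pj A) f"
  "total (pullback_bundle C G f P) = pb C (proj P) f" "proj (pullback_bundle C G f P) = pb2 C (proj P) f"
  by (simp_all add: quotient_pull_obj_def split_beta pullback_bundle_def)

lemma pullq_obj:
  assumes A: "A \<in> qobj Y" and f: "arr f" "tgt f = Y"
  shows "pullq f A \<in> qobj (src f)"
proof -
  note [simp] = qobj_simps[OF A] f
  have "principal_bundle \<kappa> C \<tau> G (src f) (pullback_bundle C G f (fst A))"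
    using principal_pullback[of Y "fst A" f] A by (simp add: qobj_iff)
  then show ?thesis using A pullback_act_arr(1-3)[of "fst A" f] by (simp add: qobj_iff)
qed

lemma over_pb1:
  assumes A: "A \<in> qobj Y" and f: "arr f" "tgt f = Y"
  shows "over f (pullq f A) (pb1 C (pj A) f) A"
  using qobj_simps[OF A] f by (simp add: over_def pb_square)

lemma qmor_lift:
  assumes A: "A \<in> qobj Y" and f: "arr f" "tgt f = Y" and B: "B \<in> qobj (src f)" and c: "over f B c A"
  shows "qmor B (lift C (pj A) f c (pj B)) (pullq f A)"
proof -
  note [simp] = qobj_simps[OF A] f qobj_simps[OF B] overD(1-4)[OF c]
  let ?l = "lift C (pj A) f c (pj B)"
  have l: "arr ?l" "src ?l = tot B" "tgt ?l = pb C (pj A) f" "pb1 C (pj A) f \<cdot> ?l = c" "pb2 C (pj A) f \<cdot> ?l = pj B"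
    by simp_all
  have "?l \<cdot> (ac B \<cdot> pair C g a) = act (pullback_bundle C G f (fst A)) \<cdot> pair C g (?l \<cdot> a)"
    if [simp]: "arr g" "arr a" "src g = src a" "tgt g = K" "tgt a = tot B" for g a
    using overD(6)[OF c, of g a] pullback_act_arr(1-3)[of "fst A" f]
    by - (rule pb_ext[of "pj A" f]; simp)
  moreover have "snd A \<cdot> (pb1 C (pj A) f \<cdot> ?l) = snd B" using overD(5)[OF c] by simp
  ultimately show ?thesis unfolding qmor_iff[OF B pullq_obj[OF A f]] over_def by simp
qed

lemma qfib_Hom_iff:
  "h \<in> Hom (qfib Y) A B \<longleftrightarrow> (\<exists>\<phi>. h = (A, \<phi>, B) \<and> A \<in> qobj Y \<and> B \<in> qobj Y \<and> qmor A \<phi> B)"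
  by (cases A; cases B) (auto simp: quotient_fib_def Hom_def qmor_def)

lemma qfib_Arr_iff:
  "h \<in> Arr (qfib Y) \<longleftrightarrow> (\<exists>A \<phi> B. h = (A, \<phi>, B) \<and> A \<in> qobj Y \<and> B \<in> qobj Y \<and> qmor A \<phi> B)"
  by (auto simp: quotient_fib_def qmor_def)

lemma qfib_simps [simp]:
  "Obj (qfib Y) = qobj Y" "Dom (qfib Y) (A, \<phi>, B) = A" "Cod (qfib Y) (A, \<phi>, B) = B"
  "Comp (qfib Y) (B', \<psi>, D) (A, \<phi>, B) = (A, \<psi> \<cdot> \<phi>, D)"
  "Ident (qfib Y) A = (A, Ident C (tot A), A)"
  by (auto simp: quotient_fib_def split: prod.splits)

lemma qmor_Ident: "A \<in> qobj Y \<Longrightarrow> qmor A (Ident C (tot A)) A"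
  using qobj_simps[of A Y] by (simp add: qmor_iff over_def)

lemma qmor_comp: "qmor A \<phi> B \<Longrightarrow> qmor B \<psi> D \<Longrightarrow> A \<in> qobj Y \<Longrightarrow> B \<in> qobj Y \<Longrightarrow> D \<in> qobj Y \<Longrightarrow> qmor A (\<psi> \<cdot> \<phi>) D"
  using over_comp[of "Ident C Y" B \<psi> D "Ident C Y" A \<phi> Y] qobj_base[of A Y] by (simp add: qmor_iff)

lemma qfib_category: "category (qfib Y)"
proof
  fix f assume "f \<in> Arr (qfib Y)" then show "Dom (qfib Y) f \<in> Obj (qfib Y)" "Cod (qfib Y) f \<in> Obj (qfib Y)"
    by (auto simp: qfib_Arr_iff)
next
  fix A assume "A \<in> Obj (qfib Y)" then show "Ident (qfib Y) A \<in> Hom (qfib Y) A A"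
    by (simp add: qfib_Hom_iff qmor_Ident)
next
  fix f A B g D assume "f \<in> Hom (qfib Y) A B" "g \<in> Hom (qfib Y) B D"
  then show "Comp (qfib Y) g f \<in> Hom (qfib Y) A D" by (auto simp: qfib_Hom_iff intro: qmor_comp)
next
  fix f A B g D h E assume "f \<in> Hom (qfib Y) A B" "g \<in> Hom (qfib Y) B D" "h \<in> Hom (qfib Y) D E"
  then obtain u v w where "f = (A, u, B)" "g = (B, v, D)" "h = (D, w, E)"
    "A \<in> qobj Y" "B \<in> qobj Y" "D \<in> qobj Y" "E \<in> qobj Y" "qmor A u B" "qmor B v D" "qmor D w E"
    by (auto simp: qfib_Hom_iff)
  then show "Comp (qfib Y) h (Comp (qfib Y) g f) = Comp (qfib Y) (Comp (qfib Y) h g) f"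
    using qmorD(1-3)[of A u B Y] qmorD(1-3)[of B v D Y] qmorD(1-3)[of D w E Y] by simp
next
  fix f A B assume "f \<in> Hom (qfib Y) A B"
  then obtain u where "f = (A, u, B)" "A \<in> qobj Y" "B \<in> qobj Y" "qmor A u B" by (auto simp: qfib_Hom_iff)
  then show "Comp (qfib Y) (Ident (qfib Y) B) f = f" "Comp (qfib Y) f (Ident (qfib Y) A) = f"
    using qmorD(1-3)[of A u B Y] by simp_all
qed

text \<open>The inverse of an invertible morphism is again equivariant and compatible with the maps to the base
  and to \<open>X\<close>, so isomorphisms in the fibres are the morphisms that are invertible in \<open>C\<close>.\<close>

lemma qfib_inverse_iff:
  assumes "A \<in> qobj Y" "B \<in> qobj Y" "qmor A \<phi> B"
  shows "inverse_arrows (qfib Y) (A, \<phi>, B) h \<longleftrightarrow> (\<exists>j. h = (B, j, A) \<and> inverse_arrows C \<phi> j)"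
proof
  assume "inverse_arrows (qfib Y) (A, \<phi>, B) h"
  then show "\<exists>j. h = (B, j, A) \<and> inverse_arrows C \<phi> j"
    using qmorD(1-3)[OF assms(3,1,2)] assms qmorD(1-3)[of B _ A, OF _ assms(2,1)]
    by (auto simp: inverse_arrows_def qfib_Hom_iff Hom_iff)
next
  assume "\<exists>j. h = (B, j, A) \<and> inverse_arrows C \<phi> j"
  then obtain j where h: "h = (B, j, A)" and j: "inverse_arrows C \<phi> j" by blast
  note A = qobj_simps[OF assms(1)] and B = qobj_simps[OF assms(2)]
  note \<phi> = qmorD[OF assms(3,1,2)]
  note [simp] = A B \<phi>(1-3)
  have J: "arr j" "src j = tot B" "tgt j = tot A" "j \<cdot> \<phi> = Ident C (tot A)" "\<phi> \<cdot> j = Ident C (tot B)"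
    using j by (simp_all add: inverse_arrows_def Hom_iff)
  note [simp] = J(1-3)
  have "equivariant C G (tot B) (ac B) (tot A) (ac A) j"
    by (rule equivariant_inverse[OF _ j]) (use assms(3) in \<open>simp_all add: qmor_def bundle_morphism_def\<close>)
  moreover have "pj A \<cdot> j = pj B" "snd A \<cdot> j = snd B"
    using comp_eq_arr[OF \<phi>(4), of j] comp_eq_arr[OF \<phi>(5), of j] J(5) by simp_all
  ultimately have "qmor B j A" by (simp add: qmor_def bundle_morphism_def)
  then show "inverse_arrows (qfib Y) (A, \<phi>, B) h"
    using assms J(4,5) unfolding h inverse_arrows_def by (simp add: qfib_Hom_iff qfib_Arr_iff)
qed

lemma qfib_iso:
  assumes "A \<in> qobj Y" "B \<in> qobj Y" "qmor A \<phi> B" "iso_arrow C \<phi>"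
  shows "iso_arrow (qfib Y) (A, \<phi>, B)"
  using assms(4) qfib_inverse_iff[OF assms(1-3)] unfolding iso_arrow_def by blast

definition pull_arr :: "'a \<Rightarrow> ('o, 'a) qobj \<Rightarrow> 'a \<Rightarrow> ('o, 'a) qobj \<Rightarrow> 'a" where
  "pull_arr f A \<phi> B = lift C (pj B) f (\<phi> \<cdot> pb1 C (pj A) f) (pb2 C (pj A) f)"

lemma pull_arr_simps:
  assumes "A \<in> qobj Y" "B \<in> qobj Y" "qmor A \<phi> B" "arr f" "tgt f = Y"
  shows "arr (pull_arr f A \<phi> B)" "src (pull_arr f A \<phi> B) = pb C (pj A) f" "tgt (pull_arr f A \<phi> B) = pb C (pj B) f"
    "pb1 C (pj B) f \<cdot> pull_arr f A \<phi> B = \<phi> \<cdot> pb1 C (pj A) f" "pb2 C (pj B) f \<cdot> pull_arr f A \<phi> B = pb2 C (pj A) f"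
    "qmor (pullq f A) (pull_arr f A \<phi> B) (pullq f B)"
proof -
  note [simp] = qobj_simps[OF assms(1)] qobj_simps[OF assms(2)] assms(4,5) qmorD(1-3)[OF assms(3,1,2)]
  have e: "pj B \<cdot> (\<phi> \<cdot> pb1 C (pj A) f) = f \<cdot> pb2 C (pj A) f"
    using comp_eq_arr[OF qmorD(4)[OF assms(3,1,2)], of "pb1 C (pj A) f"] by (simp add: pb_square)
  then show "arr (pull_arr f A \<phi> B)" "src (pull_arr f A \<phi> B) = pb C (pj A) f" "tgt (pull_arr f A \<phi> B) = pb C (pj B) f"
    "pb1 C (pj B) f \<cdot> pull_arr f A \<phi> B = \<phi> \<cdot> pb1 C (pj A) f" "pb2 C (pj B) f \<cdot> pull_arr f A \<phi> B = pb2 C (pj A) f"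
    by (simp_all add: pull_arr_def)
  have "over f (pullq f A) (\<phi> \<cdot> pb1 C (pj A) f) B"
    by (rule over_Ident_left[OF over_pb1[OF assms(1,4,5)] assms(1) pullq_obj[OF assms(1,4,5)] assms(4,5,3,2)])
  from qmor_lift[OF assms(2,4,5) pullq_obj[OF assms(1,4,5)] this]
  show "qmor (pullq f A) (pull_arr f A \<phi> B) (pullq f B)" by (simp add: pull_arr_def)
qed

lemma pull_arr_comp_simps:
  assumes "A \<in> qobj Y" "B \<in> qobj Y" "qmor A \<phi> B" "arr f" "tgt f = Y" "arr h" "tgt h = pb C (pj A) f"
  shows "pb1 C (pj B) f \<cdot> (pull_arr f A \<phi> B \<cdot> h) = \<phi> \<cdot> (pb1 C (pj A) f \<cdot> h)"
    "pb2 C (pj B) f \<cdot> (pull_arr f A \<phi> B \<cdot> h) = pb2 C (pj A) f \<cdot> h"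
proof -
  note [simp] = qobj_simps[OF assms(1)] qobj_simps[OF assms(2)] assms(4-7) qmorD(1-3)[OF assms(3,1,2)] pull_arr_simps(1-3)[OF assms(1-5)]
  show "pb1 C (pj B) f \<cdot> (pull_arr f A \<phi> B \<cdot> h) = \<phi> \<cdot> (pb1 C (pj A) f \<cdot> h)"
    using comp_eq_comp[OF pull_arr_simps(4)[OF assms(1-5)], of h] by simp
  show "pb2 C (pj B) f \<cdot> (pull_arr f A \<phi> B \<cdot> h) = pb2 C (pj A) f \<cdot> h"
    using comp_eq_arr[OF pull_arr_simps(5)[OF assms(1-5)], of h] by simp
qed

lemma quotient_pull_simps [simp]:
  "omap (quotient_pull C G f) = pullq f"
  "amap (quotient_pull C G f) (A, \<phi>, B) = (pullq f A, pull_arr f A \<phi> B, pullq f B)"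
  by (auto simp: quotient_pull_def pull_arr_def split: prod.splits)

lemma pull_arr_Ident:
  assumes "A \<in> qobj Y" "arr f" "tgt f = Y"
  shows "pull_arr f A (Ident C (tot A)) A = Ident C (pb C (pj A) f)"
  using pull_arr_simps(1-5)[OF assms(1,1) qmor_Ident[OF assms(1)] assms(2,3)] qobj_simps[OF assms(1)] assms(2,3)
  by - (rule pb_ext[of "pj A" f]; simp)

lemma pull_arr_comp:
  assumes "A \<in> qobj Y" "B \<in> qobj Y" "D \<in> qobj Y" "qmor A \<phi> B" "qmor B \<psi> D" "arr f" "tgt f = Y"
  shows "pull_arr f A (\<psi> \<cdot> \<phi>) D = pull_arr f B \<psi> D \<cdot> pull_arr f A \<phi> B"
proof -
  note 1 = pull_arr_simps(1-5)[OF assms(1,2,4,6,7)] and 2 = pull_arr_simps(1-5)[OF assms(2,3,5,6,7)]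
    and 3 = pull_arr_simps(1-5)[OF assms(1,3) qmor_comp[OF assms(4,5,1,2,3)] assms(6,7)]
  note [simp] = qobj_simps[OF assms(1)] qobj_simps[OF assms(2)] qobj_simps[OF assms(3)] assms(6,7) 1 2 3
     qmorD(1-3)[OF assms(4,1,2)] qmorD(1-3)[OF assms(5,2,3)]
  show ?thesis
    by (rule pb_ext[of "pj D" f]) (simp_all add: pull_arr_comp_simps[OF assms(2,3,5,6,7)])
qed

lemma pull_functor:
  assumes "arr f"
  shows "is_functor (qfib (tgt f)) (qfib (src f)) (quotient_pull C G f)"
  unfolding is_functor_def
proof (intro conjI ballI impI)
  fix A assume "A \<in> Obj (qfib (tgt f))"
  then have A: "A \<in> qobj (tgt f)" by simp
  then show "omap (quotient_pull C G f) A \<in> Obj (qfib (src f))" using pullq_obj assms by simp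
  show "amap (quotient_pull C G f) (Ident (qfib (tgt f)) A) = Ident (qfib (src f)) (omap (quotient_pull C G f) A)"
    using pull_arr_Ident[OF A assms refl] by simp
next
  fix h assume "h \<in> Arr (qfib (tgt f))"
  then obtain A \<phi> B where h: "h = (A, \<phi>, B)" "A \<in> qobj (tgt f)" "B \<in> qobj (tgt f)" "qmor A \<phi> B"
    by (auto simp: qfib_Arr_iff)
  then show "amap (quotient_pull C G f) h \<in> Hom (qfib (src f)) (omap (quotient_pull C G f) (Dom (qfib (tgt f)) h))
      (omap (quotient_pull C G f) (Cod (qfib (tgt f)) h))"
    using pull_arr_simps(6)[OF h(2-4) assms refl] pullq_obj assms by (simp add: qfib_Hom_iff)
next
  fix h k assume "h \<in> Arr (qfib (tgt f))" "k \<in> Arr (qfib (tgt f))" "Cod (qfib (tgt f)) h = Dom (qfib (tgt f)) k"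
  then obtain A \<phi> B \<psi> D where "h = (A, \<phi>, B)" "k = (B, \<psi>, D)" "A \<in> qobj (tgt f)" "B \<in> qobj (tgt f)" "D \<in> qobj (tgt f)"
    "qmor A \<phi> B" "qmor B \<psi> D"
    by (auto simp: qfib_Arr_iff)
  then show "amap (quotient_pull C G f) (Comp (qfib (tgt f)) k h)
     = Comp (qfib (src f)) (amap (quotient_pull C G f) k) (amap (quotient_pull C G f) h)"
    using pull_arr_comp[of A "tgt f" B D \<phi> \<psi> f] assms by simp
qed

definition coh_arr :: "'a \<Rightarrow> 'a \<Rightarrow> ('o, 'a) qobj \<Rightarrow> 'a" where
  "coh_arr f g A = lift C (pj A) (f \<cdot> g) (pb1 C (pj A) f \<cdot> pb1 C (pb2 C (pj A) f) g) (pb2 C (pb2 C (pj A) f) g)"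

lemma quotient_coh_eq: "quotient_coh C G f g A = (pullq g (pullq f A), coh_arr f g A, pullq (f \<cdot> g) A)"
  by (simp add: quotient_coh_def coh_arr_def split: prod.splits)

lemma coh_arr_simps:
  assumes A: "A \<in> qobj Y" and f: "arr f" "tgt f = Y" and g: "arr g" "tgt g = src f"
  shows "arr (coh_arr f g A)" "src (coh_arr f g A) = pb C (pb2 C (pj A) f) g" "tgt (coh_arr f g A) = pb C (pj A) (f \<cdot> g)"
    "pb1 C (pj A) (f \<cdot> g) \<cdot> coh_arr f g A = pb1 C (pj A) f \<cdot> pb1 C (pb2 C (pj A) f) g"
    "pb2 C (pj A) (f \<cdot> g) \<cdot> coh_arr f g A = pb2 C (pb2 C (pj A) f) g"
    "qmor (pullq g (pullq f A)) (coh_arr f g A) (pullq (f \<cdot> g) A)" "iso_arrow C (coh_arr f g A)"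
proof -
  note [simp] = qobj_simps[OF A] f g
  note fA = pullq_obj[OF A f]
  note gA = pullq_obj[OF fA g]
  have e: "pj A \<cdot> (pb1 C (pj A) f \<cdot> pb1 C (pb2 C (pj A) f) g) = f \<cdot> (g \<cdot> pb2 C (pb2 C (pj A) f) g)"
    by (simp add: pb_square_comp pb_square)
  then show c: "arr (coh_arr f g A)" "src (coh_arr f g A) = pb C (pb2 C (pj A) f) g" "tgt (coh_arr f g A) = pb C (pj A) (f \<cdot> g)"
    "pb1 C (pj A) (f \<cdot> g) \<cdot> coh_arr f g A = pb1 C (pj A) f \<cdot> pb1 C (pb2 C (pj A) f) g"
    "pb2 C (pj A) (f \<cdot> g) \<cdot> coh_arr f g A = pb2 C (pb2 C (pj A) f) g"
    by (simp_all add: coh_arr_def)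
  have "over (f \<cdot> g) (pullq g (pullq f A)) (pb1 C (pj A) f \<cdot> pb1 C (pb2 C (pj A) f) g) A"
    using over_comp[OF over_pb1[OF A f] over_pb1[OF fA g] A fA gA f(1) g] by simp
  from qmor_lift[OF A _ _ _ this] gA
  show "qmor (pullq g (pullq f A)) (coh_arr f g A) (pullq (f \<cdot> g) A)" by (simp add: coh_arr_def)
  have "is_pullback C (pj A) (f \<cdot> g) (pb C (pb2 C (pj A) f) g) (pb1 C (pj A) f \<cdot> pb1 C (pb2 C (pj A) f) g) (pb2 C (pb2 C (pj A) f) g)"
    by (rule pullback_paste[OF pb]) (simp_all add: pb)
  from pullback_comparison_iso[OF this pb, of "coh_arr f g A"] c
  show "iso_arrow C (coh_arr f g A)" by simp
qed

lemma coh_arr_comp_simps: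
  assumes A: "A \<in> qobj Y" and f: "arr f" "tgt f = Y" and g: "arr g" "tgt g = src f"
    and h: "arr h" "tgt h = pb C (pb2 C (pj A) f) g"
  shows "pb1 C (pj A) (f \<cdot> g) \<cdot> (coh_arr f g A \<cdot> h) = pb1 C (pj A) f \<cdot> (pb1 C (pb2 C (pj A) f) g \<cdot> h)"
    "pb2 C (pj A) (f \<cdot> g) \<cdot> (coh_arr f g A \<cdot> h) = pb2 C (pb2 C (pj A) f) g \<cdot> h"
proof -
  note [simp] = qobj_simps[OF A] f g h coh_arr_simps(1-3)[OF A f g]
  show "pb1 C (pj A) (f \<cdot> g) \<cdot> (coh_arr f g A \<cdot> h) = pb1 C (pj A) f \<cdot> (pb1 C (pb2 C (pj A) f) g \<cdot> h)"
    using comp_eq_comp[OF coh_arr_simps(4)[OF A f g], of h] by simp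
  show "pb2 C (pj A) (f \<cdot> g) \<cdot> (coh_arr f g A \<cdot> h) = pb2 C (pb2 C (pj A) f) g \<cdot> h"
    using comp_eq_arr[OF coh_arr_simps(5)[OF A f g], of h] by simp
qed

definition coh_id_arr :: "'o \<Rightarrow> ('o, 'a) qobj \<Rightarrow> 'a" where
  "coh_id_arr Y A = lift C (pj A) (Ident C Y) (Ident C (tot A)) (pj A)"

lemma quotient_coh_id_eq: "quotient_coh_id C G Y A = (A, coh_id_arr Y A, pullq (Ident C Y) A)"
  by (simp add: quotient_coh_id_def coh_id_arr_def split: prod.splits)

lemma coh_id_arr_simps:
  assumes A: "A \<in> qobj Y"
  shows "arr (coh_id_arr Y A)" "src (coh_id_arr Y A) = tot A" "tgt (coh_id_arr Y A) = pb C (pj A) (Ident C Y)"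
    "pb1 C (pj A) (Ident C Y) \<cdot> coh_id_arr Y A = Ident C (tot A)" "pb2 C (pj A) (Ident C Y) \<cdot> coh_id_arr Y A = pj A"
    "qmor A (coh_id_arr Y A) (pullq (Ident C Y) A)" "iso_arrow C (coh_id_arr Y A)"
proof -
  note [simp] = qobj_simps[OF A] qobj_base[OF A]
  show c: "arr (coh_id_arr Y A)" "src (coh_id_arr Y A) = tot A" "tgt (coh_id_arr Y A) = pb C (pj A) (Ident C Y)"
    "pb1 C (pj A) (Ident C Y) \<cdot> coh_id_arr Y A = Ident C (tot A)" "pb2 C (pj A) (Ident C Y) \<cdot> coh_id_arr Y A = pj A"
    by (simp_all add: coh_id_arr_def)
  have "over (Ident C Y) A (Ident C (tot A)) A" using qmor_Ident[OF A] A by (simp add: qmor_iff)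
  from qmor_lift[OF A _ _ _ this] A
  show "qmor A (coh_id_arr Y A) (pullq (Ident C Y) A)" by (simp add: coh_id_arr_def)
  have "is_pullback C (pj A) (Ident C Y) (tot A) (Ident C (tot A)) (pj A)"
    by (rule is_pullbackI) auto
  from pullback_comparison_iso[OF this pb, of "coh_id_arr Y A"] c
  show "iso_arrow C (coh_id_arr Y A)" by simp
qed

abbreviation "XG \<equiv> quotient_prestack \<kappa> C \<tau> G X x"

lemma XG_simps [simp]:
  "fib XG = qfib" "pull XG = quotient_pull C G" "coh XG f g A = (pullq g (pullq f A), coh_arr f g A, pullq (f \<cdot> g) A)"
  "coh_id XG Y A = (A, coh_id_arr Y A, pullq (Ident C Y) A)"
  by (simp_all add: quotient_prestack_def quotient_coh_eq quotient_coh_id_eq)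

text \<open>All equations are between arrows into chosen pullbacks and are checked on the two projections; the
  coherence arrows are isomorphisms because both sides are pullbacks of the same arrows.\<close>

theorem prestack: "is_prestack C XG"
proof (rule is_prestack.intro[OF category_axioms is_prestack_axioms.intro], unfold XG_simps)
  fix Y show "category (qfib Y)" by (rule qfib_category)
next
  fix f assume "arr f" then show "is_functor (qfib (tgt f)) (qfib (src f)) (quotient_pull C G f)"
    by (rule pull_functor)
next
  fix f Z Y g Z' A assume "f \<in> Hom C Z Y" "g \<in> Hom C Z' Z" "A \<in> Obj (qfib Y)"
  then have A: "A \<in> qobj Y" and f: "arr f" "tgt f = Y" and g: "arr g" "tgt g = src f" and Z: "src g = Z'"
    by (simp_all add: Hom_iff)
  note o = pullq_obj[OF pullq_obj[OF A f] g] pullq_obj[of A Y "f \<cdot> g"]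
  show "(pullq g (pullq f A), coh_arr f g A, pullq (f \<cdot> g) A)
     \<in> Hom (qfib Z') (omap (quotient_pull C G g) (omap (quotient_pull C G f) A)) (omap (quotient_pull C G (f \<cdot> g)) A)"
    using o A f g Z coh_arr_simps(6)[OF A f g] by (simp add: qfib_Hom_iff)
  show "iso_arrow (qfib Z') (pullq g (pullq f A), coh_arr f g A, pullq (f \<cdot> g) A)"
    by (rule qfib_iso) (use o A f g Z coh_arr_simps(6,7)[OF A f g] in simp_all)
next
  fix f Z Y g Z' a A B assume "f \<in> Hom C Z Y" "g \<in> Hom C Z' Z" "a \<in> Hom (qfib Y) A B"
  then obtain \<phi> where f: "arr f" "tgt f = Y" and g: "arr g" "tgt g = src f" and Z: "src g = Z'"
    and a: "a = (A, \<phi>, B)" and A: "A \<in> qobj Y" and B: "B \<in> qobj Y" and \<phi>: "qmor A \<phi> B"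
    by (auto simp: qfib_Hom_iff Hom_iff)
  have fg: "arr (f \<cdot> g)" "tgt (f \<cdot> g) = Y" using f g by simp_all
  note 1 = pull_arr_simps[OF A B \<phi> f]
  note 2 = pull_arr_simps[OF pullq_obj[OF A f] pullq_obj[OF B f] 1(6) g]
  note [simp] = f g qobj_simps[OF A] qobj_simps[OF B] qmorD(1-3)[OF \<phi> A B] 1(1-5) 2(1-5)
    pull_arr_simps(1-5)[OF A B \<phi> fg] coh_arr_simps(1-5)[OF A f g] coh_arr_simps(1-5)[OF B f g]
    pull_arr_comp_simps[OF A B \<phi> f] pull_arr_comp_simps[OF A B \<phi> fg] coh_arr_comp_simps[OF B f g]
    pull_arr_comp_simps[OF pullq_obj[OF A f] pullq_obj[OF B f] 1(6) g]
  have "coh_arr f g B \<cdot> pull_arr g (pullq f A) (pull_arr f A \<phi> B) (pullq f B) = pull_arr (f \<cdot> g) A \<phi> B \<cdot> coh_arr f g A"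
    by (rule pb_ext[of "pj B" "f \<cdot> g"]) (use 2(4,5) in simp_all)
  then show "Comp (qfib Z') (pullq g (pullq f B), coh_arr f g B, pullq (f \<cdot> g) B)
       (amap (quotient_pull C G g) (amap (quotient_pull C G f) a))
     = Comp (qfib Z') (amap (quotient_pull C G (f \<cdot> g)) a) (pullq g (pullq f A), coh_arr f g A, pullq (f \<cdot> g) A)"
    unfolding a by simp
next
  fix Y A assume "Y \<in> Obj C" "A \<in> Obj (qfib Y)"
  then have Y: "arr (Ident C Y)" "tgt (Ident C Y) = Y" "src (Ident C Y) = Y" and A: "A \<in> qobj Y" by simp_all
  show "(A, coh_id_arr Y A, pullq (Ident C Y) A) \<in> Hom (qfib Y) A (omap (quotient_pull C G (Ident C Y)) A)"
    using A pullq_obj[OF A Y(1,2)] Y(3) coh_id_arr_simps(6)[OF A] by (simp add: qfib_Hom_iff)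
  show "iso_arrow (qfib Y) (A, coh_id_arr Y A, pullq (Ident C Y) A)"
    by (rule qfib_iso) (use A pullq_obj[OF A Y(1,2)] Y(3) coh_id_arr_simps(6,7)[OF A] in simp_all)
next
  fix Y a A B assume "Y \<in> Obj C" "a \<in> Hom (qfib Y) A B"
  then obtain \<phi> where Y: "arr (Ident C Y)" "tgt (Ident C Y) = Y" "src (Ident C Y) = Y"
    and a: "a = (A, \<phi>, B)" and A: "A \<in> qobj Y" and B: "B \<in> qobj Y" and \<phi>: "qmor A \<phi> B"
    by (auto simp: qfib_Hom_iff)
  note [simp] = Y qobj_simps[OF A] qobj_simps[OF B] qmorD(1-3)[OF \<phi> A B] pull_arr_simps(1-5)[OF A B \<phi> Y(1,2)]
    pull_arr_comp_simps[OF A B \<phi> Y(1,2)] coh_id_arr_simps(1-5)[OF A] coh_id_arr_simps(1-5)[OF B]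
  have "coh_id_arr Y B \<cdot> \<phi> = pull_arr (Ident C Y) A \<phi> B \<cdot> coh_id_arr Y A"
    using comp_eq_arr[OF coh_id_arr_simps(4)[OF B], of \<phi>] comp_eq_arr[OF coh_id_arr_simps(5)[OF B], of \<phi>] qmorD(4)[OF \<phi> A B]
    by - (rule pb_ext[of "pj B" "Ident C Y"]; simp)
  then show "Comp (qfib Y) (B, coh_id_arr Y B, pullq (Ident C Y) B) a
     = Comp (qfib Y) (amap (quotient_pull C G (Ident C Y)) a) (A, coh_id_arr Y A, pullq (Ident C Y) A)"
    unfolding a by simp
next
  fix f Z Y g Z' h Z'' A assume "f \<in> Hom C Z Y" "g \<in> Hom C Z' Z" "h \<in> Hom C Z'' Z'" "A \<in> Obj (qfib Y)"
  then have A: "A \<in> qobj Y" and f: "arr f" "tgt f = Y" and g: "arr g" "tgt g = src f"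
    and h: "arr h" "tgt h = src g" by (simp_all add: Hom_iff)
  have fg: "arr (f \<cdot> g)" "tgt (f \<cdot> g) = Y" and gh: "arr (g \<cdot> h)" "tgt (g \<cdot> h) = src f"
    and h': "tgt h = src (f \<cdot> g)" using f g h by simp_all
  note fA = pullq_obj[OF A f]
  note gA = pullq_obj[OF fA g] and fgA = pullq_obj[OF A fg]
  have gA': "pullq g (pullq f A) \<in> qobj (src g)" "pullq (f \<cdot> g) A \<in> qobj (src g)" using gA fgA f g by simp_all
  note 1 = pull_arr_simps[OF gA' coh_arr_simps(6)[OF A f g] h]
  note [simp] = f g h qobj_simps[OF A] coh_arr_simps(1-5)[OF A f g] coh_arr_simps(1-5)[OF A fg h(1) h']
    coh_arr_simps(1-5)[OF A f gh] coh_arr_simps(1-5)[OF fA g h]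
    coh_arr_comp_simps[OF A f g] coh_arr_comp_simps[OF A fg h(1) h']
    coh_arr_comp_simps[OF A f gh] coh_arr_comp_simps[OF fA g h] 1(1-5)
  have "coh_arr (f \<cdot> g) h A \<cdot> pull_arr h (pullq g (pullq f A)) (coh_arr f g A) (pullq (f \<cdot> g) A)
       = coh_arr f (g \<cdot> h) A \<cdot> coh_arr g h (pullq f A)"
    using 1(1-5) coh_arr_simps(1-5)[OF A fg h(1) h'] coh_arr_simps(1-5)[OF fA g h]
      coh_arr_comp_simps[OF A fg h(1) h', OF 1(1)] coh_arr_comp_simps[OF A f gh, of "coh_arr g h (pullq f A)"]
      comp_eq_comp[OF coh_arr_simps(4)[OF A f g], of "pb1 C (pb2 C (pb2 C (pj A) f) g) h"]
    by - (rule pb_ext[of "pj A" "f \<cdot> (g \<cdot> h)"]; simp)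
  then show "Comp (qfib Z'') (pullq h (pullq (f \<cdot> g) A), coh_arr (f \<cdot> g) h A, pullq (f \<cdot> g \<cdot> h) A)
        (amap (quotient_pull C G h) (pullq g (pullq f A), coh_arr f g A, pullq (f \<cdot> g) A))
     = Comp (qfib Z'') (pullq (g \<cdot> h) (pullq f A), coh_arr f (g \<cdot> h) A, pullq (f \<cdot> (g \<cdot> h)) A)
        (pullq h (pullq g (omap (quotient_pull C G f) A)), coh_arr g h (omap (quotient_pull C G f) A), pullq (g \<cdot> h) (omap (quotient_pull C G f) A))"
    by simp
next
  fix f Z Y A assume "f \<in> Hom C Z Y" "A \<in> Obj (qfib Y)"
  then have A: "A \<in> qobj Y" and f: "arr f" "tgt f = Y" and Z: "Z = src f"
    by (simp_all add: Hom_iff)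
  have Z': "arr (Ident C Z)" "tgt (Ident C Z) = src f" using f Z by simp_all
  have Y: "arr (Ident C Y)" "tgt (Ident C Y) = Y" and fY: "tgt f = src (Ident C Y)" using qobj_base[OF A] f by simp_all
  note fA = pullq_obj[OF A f]
  note 0 = coh_id_arr_simps[OF fA, folded Z] and 1 = coh_id_arr_simps[OF A]
  have A': "pullq (Ident C Y) A \<in> qobj Y" using pullq_obj[OF A Y] Y fY f by simp
  note 2 = pull_arr_simps[OF A A' 1(6) f]
  note 3 = coh_arr_simps[OF A f Z'] and 4 = coh_arr_simps[OF A Y f(1) fY]
  note [simp] = f qobj_simps[OF A] 0(1-3) 1(1-5) 2(1-3) 3(1-3) 4(1-3) Z
  have "coh_arr f (Ident C Z) A \<cdot> coh_id_arr Z (pullq f A) = Ident C (pb C (pj A) f)"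
    using 0 3 coh_arr_comp_simps[OF A f Z' 0(1)]
    by - (rule pb_ext[of "pj A" f]; simp)
  then show "Comp (qfib Z) (pullq (Ident C Z) (pullq f A), coh_arr f (Ident C Z) A, pullq (f \<cdot> Ident C Z) A)
       (omap (quotient_pull C G f) A, coh_id_arr Z (omap (quotient_pull C G f) A), pullq (Ident C Z) (omap (quotient_pull C G f) A))
     = Ident (qfib Z) (omap (quotient_pull C G f) A)" by simp
  have "coh_arr (Ident C Y) f A \<cdot> pull_arr f A (coh_id_arr Y A) (pullq (Ident C Y) A) = Ident C (pb C (pj A) f)"
    using 1 2 4 coh_arr_comp_simps[OF A Y f(1) fY 2(1)] comp_eq_arr[OF 1(4), of "pb1 C (pj A) f"] Y fY
    by - (rule pb_ext[of "pj A" f]; simp)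
  then show "Comp (qfib Z) (pullq f (pullq (Ident C Y) A), coh_arr (Ident C Y) f A, pullq (Ident C Y \<cdot> f) A)
       (amap (quotient_pull C G f) (A, coh_id_arr Y A, pullq (Ident C Y) A))
     = Ident (qfib Z) (omap (quotient_pull C G f) A)" by simp
qed

end


section \<open>Morphisms of bundles form a sheaf\<close>

context quotient
begin

lemma lift_act:
  assumes A: "A \<in> qobj Y" and f: "arr f" "tgt f = Y"
    and a: "arr g" "arr a" "arr u" "src g = src a" "src u = src a" "tgt g = K" "tgt a = tot A" "tgt u = src f"
      "f \<cdot> u = pj A \<cdot> a"
  shows "lift C (pj A) f (ac A \<cdot> pair C g a) u = ac (pullq f A) \<cdot> pair C g (lift C (pj A) f a u)"
  by (rule lift_unique) (use qobj_simps[OF A] f a pullback_act_arr(1-3)[of "fst A" f] in simp_all)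

text \<open>The pullbacks of the total space of \<open>A\<close> along a covering family cover it, and a morphism restricted to
  one of them is determined by its base change.\<close>

theorem separated: "morphisms_separated \<kappa> C \<tau> XG"
  unfolding morphisms_separated_def
proof (intro ballI allI impI)
  fix U I f A B h k
  assume cov: "covering_family \<kappa> C \<tau> U I f" and "A \<in> Obj (fib XG U)" "B \<in> Obj (fib XG U)"
    and "h \<in> Hom (fib XG U) A B" "k \<in> Hom (fib XG U) A B"
    and eq: "\<forall>i \<in> I. amap (pull XG (f i)) h = amap (pull XG (f i)) k"
  then obtain \<phi> \<psi> where A: "A \<in> qobj U" and B: "B \<in> qobj U" and h: "h = (A, \<phi>, B)" "qmor A \<phi> B"
    and k: "k = (A, \<psi>, B)" "qmor A \<psi> B"
    by (auto simp: qfib_Hom_iff)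
  have f: "\<And>i. i \<in> I \<Longrightarrow> arr (f i)" "\<And>i. i \<in> I \<Longrightarrow> tgt (f i) = U" using cov by (simp_all add: covering_family_def)
  note [simp] = f qobj_simps[OF A] qobj_simps[OF B] qmorD(1-3)[OF h(2) A B] qmorD(1-3)[OF k(2) A B]
  have "\<phi> = \<psi>"
  proof (rule arrow_ext_on_family[of "pj A" I f])
    fix i a u assume i [simp]: "i \<in> I" and [simp]: "arr a" "tgt a = src (pj A)" "arr u" "tgt u = src (f i)"
       "src u = src a" and e [symmetric, simp]: "f i \<cdot> u = pj A \<cdot> a"
    let ?a = "lift C (pj A) (f i) a u"
    have "pull_arr (f i) A \<phi> B \<cdot> ?a = pull_arr (f i) A \<psi> B \<cdot> ?a"
      using eq i h(1) k(1) by simp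
    then have "pb1 C (pj B) (f i) \<cdot> (pull_arr (f i) A \<phi> B \<cdot> ?a) = pb1 C (pj B) (f i) \<cdot> (pull_arr (f i) A \<psi> B \<cdot> ?a)"
      by (rule arg_cong)
    then show "\<phi> \<cdot> a = \<psi> \<cdot> a"
      using pull_arr_comp_simps(1)[OF A B h(2) f[OF i], of ?a] pull_arr_comp_simps(1)[OF A B k(2) f[OF i], of ?a] by simp
  qed (use cov in simp_all)
  then show "h = k" using h k by simp
qed

text \<open>\<open>restrict_arrow\<close> is conjugated by coherence arrows. On points these disappear: the restriction sends a
  point \<open>a\<close> over \<open>f \<cdot> g \<cdot> w\<close> to its image under \<open>\<phi>\<close> at the point \<open>(a, g \<cdot> w)\<close> of \<open>f\<^sup>*A\<close>.\<close>

lemma restrict_arrow_point: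
  assumes A: "A \<in> qobj Y" and B: "B \<in> qobj Y" and f: "arr f" "tgt f = Y" and g: "arr g" "tgt g = src f"
    and \<phi>: "qmor (pullq f A) \<phi> (pullq f B)"
    and a: "arr a" "arr w" "src w = src a" "tgt a = tot A" "tgt w = src g" "f \<cdot> (g \<cdot> w) = pj A \<cdot> a"
  shows "pb1 C (pj B) (f \<cdot> g) \<cdot> (fst (snd (restrict_arrow C XG A B f g (pullq f A, \<phi>, pullq f B))) \<cdot> lift C (pj A) (f \<cdot> g) a w)
     = pb1 C (pj B) f \<cdot> (\<phi> \<cdot> lift C (pj A) f a (g \<cdot> w))"
proof -
  note fA = pullq_obj[OF A f] and fB = pullq_obj[OF B f]
  note gA = pullq_obj[OF fA g]
  have fg: "arr (f \<cdot> g)" "tgt (f \<cdot> g) = Y" "src (f \<cdot> g) = src g" using f g by simp_all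
  note fgA = pullq_obj[OF A fg(1,2), unfolded fg(3)]
  note 1 = coh_arr_simps[OF A f g] and 2 = coh_arr_simps[OF B f g]
  note 3 = pull_arr_simps[OF fA fB \<phi> g]
  note [simp] = qobj_simps[OF A] qobj_simps[OF B] f g a(1-5) a(6)[symmetric] qmorD(1-3)[OF \<phi> fA fB] 1(1-3) 2(1-3) 3(1-3)
  obtain j where j: "inverse_arrows C (coh_arr f g A) j" using 1(7) by (auto simp: iso_arrow_def)
  have [simp]: "arr j" "src j = pb C (pj A) (f \<cdot> g)" "tgt j = pb C (pb2 C (pj A) f) g"
    and jc: "j \<cdot> coh_arr f g A = Ident C (pb C (pb2 C (pj A) f) g)"
    using j by (simp_all add: inverse_arrows_def Hom_iff)
  have "inverse_arrows (qfib (src g)) (pullq g (pullq f A), coh_arr f g A, pullq (f \<cdot> g) A) (pullq (f \<cdot> g) A, j, pullq g (pullq f A))"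
    using qfib_inverse_iff[OF gA fgA 1(6)] j by blast
  then have "inv_arrow (qfib (src g)) (pullq g (pullq f A), coh_arr f g A, pullq (f \<cdot> g) A) = (pullq (f \<cdot> g) A, j, pullq g (pullq f A))"
    by (rule category.inv_arrow_eq[OF qfib_category])
  then have r: "fst (snd (restrict_arrow C XG A B f g (pullq f A, \<phi>, pullq f B)))
      = (coh_arr f g B \<cdot> pull_arr g (pullq f A) \<phi> (pullq f B)) \<cdot> j"
    by (simp add: restrict_arrow_def)
  define z where "z = lift C (pb2 C (pj A) f) g (lift C (pj A) f a (g \<cdot> w)) w"
  have z [simp]: "arr z" "src z = src a" "tgt z = pb C (pb2 C (pj A) f) g"
    "pb1 C (pb2 C (pj A) f) g \<cdot> z = lift C (pj A) f a (g \<cdot> w)" "pb2 C (pb2 C (pj A) f) g \<cdot> z = w"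
    by (simp_all add: z_def)
  have "coh_arr f g A \<cdot> z = lift C (pj A) (f \<cdot> g) a w"
    using coh_arr_comp_simps[OF A f g z(1,3)] by - (rule pb_ext[of "pj A" "f \<cdot> g"]; simp)
  then have "j \<cdot> lift C (pj A) (f \<cdot> g) a w = j \<cdot> (coh_arr f g A \<cdot> z)" by simp
  also have "\<dots> = z" using comp_eq_arr[OF jc, of z] by simp
  finally have "pb1 C (pj B) (f \<cdot> g) \<cdot> (((coh_arr f g B \<cdot> pull_arr g (pullq f A) \<phi> (pullq f B)) \<cdot> j) \<cdot> lift C (pj A) (f \<cdot> g) a w)
     = pb1 C (pj B) (f \<cdot> g) \<cdot> (coh_arr f g B \<cdot> (pull_arr g (pullq f A) \<phi> (pullq f B) \<cdot> z))" by simp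
  also have "\<dots> = pb1 C (pj B) f \<cdot> (pb1 C (pb2 C (pj B) f) g \<cdot> (pull_arr g (pullq f A) \<phi> (pullq f B) \<cdot> z))"
    by (rule coh_arr_comp_simps(1)[OF B f g]) simp_all
  also have "\<dots> = pb1 C (pj B) f \<cdot> (\<phi> \<cdot> lift C (pj A) f a (g \<cdot> w))"
    using pull_arr_comp_simps(1)[OF fA fB \<phi> g, of z] by simp
  finally show ?thesis by (simp only: r)
qed

text \<open>The glued morphism sends a point \<open>a\<close> whose image in \<open>U\<close> factors as \<open>f i \<cdot> u\<close> to the image of \<open>(a, u)\<close> under
  \<open>\<phi> i\<close>. For two factorizations \<open>f i \<cdot> u = f j \<cdot> v\<close> the value is the same because \<open>(u, v)\<close> is a point of
  \<open>U\<^sub>i \<times>\<^sub>U U\<^sub>j\<close>, where \<open>\<phi> i\<close> and \<open>\<phi> j\<close> agree.\<close>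

theorem glue: "morphisms_glue \<kappa> C \<tau> XG"
  unfolding morphisms_glue_def
proof (intro ballI allI impI, elim conjE)
  fix U I f A B h
  assume U: "U \<in> Obj C" and cov: "covering_family \<kappa> C \<tau> U I f" and "A \<in> Obj (fib XG U)" "B \<in> Obj (fib XG U)"
    and h: "\<forall>i \<in> I. h i \<in> Hom (fib XG (src (f i))) (omap (pull XG (f i)) A) (omap (pull XG (f i)) B)"
    and agree: "\<forall>i \<in> I. \<forall>j \<in> I. restrict_arrow C XG A B (f i) (pb1 C (f i) (f j)) (h i)
               = restrict_arrow C XG A B (f j) (pb2 C (f i) (f j)) (h j)"
  then have A: "A \<in> qobj U" and B: "B \<in> qobj U" by simp_all
  define \<phi> where "\<phi> i = fst (snd (h i))" for i
  have h: "h i = (pullq (f i) A, \<phi> i, pullq (f i) B)" and \<phi>: "qmor (pullq (f i) A) (\<phi> i) (pullq (f i) B)" if "i \<in> I" for i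
    using h that by (auto simp: qfib_Hom_iff \<phi>_def)
  have f: "\<And>i. i \<in> I \<Longrightarrow> arr (f i)" "\<And>i. i \<in> I \<Longrightarrow> tgt (f i) = U" using cov by (simp_all add: covering_family_def)
  define q where "q i = pb1 C (pj B) (f i) \<cdot> \<phi> i" for i
  note [simp] = f qobj_simps[OF A] qobj_simps[OF B]
  have \<phi>' [simp]: "arr (\<phi> i)" "src (\<phi> i) = pb C (pj A) (f i)" "tgt (\<phi> i) = pb C (pj B) (f i)"
      "pb2 C (pj B) (f i) \<cdot> \<phi> i = pb2 C (pj A) (f i)" if "i \<in> I" for i
    using qmorD(1-4)[OF \<phi>[OF that] pullq_obj[OF A f[OF that]] pullq_obj[OF B f[OF that]]] by simp_all
  have q_over: "over (f i) (pullq (f i) A) (q i) B" if "i \<in> I" for i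
    unfolding q_def
    by (rule over_Ident_right[OF over_pb1[OF B f[OF that]] B pullq_obj[OF B f[OF that]] f[OF that] \<phi>[OF that] pullq_obj[OF A f[OF that]]])
  have q [simp]: "arr (q i)" "src (q i) = pb C (pj A) (f i)" "tgt (q i) = tot B" if "i \<in> I" for i
    using overD(1-3)[OF q_over[OF that]] by simp_all
  have cov': "covering_family \<kappa> C \<tau> (tgt (pj A)) I f" using cov by simp
  obtain \<eta> where \<eta> [simp]: "arr \<eta>" "src \<eta> = tot A" "tgt \<eta> = tot B"
    and \<eta>q: "\<And>i a u. i \<in> I \<Longrightarrow> arr a \<Longrightarrow> tgt a = tot A \<Longrightarrow> arr u \<Longrightarrow> tgt u = src (f i)
       \<Longrightarrow> src u = src a \<Longrightarrow> f i \<cdot> u = pj A \<cdot> a \<Longrightarrow> \<eta> \<cdot> a = q i \<cdot> lift C (pj A) (f i) a u"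
  proof (rule arrow_glue_on_family[OF cov', of "tot B" "\<lambda>i a u. q i \<cdot> lift C (pj A) (f i) a u"])
    fix i j a u v assume i [simp]: "i \<in> I" and j [simp]: "j \<in> I" and a [simp]: "arr a" "tgt a = src (pj A)" "arr u" "tgt u = src (f i)"
       "src u = src a" and eu: "f i \<cdot> u = pj A \<cdot> a"
       and v [simp]: "arr v" "tgt v = src (f j)" "src v = src a" and ev: "f j \<cdot> v = pj A \<cdot> a"
    let ?p = "pb1 C (f i) (f j)" and ?p' = "pb2 C (f i) (f j)"
    have sq: "f i \<cdot> ?p = f j \<cdot> ?p'" by (rule pb_square) simp_all
    define w where "w = lift C (f i) (f j) u v"
    have w [simp]: "arr w" "src w = src a" "tgt w = pb C (f i) (f j)" "?p \<cdot> w = u" "?p' \<cdot> w = v"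
      using eu ev by (simp_all add: w_def)
    have "q i \<cdot> lift C (pj A) (f i) a u = pb1 C (pj B) (f i) \<cdot> (\<phi> i \<cdot> lift C (pj A) (f i) a (?p \<cdot> w))"
      using eu by (simp add: q_def)
    also have "\<dots> = pb1 C (pj B) (f i \<cdot> ?p) \<cdot> (fst (snd (restrict_arrow C XG A B (f i) ?p (h i))) \<cdot> lift C (pj A) (f i \<cdot> ?p) a w)"
      unfolding h[OF i] by (rule restrict_arrow_point[symmetric, OF A B f[OF i] _ _ \<phi>[OF i]]) (use eu in simp_all)
    also have "\<dots> = pb1 C (pj B) (f j \<cdot> ?p') \<cdot> (fst (snd (restrict_arrow C XG A B (f j) ?p' (h j))) \<cdot> lift C (pj A) (f j \<cdot> ?p') a w)"
      using agree i j unfolding sq by simp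
    also have "\<dots> = pb1 C (pj B) (f j) \<cdot> (\<phi> j \<cdot> lift C (pj A) (f j) a (?p' \<cdot> w))"
      unfolding h[OF j] by (rule restrict_arrow_point[OF A B f[OF j] _ _ \<phi>[OF j]]) (use ev in simp_all)
    also have "\<dots> = q j \<cdot> lift C (pj A) (f j) a v"
      using ev by (simp add: q_def)
    finally show "q i \<cdot> lift C (pj A) (f i) a u = q j \<cdot> lift C (pj A) (f j) a v" .
  qed (simp_all add: lift_comp)
  have pj\<eta>: "pj B \<cdot> \<eta> = pj A"
  proof (rule arrow_ext_on_family[OF cov'])
    fix i a u assume A: "i \<in> I" "arr a" "tgt a = src (pj A)" "arr u" "tgt u = src (f i)"
       "src u = src a" "f i \<cdot> u = pj A \<cdot> a"
    then show "(pj B \<cdot> \<eta>) \<cdot> a = pj A \<cdot> a"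
      using \<eta>q[of i a u] comp_eq_comp[OF overD(4)[OF q_over[of i]], of "lift C (pj A) (f i) a u"] by simp
  qed simp_all
  have snd\<eta>: "snd B \<cdot> \<eta> = snd A"
  proof (rule arrow_ext_on_family[OF cov'])
    fix i a u assume A: "i \<in> I" "arr a" "tgt a = src (pj A)" "arr u" "tgt u = src (f i)"
       "src u = src a" "f i \<cdot> u = pj A \<cdot> a"
    then show "(snd B \<cdot> \<eta>) \<cdot> a = snd A \<cdot> a"
      using \<eta>q[of i a u] comp_eq_arr[OF overD(5)[OF q_over[of i]], of "lift C (pj A) (f i) a u"] by simp
  qed simp_all
  have equiv: "\<eta> \<cdot> (ac A \<cdot> pair C g a) = ac B \<cdot> pair C g (\<eta> \<cdot> a)"
    if [simp]: "arr g" "arr a" "src g = src a" "tgt g = K" "tgt a = tot A" for g a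
  proof (rule arrow_ext_on_family[of "pj A \<cdot> a" I f])
    fix i y u assume i [simp]: "i \<in> I" and [simp]: "arr y" "tgt y = src (pj A \<cdot> a)" "arr u" "tgt u = src (f i)"
       "src u = src y" and "f i \<cdot> u = (pj A \<cdot> a) \<cdot> y"
    then have e: "f i \<cdot> u = pj A \<cdot> (a \<cdot> y)" by simp
    let ?l = "lift C (pj A) (f i) (a \<cdot> y) u"
    have "\<eta> \<cdot> (ac A \<cdot> pair C (g \<cdot> y) (a \<cdot> y)) = q i \<cdot> lift C (pj A) (f i) (ac A \<cdot> pair C (g \<cdot> y) (a \<cdot> y)) u"
      by (rule \<eta>q) (use e in simp_all)
    also have "lift C (pj A) (f i) (ac A \<cdot> pair C (g \<cdot> y) (a \<cdot> y)) u = ac (pullq (f i) A) \<cdot> pair C (g \<cdot> y) ?l"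
      by (rule lift_act[OF A f[OF i]]) (use e in simp_all)
    also have "q i \<cdot> \<dots> = ac B \<cdot> pair C (g \<cdot> y) (q i \<cdot> ?l)"
      by (rule overD(6)[OF q_over[OF i]]) (use e in simp_all)
    also have "q i \<cdot> ?l = \<eta> \<cdot> (a \<cdot> y)" by (rule \<eta>q[symmetric]) (use e in simp_all)
    finally show "(\<eta> \<cdot> (ac A \<cdot> pair C g a)) \<cdot> y = (ac B \<cdot> pair C g (\<eta> \<cdot> a)) \<cdot> y" by simp
  qed (use cov in simp_all)
  have \<eta>mor: "qmor A \<eta> B"
    using pj\<eta> snd\<eta> equiv by (simp add: qmor_iff[OF A B] over_def)
  have "pull_arr (f i) A \<eta> B = \<phi> i" if i [simp]: "i \<in> I" for i
  proof -
    note [simp] = pull_arr_simps(1-5)[OF A B \<eta>mor f[OF i]]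
    have "\<eta> \<cdot> pb1 C (pj A) (f i) = q i \<cdot> lift C (pj A) (f i) (pb1 C (pj A) (f i)) (pb2 C (pj A) (f i))"
      by (rule \<eta>q) (simp_all add: pb_square)
    also have "lift C (pj A) (f i) (pb1 C (pj A) (f i)) (pb2 C (pj A) (f i)) = Ident C (pb C (pj A) (f i))"
      by (rule lift_unique) simp_all
    finally have "\<eta> \<cdot> pb1 C (pj A) (f i) = pb1 C (pj B) (f i) \<cdot> \<phi> i" by (simp add: q_def)
    then show ?thesis by - (rule pb_ext[of "pj B" "f i"]; simp)
  qed
  then show "\<exists>\<eta> \<in> Hom (fib XG U) A B. \<forall>i \<in> I. amap (pull XG (f i)) \<eta> = h i"
    using A B \<eta>mor h by (intro bexI[of _ "(A, \<eta>, B)"]) (auto simp: qfib_Hom_iff)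
qed

end

section \<open>Effective descent\<close>

locale quotient_descent = quotient C \<kappa> \<tau> G X x
  for C :: "('o, 'a, 'm) pcat_scheme" (structure) and \<kappa> :: "'k rel" and \<tau> :: "'o \<Rightarrow> 'a set set"
    and G :: "('o, 'a) grp" and X :: 'o and x :: 'a +
  fixes Y :: 'o and S :: "'a set" and W :: "'a \<Rightarrow> ('o, 'a) qobj" and \<Phi> :: "'a \<Rightarrow> 'a \<Rightarrow> ('o, 'a) qarr"
  assumes Y: "Y \<in> Obj C" and S: "S \<in> \<tau> Y" and datum: "descent_datum C XG S W \<Phi>"
begin

lemma S_simps [simp]: "f \<in> S \<Longrightarrow> arr f" "f \<in> S \<Longrightarrow> tgt f = Y"
  using cover_arr[OF S Y] by simp_all

lemma S_comp [simp]: "f \<in> S \<Longrightarrow> arr g \<Longrightarrow> tgt g = src f \<Longrightarrow> f \<cdot> g \<in> S"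
  by (rule cover_comp[OF S Y])

definition \<phi> where "\<phi> f g = fst (snd (\<Phi> f g))"

text \<open>By the cocycle condition these arrows compose strictly (\<open>e_comp\<close>): the coherence isomorphisms in
  that condition only express the choice of pullbacks.\<close>

definition e where "e f g = pb1 C (pj (W f)) g \<cdot> inv_arrow C (\<phi> f g)"

lemma W: "f \<in> S \<Longrightarrow> W f \<in> qobj (src f)"
  using datum by (simp add: descent_datum_def)

lemma W_simps [simp]:
  assumes "f \<in> S"
  shows "G_object (fst (W f))" "tgt (pj (W f)) = src f" "arr (snd (W f))" "src (snd (W f)) = tot (W f)" "tgt (snd (W f)) = X"
  using qobj_simps[OF W[OF assms]] by simp_all

lemma W_comp: "f \<in> S \<Longrightarrow> arr g \<Longrightarrow> tgt g = src f \<Longrightarrow> W (f \<cdot> g) \<in> qobj (src g)"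
  using W[of "f \<cdot> g"] by simp

lemma \<phi>:
  assumes f: "f \<in> S" and g: "arr g" "tgt g = src f"
  shows "\<Phi> f g = (pullq g (W f), \<phi> f g, W (f \<cdot> g))" "qmor (pullq g (W f)) (\<phi> f g) (W (f \<cdot> g))"
    "inverse_arrows C (\<phi> f g) (inv_arrow C (\<phi> f g))" "qmor (W (f \<cdot> g)) (inv_arrow C (\<phi> f g)) (pullq g (W f))"
proof -
  have "\<Phi> f g \<in> Hom (qfib (src g)) (pullq g (W f)) (W (f \<cdot> g))" and iso: "iso_arrow (qfib (src g)) (\<Phi> f g)"
    using datum f g by (simp_all add: descent_datum_def)
  then show \<Phi>: "\<Phi> f g = (pullq g (W f), \<phi> f g, W (f \<cdot> g))" and m: "qmor (pullq g (W f)) (\<phi> f g) (W (f \<cdot> g))"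
    by (auto simp: qfib_Hom_iff \<phi>_def)
  note o = pullq_obj[OF W[OF f] g] W_comp[OF f g]
  have "iso_arrow C (\<phi> f g)" using iso qfib_inverse_iff[OF o m] unfolding \<Phi> iso_arrow_def by blast
  then show i: "inverse_arrows C (\<phi> f g) (inv_arrow C (\<phi> f g))" by (rule inverse_arrows_inv_arrow)
  then have "inverse_arrows (qfib (src g)) (pullq g (W f), \<phi> f g, W (f \<cdot> g)) (W (f \<cdot> g), inv_arrow C (\<phi> f g), pullq g (W f))"
    using qfib_inverse_iff[OF o m] by blast
  then show "qmor (W (f \<cdot> g)) (inv_arrow C (\<phi> f g)) (pullq g (W f))"
    by (simp add: inverse_arrows_def qfib_Hom_iff)
qed

lemma
  assumes f: "f \<in> S" and g: "arr g" "tgt g = src f"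
  shows e_over: "over g (W (f \<cdot> g)) (e f g) (W f)"
    and e_cartesian: "is_pullback C (pj (W f)) g (tot (W (f \<cdot> g))) (e f g) (pj (W (f \<cdot> g)))"
    and e_\<phi>: "e f g \<cdot> \<phi> f g = pb1 C (pj (W f)) g"
    and \<phi>_simps: "arr (\<phi> f g)" "src (\<phi> f g) = pb C (pj (W f)) g" "tgt (\<phi> f g) = tot (W (f \<cdot> g))"
      "pj (W (f \<cdot> g)) \<cdot> \<phi> f g = pb2 C (pj (W f)) g"
proof -
  note p = \<phi>[OF f g]
  note o = pullq_obj[OF W[OF f] g] W_comp[OF f g]
  note i = qmorD[OF p(4) o(2,1)] and m = qmorD[OF p(2) o]
  note [simp] = f g i(1-3) m(1-3)
  show "arr (\<phi> f g)" "src (\<phi> f g) = pb C (pj (W f)) g" "tgt (\<phi> f g) = tot (W (f \<cdot> g))"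
      "pj (W (f \<cdot> g)) \<cdot> \<phi> f g = pb2 C (pj (W f)) g" using m by simp_all
  show "over g (W (f \<cdot> g)) (e f g) (W f)" unfolding e_def
    by (rule over_Ident_right[OF over_pb1[OF W[OF f] g] W[OF f] o(1) g p(4) o(2)])
  have inv: "inverse_arrows C (inv_arrow C (\<phi> f g)) (\<phi> f g)"
    using p(3) by (simp add: inverse_arrows_def Hom_iff)
  have "is_pullback C (pj (W f)) g (tot (W (f \<cdot> g))) (pb1 C (pj (W f)) g \<cdot> inv_arrow C (\<phi> f g)) (pb2 C (pj (W f)) g \<cdot> inv_arrow C (\<phi> f g))"
    by (rule pullback_iso[OF pb _ _ inv]) simp_all
  then show "is_pullback C (pj (W f)) g (tot (W (f \<cdot> g))) (e f g) (pj (W (f \<cdot> g)))" using i(4) by (simp add: e_def)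
  show "e f g \<cdot> \<phi> f g = pb1 C (pj (W f)) g" using p(3) by (simp add: e_def inverse_arrows_def)
qed

lemma e_simps [simp]:
  assumes "f \<in> S" "arr g" "tgt g = src f"
  shows "arr (e f g)" "src (e f g) = tot (W (f \<cdot> g))" "tgt (e f g) = tot (W f)"
  using overD(1-3)[OF e_over[OF assms]] .

lemma cocycle:
  assumes f: "f \<in> S" and g: "arr g" "tgt g = src f" and h: "arr h" "tgt h = src g"
  shows "\<phi> (f \<cdot> g) h \<cdot> pull_arr h (pullq g (W f)) (\<phi> f g) (W (f \<cdot> g)) = \<phi> f (g \<cdot> h) \<cdot> coh_arr g h (W f)"
proof -
  have "Comp (fib XG (src h)) (\<Phi> (f \<cdot> g) h) (amap (pull XG h) (\<Phi> f g))
          = Comp (fib XG (src h)) (\<Phi> f (g \<cdot> h)) (coh XG g h (W f))"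
    using datum f g h unfolding descent_datum_def by blast
  moreover have "f \<cdot> g \<in> S" "tgt h = src (f \<cdot> g)" "arr (g \<cdot> h)" "tgt (g \<cdot> h) = src f" using f g h by simp_all
  ultimately show ?thesis
    using \<phi>(1)[OF f g] \<phi>(1)[of "f \<cdot> g" h] \<phi>(1)[of f "g \<cdot> h"] f g h by simp
qed

lemma e_comp:
  assumes f: "f \<in> S" and g: "arr g" "tgt g = src f" and h: "arr h" "tgt h = src g"
  shows "e f g \<cdot> e (f \<cdot> g) h = e f (g \<cdot> h)"
proof -
  note [simp] = f g h
  have fg: "f \<cdot> g \<in> S" "tgt h = src (f \<cdot> g)" and gh: "arr (g \<cdot> h)" "tgt (g \<cdot> h) = src f" by simp_all
  note 1 = \<phi>_simps[OF f g] and 2 = \<phi>_simps[OF fg(1) h(1) fg(2)] and 3 = \<phi>_simps[OF f gh]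
  note p = pull_arr_simps[OF pullq_obj[OF W[OF f] g] W_comp[OF f g] \<phi>(2)[OF f g] h]
  note c = coh_arr_simps[OF W[OF f] g h]
  let ?P = "pull_arr h (pullq g (W f)) (\<phi> f g) (W (f \<cdot> g))" and ?c = "coh_arr g h (W f)"
  note [simp] = 1(1-3) 2(1-3) 3(1-3) p(1-3) c(1-3)
  have "(e f g \<cdot> e (f \<cdot> g) h) \<cdot> (\<phi> f (g \<cdot> h) \<cdot> ?c) = e f g \<cdot> (e (f \<cdot> g) h \<cdot> (\<phi> (f \<cdot> g) h \<cdot> ?P))"
    using cocycle[OF f g h] by simp
  also have "e (f \<cdot> g) h \<cdot> (\<phi> (f \<cdot> g) h \<cdot> ?P) = \<phi> f g \<cdot> pb1 C (pb2 C (pj (W f)) g) h"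
    using comp_eq_arr[OF e_\<phi>[OF fg(1) h(1) fg(2)], of ?P] p(4) by simp
  also have "e f g \<cdot> \<dots> = pb1 C (pj (W f)) g \<cdot> pb1 C (pb2 C (pj (W f)) g) h"
    using comp_eq_arr[OF e_\<phi>[OF f g], of "pb1 C (pb2 C (pj (W f)) g) h"] by simp
  also have "\<dots> = pb1 C (pj (W f)) (g \<cdot> h) \<cdot> ?c" using c(4) by simp
  also have "\<dots> = e f (g \<cdot> h) \<cdot> (\<phi> f (g \<cdot> h) \<cdot> ?c)"
    using comp_eq_arr[OF e_\<phi>[OF f gh], of ?c] by simp
  finally have eq: "(e f g \<cdot> e (f \<cdot> g) h) \<cdot> (\<phi> f (g \<cdot> h) \<cdot> ?c) = e f (g \<cdot> h) \<cdot> (\<phi> f (g \<cdot> h) \<cdot> ?c)" .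
  obtain i where i: "inverse_arrows C ?c i" using c(7) by (auto simp: iso_arrow_def)
  let ?j = "inv_arrow C (\<phi> f (g \<cdot> h))"
  have j: "inverse_arrows C (\<phi> f (g \<cdot> h)) ?j" by (rule \<phi>(3)[OF f gh])
  have [simp]: "arr i" "src i = pb C (pj (W f)) (g \<cdot> h)" "tgt i = pb C (pb2 C (pj (W f)) g) h"
    and ci: "?c \<cdot> i = Ident C (pb C (pj (W f)) (g \<cdot> h))"
    and [simp]: "arr ?j" "src ?j = tot (W (f \<cdot> (g \<cdot> h)))" "tgt ?j = pb C (pj (W f)) (g \<cdot> h)"
    and pj: "\<phi> f (g \<cdot> h) \<cdot> ?j = Ident C (tot (W (f \<cdot> (g \<cdot> h))))"
    using i j by (simp_all add: inverse_arrows_def Hom_iff)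
  have id: "(\<phi> f (g \<cdot> h) \<cdot> ?c) \<cdot> (i \<cdot> ?j) = Ident C (tot (W (f \<cdot> (g \<cdot> h))))"
    using comp_eq_arr[OF ci, of ?j] pj by simp
  have "((e f g \<cdot> e (f \<cdot> g) h) \<cdot> (\<phi> f (g \<cdot> h) \<cdot> ?c)) \<cdot> (i \<cdot> ?j) = (e f (g \<cdot> h) \<cdot> (\<phi> f (g \<cdot> h) \<cdot> ?c)) \<cdot> (i \<cdot> ?j)"
    using eq by (rule arg_cong)
  then have "(e f g \<cdot> e (f \<cdot> g) h) \<cdot> ((\<phi> f (g \<cdot> h) \<cdot> ?c) \<cdot> (i \<cdot> ?j)) = e f (g \<cdot> h) \<cdot> ((\<phi> f (g \<cdot> h) \<cdot> ?c) \<cdot> (i \<cdot> ?j))"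
    by simp
  then show ?thesis unfolding id by simp
qed

sublocale cd: cartesian_descent C \<kappa> \<tau> Y S "\<lambda>f. tot (W f)" "\<lambda>f. pj (W f)" e
  by unfold_locales (use Y S e_cartesian e_comp in \<open>simp_all add: Hom_iff\<close>)

text \<open>On the object \<open>L\<close> glued from the total spaces, a point \<open>b\<close> with image \<open>f \<in> S\<close> in the base is \<open>c f \<cdot> s\<close> for a
  unique section \<open>s = l b\<close> of \<open>W f\<close>. The action and the map to \<open>X\<close> are defined on such points by
  those of \<open>W f\<close>, and their laws are inherited from it, because arrows out of \<open>L\<close> are equal if they
  are equal on such points (\<open>ext\<close>).\<close>

lemma effective: "effective C XG Y S W \<Phi>"
proof -
  obtain L \<pi> c where \<pi>: "\<pi> \<in> Hom C L Y" and c_cart: "\<And>f. f \<in> S \<Longrightarrow> is_pullback C \<pi> f (tot (W f)) (c f) (pj (W f))"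
    and ce: "\<And>f g. f \<in> S \<Longrightarrow> arr g \<Longrightarrow> tgt g = src f \<Longrightarrow> c f \<cdot> e f g = c (f \<cdot> g)"
    by (rule cd.objects_glue) (rule that)
  have \<pi> [simp]: "arr \<pi>" "src \<pi> = L" "tgt \<pi> = Y" using \<pi> by (simp_all add: Hom_iff)
  have L [simp]: "L \<in> Obj C" using Dom_in_Obj[OF \<pi>(1)] by simp
  have c [simp]: "arr (c f)" "src (c f) = tot (W f)" "tgt (c f) = L"
    and \<pi>c: "\<pi> \<cdot> c f = f \<cdot> pj (W f)" if "f \<in> S" for f
    using is_pullbackD[OF c_cart[OF that]] that by simp_all
  have \<pi>c_comp: "\<pi> \<cdot> (c f \<cdot> a) = f \<cdot> (pj (W f) \<cdot> a)" if "f \<in> S" "arr a" "tgt a = tot (W f)" for f a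
    by (rule comp_eq_comp[OF \<pi>c]) (use that in simp_all)
  define l where "l b = (SOME s. arr s \<and> src s = src b \<and> tgt s = tot (W (\<pi> \<cdot> b))
     \<and> c (\<pi> \<cdot> b) \<cdot> s = b \<and> pj (W (\<pi> \<cdot> b)) \<cdot> s = Ident C (src b))" for b
  have l: "arr (l b)" "src (l b) = src b" "tgt (l b) = tot (W (\<pi> \<cdot> b))"
     "c (\<pi> \<cdot> b) \<cdot> l b = b" "pj (W (\<pi> \<cdot> b)) \<cdot> l b = Ident C (src b)"
    if b: "arr b" "tgt b = L" "\<pi> \<cdot> b \<in> S" for b
  proof -
    have "\<exists>s. arr s \<and> src s = src b \<and> tgt s = tot (W (\<pi> \<cdot> b))
     \<and> c (\<pi> \<cdot> b) \<cdot> s = b \<and> pj (W (\<pi> \<cdot> b)) \<cdot> s = Ident C (src b)"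
      by (rule is_pullback_factor[OF c_cart[OF b(3)] \<pi>(1) S_simps(1)[OF b(3)], of b "Ident C (src b)"])
        (use b in \<open>auto intro!: exI\<close>)
    from someI_ex[OF this] show "arr (l b)" "src (l b) = src b" "tgt (l b) = tot (W (\<pi> \<cdot> b))"
     "c (\<pi> \<cdot> b) \<cdot> l b = b" "pj (W (\<pi> \<cdot> b)) \<cdot> l b = Ident C (src b)"
      unfolding l_def by blast+
  qed
  have c_ext: "a = b" if "f \<in> S" "c f \<cdot> a = c f \<cdot> b" "pj (W f) \<cdot> a = pj (W f) \<cdot> b"
    "arr a" "arr b" "src a = src b" "tgt a = tot (W f)" "tgt b = tot (W f)" for f a b
    by (rule is_pullback_ext[OF c_cart[OF that(1)]]) (use that in simp_all)
  \<comment> \<open>For an arbitrary point \<open>a\<close> of \<open>W f\<close>, the section of its image in \<open>L\<close> is the one that induces \<open>a\<close>.\<close>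
  have el: "e f (pj (W f) \<cdot> a) \<cdot> l (c f \<cdot> a) = a" if [simp]: "f \<in> S" "arr a" "tgt a = tot (W f)" for f a
  proof -
    let ?b = "c f \<cdot> a" and ?u = "pj (W f) \<cdot> a"
    have \<pi>b: "\<pi> \<cdot> ?b = f \<cdot> ?u" by (simp add: \<pi>c_comp)
    have "\<pi> \<cdot> ?b \<in> S" unfolding \<pi>b by simp
    note lb = l[of ?b, OF _ _ this, unfolded \<pi>b]
    have u: "arr ?u" "tgt ?u = src f" by simp_all
    have [simp]: "arr (l ?b)" "src (l ?b) = src a" "tgt (l ?b) = tot (W (f \<cdot> ?u))"
      "c (f \<cdot> ?u) \<cdot> l ?b = ?b" "pj (W (f \<cdot> ?u)) \<cdot> l ?b = Ident C (src a)"
      using lb by simp_all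
    show ?thesis
    proof (rule c_ext[of f])
      show "c f \<cdot> (e f ?u \<cdot> l ?b) = c f \<cdot> a" using comp_eq_arr[OF ce[OF that(1) u], of "l ?b"] by simp
      show "pj (W f) \<cdot> (e f ?u \<cdot> l ?b) = pj (W f) \<cdot> a"
        using comp_eq_comp[OF overD(4)[OF e_over[OF that(1) u]], of "l ?b"] by simp
    qed simp_all
  qed
  have l_comp: "e (\<pi> \<cdot> b) w \<cdot> l (b \<cdot> w) = l b \<cdot> w"
    if b [simp]: "arr b" "tgt b = L" "\<pi> \<cdot> b \<in> S" "arr w" "tgt w = src b" for b w
    using el[of "\<pi> \<cdot> b" "l b \<cdot> w"] l[OF b(1-3)] comp_eq_arr[OF l(4)[OF b(1-3)], of w] comp_eq_arr[OF l(5)[OF b(1-3)], of w]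
    by simp
  have WS: "\<pi> \<cdot> (b \<cdot> w) \<in> S" if "arr b" "tgt b = L" "\<pi> \<cdot> b \<in> S" "arr w" "tgt w = src b" for b w
    using S_comp[OF that(3,4)] that by simp
  have e_act: "e f g \<cdot> (ac (W (f \<cdot> g)) \<cdot> pair C k a) = ac (W f) \<cdot> pair C k (e f g \<cdot> a)"
    if "f \<in> S" "arr g" "tgt g = src f" "arr k" "arr a" "src k = src a" "tgt k = K" "tgt a = tot (W (f \<cdot> g))"
    for f g k a
    using overD(6)[OF e_over[OF that(1-3)]] that by simp
  \<comment> \<open>The action on points \<open>y = (g, b)\<close> of \<open>G \<times> L\<close> for which the image of \<open>b\<close> in the base lies in \<open>S\<close>.\<close>
  define m where "m y = c (\<pi> \<cdot> (pr2 C K L \<cdot> y)) \<cdot> (ac (W (\<pi> \<cdot> (pr2 C K L \<cdot> y))) \<cdot> pair C (pr1 C K L \<cdot> y) (l (pr2 C K L \<cdot> y)))" for y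
  have SY: "S \<in> \<tau> (tgt (\<pi> \<cdot> pr2 C K L))" "S \<in> \<tau> (tgt \<pi>)" using S by simp_all
  obtain aL where aL [simp]: "arr aL" "src aL = Prod C K L" "tgt aL = L"
    and aLm: "\<And>y. arr y \<Longrightarrow> tgt y = src (\<pi> \<cdot> pr2 C K L) \<Longrightarrow> (\<pi> \<cdot> pr2 C K L) \<cdot> y \<in> S \<Longrightarrow> aL \<cdot> y = m y"
  proof (rule arrow_glue_on_cover[OF SY(1), of L m])
    fix y assume "arr y" "tgt y = src (\<pi> \<cdot> pr2 C K L)" "(\<pi> \<cdot> pr2 C K L) \<cdot> y \<in> S"
    then show "arr (m y) \<and> src (m y) = src y \<and> tgt (m y) = L"
      using l[of "pr2 C K L \<cdot> y"] by (simp add: m_def)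
  next
    fix y w assume A [simp]: "arr y" "tgt y = src (\<pi> \<cdot> pr2 C K L)" and yS: "(\<pi> \<cdot> pr2 C K L) \<cdot> y \<in> S"
      and w [simp]: "arr w" "tgt w = src y"
    define b g where "b = pr2 C K L \<cdot> y" and "g = pr1 C K L \<cdot> y"
    have b [simp]: "arr b" "tgt b = L" "\<pi> \<cdot> b \<in> S" "src b = src y"
      and g [simp]: "arr g" "tgt g = K" "src g = src y" using yS by (simp_all add: b_def g_def)
    let ?f = "\<pi> \<cdot> b"
    note lb = l[OF b(1-3)] 
    have w': "tgt w = src ?f" "tgt w = src b" by simp_all
    note lbw = l[of "b \<cdot> w", OF _ _ WS[OF b(1-3) w(1) w'(2)]]
    note [simp] = lb(1-3)
    have [simp]: "arr (l (b \<cdot> w))" "src (l (b \<cdot> w)) = src w" "tgt (l (b \<cdot> w)) = tot (W (?f \<cdot> w))"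
      using lbw(1-3) by simp_all
    have [simp]: "?f \<cdot> w \<in> S" by (rule S_comp[OF b(3) w(1) w'(1)])
    have "m (y \<cdot> w) = c (?f \<cdot> w) \<cdot> (ac (W (?f \<cdot> w)) \<cdot> pair C (g \<cdot> w) (l (b \<cdot> w)))"
      by (simp add: m_def b_def g_def)
    also have "\<dots> = c ?f \<cdot> (e ?f w \<cdot> (ac (W (?f \<cdot> w)) \<cdot> pair C (g \<cdot> w) (l (b \<cdot> w))))"
      by (rule comp_eq_arr[OF ce[OF b(3) w(1) w'(1)], symmetric]) (simp_all del: comp_assoc)
    also have "\<dots> = c ?f \<cdot> (ac (W ?f) \<cdot> pair C (g \<cdot> w) (l b \<cdot> w))"
      using e_act[OF b(3) w(1) w'(1), of "g \<cdot> w" "l (b \<cdot> w)"] l_comp[OF b(1-3) w(1) w'(2)] by (simp del: comp_assoc)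
    also have "\<dots> = m y \<cdot> w" by (simp add: m_def b_def[symmetric] g_def[symmetric])
    finally show "m (y \<cdot> w) = m y \<cdot> w" .
  qed (simp_all add: that)
  have c_act: "aL \<cdot> pair C g (c f \<cdot> a) = c f \<cdot> (ac (W f) \<cdot> pair C g a)"
    if f [simp]: "f \<in> S" and [simp]: "arr g" "arr a" "src g = src a" "tgt g = K" "tgt a = tot (W f)" for f g a
  proof -
    let ?b = "c f \<cdot> a" and ?u = "pj (W f) \<cdot> a"
    have \<pi>b: "\<pi> \<cdot> ?b = f \<cdot> ?u" by (simp add: \<pi>c_comp)
    have u: "arr ?u" "tgt ?u = src f" by simp_all
    have fu: "f \<cdot> ?u \<in> S" by (rule S_comp[OF f u])
    have bS: "\<pi> \<cdot> ?b \<in> S" unfolding \<pi>b by (rule fu)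
    note lb = l[of ?b, OF _ _ bS, unfolded \<pi>b]
    have [simp]: "arr (l ?b)" "src (l ?b) = src a" "tgt (l ?b) = tot (W (f \<cdot> ?u))"
      using lb by simp_all
    note [simp] = fu
    have "aL \<cdot> pair C g ?b = m (pair C g ?b)" by (rule aLm) (use bS in simp_all)
    also have "\<dots> = c (f \<cdot> ?u) \<cdot> (ac (W (f \<cdot> ?u)) \<cdot> pair C g (l ?b))" by (simp add: m_def \<pi>b)
    also have "\<dots> = c f \<cdot> (e f ?u \<cdot> (ac (W (f \<cdot> ?u)) \<cdot> pair C g (l ?b)))"
      by (rule comp_eq_arr[OF ce[OF f u], symmetric]) simp_all
    also have "\<dots> = c f \<cdot> (ac (W f) \<cdot> pair C g a)"
      using e_act[OF f u, of g "l ?b"] el[of f a] by simp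
    finally show ?thesis .
  qed
  have ext: "h = k" if "arr b" "tgt b = L" "arr h" "arr k" "src h = src b" "src k = src b" "tgt h = tgt k"
    "\<And>w f s. arr w \<Longrightarrow> tgt w = src b \<Longrightarrow> f \<in> S \<Longrightarrow> arr s \<Longrightarrow> src s = src w \<Longrightarrow> tgt s = tot (W f)
       \<Longrightarrow> b \<cdot> w = c f \<cdot> s \<Longrightarrow> h \<cdot> w = k \<cdot> w" for b h k
  proof (rule arrow_ext_on_cover[of S "\<pi> \<cdot> b"])
    fix w assume w: "arr w" "tgt w = src (\<pi> \<cdot> b)" "(\<pi> \<cdot> b) \<cdot> w \<in> S"
    then show "h \<cdot> w = k \<cdot> w" using that(1,2) l[of "b \<cdot> w"] by (intro that(8)[of w "\<pi> \<cdot> (b \<cdot> w)" "l (b \<cdot> w)"]) simp_all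
  qed (use that S in simp_all)
  have \<pi>_inv: "\<pi> \<cdot> (aL \<cdot> pair C g b) = \<pi> \<cdot> b"
    if [simp]: "arr g" "arr b" "src g = src b" "tgt g = K" "tgt b = L" for g b
  proof (rule ext[of b])
    fix w f s assume A [simp]: "arr w" "tgt w = src b" "f \<in> S" "arr s" "src s = src w" "tgt s = tot (W f)"
      and bw: "b \<cdot> w = c f \<cdot> s"
    show "(\<pi> \<cdot> (aL \<cdot> pair C g b)) \<cdot> w = (\<pi> \<cdot> b) \<cdot> w" by (simp add: bw c_act \<pi>c_comp)
  qed simp_all
  have act_assoc: "aL \<cdot> pair C g (aL \<cdot> pair C h b) = aL \<cdot> pair C (Gmult G \<cdot> pair C g h) b"
    if [simp]: "arr g" "arr h" "arr b" "src g = src b" "src h = src b" "tgt g = K" "tgt h = K" "tgt b = L" for g h b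
  proof (rule ext[of b])
    fix w f s assume A [simp]: "arr w" "tgt w = src b" "f \<in> S" "arr s" "src s = src w" "tgt s = tot (W f)"
      and bw: "b \<cdot> w = c f \<cdot> s"
    show "(aL \<cdot> pair C g (aL \<cdot> pair C h b)) \<cdot> w = (aL \<cdot> pair C (Gmult G \<cdot> pair C g h) b) \<cdot> w"
      by (simp add: bw c_act G_object_act_assoc)
  qed simp_all
  have act_unit: "aL \<cdot> pair C (Gunit G \<cdot> to_Term C (src b)) b = b" if [simp]: "arr b" "tgt b = L" for b
  proof (rule ext[of b])
    fix w f s assume A [simp]: "arr w" "tgt w = src b" "f \<in> S" "arr s" "src s = src w" "tgt s = tot (W f)"
      and bw: "b \<cdot> w = c f \<cdot> s"
    show "(aL \<cdot> pair C (Gunit G \<cdot> to_Term C (src b)) b) \<cdot> w = b \<cdot> w"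
      using G_object_act_unit[of "fst (W f)" s] by (simp add: bw c_act)
  qed simp_all
  have e_snd: "snd (W (f \<cdot> g)) = snd (W f) \<cdot> e f g" if "f \<in> S" "arr g" "tgt g = src f" for f g
    using overD(5)[OF e_over[OF that]] by simp
  obtain \<alpha> where \<alpha> [simp]: "arr \<alpha>" "src \<alpha> = L" "tgt \<alpha> = X"
    and \<alpha>l: "\<And>b. arr b \<Longrightarrow> tgt b = src \<pi> \<Longrightarrow> \<pi> \<cdot> b \<in> S \<Longrightarrow> \<alpha> \<cdot> b = snd (W (\<pi> \<cdot> b)) \<cdot> l b"
  proof (rule arrow_glue_on_cover[OF SY(2), of X "\<lambda>b. snd (W (\<pi> \<cdot> b)) \<cdot> l b"])
    fix b assume "arr b" "tgt b = src \<pi>" "\<pi> \<cdot> b \<in> S"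
    then show "arr (snd (W (\<pi> \<cdot> b)) \<cdot> l b) \<and> src (snd (W (\<pi> \<cdot> b)) \<cdot> l b) = src b \<and> tgt (snd (W (\<pi> \<cdot> b)) \<cdot> l b) = X"
      using l[of b] by simp
  next
    fix b w assume A: "arr b" "tgt b = src \<pi>" "\<pi> \<cdot> b \<in> S" and w: "arr w" "tgt w = src b"
    have b: "tgt b = L" and w': "tgt w = src (\<pi> \<cdot> b)" using A w by simp_all
    note [simp] = A(1) b A(3) w l(1-3)[OF A(1) b A(3)]
    have bwS: "\<pi> \<cdot> (b \<cdot> w) \<in> S" by (rule WS[OF A(1) b A(3) w])
    note lbw = l[of "b \<cdot> w", OF _ _ bwS]
    have "snd (W (\<pi> \<cdot> (b \<cdot> w))) \<cdot> l (b \<cdot> w) = snd (W (\<pi> \<cdot> b)) \<cdot> (e (\<pi> \<cdot> b) w \<cdot> l (b \<cdot> w))"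
      using e_snd[OF A(3) w(1) w'] e_simps[OF A(3) w(1) w'] lbw w(2) by simp
    then show "snd (W (\<pi> \<cdot> (b \<cdot> w))) \<cdot> l (b \<cdot> w) = (snd (W (\<pi> \<cdot> b)) \<cdot> l b) \<cdot> w"
      using l_comp[OF A(1) b A(3) w] by simp
  qed (simp_all add: that)
  have \<alpha>c: "\<alpha> \<cdot> (c f \<cdot> a) = snd (W f) \<cdot> a" if f [simp]: "f \<in> S" and a [simp]: "arr a" "tgt a = tot (W f)" for f a
  proof -
    let ?b = "c f \<cdot> a" and ?u = "pj (W f) \<cdot> a"
    have \<pi>b: "\<pi> \<cdot> ?b = f \<cdot> ?u" by (simp add: \<pi>c_comp)
    have u: "arr ?u" "tgt ?u = src f" by simp_all
    have bS: "\<pi> \<cdot> ?b \<in> S" unfolding \<pi>b by (rule S_comp[OF f u])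
    note lb = l[of ?b, OF _ _ bS, unfolded \<pi>b]
    have "\<alpha> \<cdot> ?b = snd (W (f \<cdot> ?u)) \<cdot> l ?b" using \<alpha>l[of ?b] bS by (simp add: \<pi>b)
    also have "\<dots> = snd (W f) \<cdot> (e f ?u \<cdot> l ?b)"
      unfolding e_snd[OF f u] using e_simps[OF f u] lb by simp
    finally show ?thesis using el[OF f a] by simp
  qed
  have \<alpha>_equiv: "\<alpha> \<cdot> (aL \<cdot> pair C g b) = x \<cdot> pair C g (\<alpha> \<cdot> b)"
    if [simp]: "arr g" "arr b" "src g = src b" "tgt g = K" "tgt b = L" for g b
  proof (rule ext[of b])
    fix w f s assume A [simp]: "arr w" "tgt w = src b" "f \<in> S" "arr s" "src s = src w" "tgt s = tot (W f)"
      and bw: "b \<cdot> w = c f \<cdot> s"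
    have "snd (W f) \<cdot> (ac (W f) \<cdot> pair C (g \<cdot> w) s) = x \<cdot> pair C (g \<cdot> w) (snd (W f) \<cdot> s)"
      using W[OF A(3)] by (simp add: qobj_iff)
    then show "(\<alpha> \<cdot> (aL \<cdot> pair C g b)) \<cdot> w = (x \<cdot> pair C g (\<alpha> \<cdot> b)) \<cdot> w" by (simp add: bw c_act \<alpha>c)
  qed simp_all
  define P where "P = \<lparr>total = L, act = aL, proj = \<pi>\<rparr>"
  have P [simp]: "total P = L" "act P = aL" "proj P = \<pi>" by (simp_all add: P_def)
  have fam: "G_object P"
    by (rule G_objectI) (use act_assoc act_unit \<pi>_inv in \<open>simp_all add: action_iff\<close>)
  have c_equiv: "equivariant C G (tot (W f)) (ac (W f)) (total P) (act P) (c f)" if "f \<in> S" for f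
    using that c_act by (simp add: equivariant_iff)
  have "principal_bundle \<kappa> C \<tau> G Y P"
  proof (rule principal_local[OF fam _ S])
    fix f assume "f \<in> S"
    then show "\<exists>Q c. principal_bundle \<kappa> C \<tau> G (src f) Q \<and>
      is_pullback C (proj P) f (total Q) c (proj Q) \<and> equivariant C G (total Q) (act Q) (total P) (act P) c"
      using c_cart[of f] c_equiv[of f] W[of f] by (intro exI[of _ "fst (W f)"] exI[of _ "c f"]) (simp add: qobj_iff)
  qed simp
  then have V: "(P, \<alpha>) \<in> qobj Y" using \<alpha>_equiv by (simp add: qobj_iff)
  have c_over: "over f (W f) (c f) (P, \<alpha>)" if "f \<in> S" for f
    using that \<pi>c[OF that] \<alpha>c[of f "Ident C (tot (W f))"] c_act[of f] by (simp add: over_def)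
  \<comment> \<open>Both \<open>W f\<close> and \<open>f\<^sup>*V\<close>, for \<open>V = (P, \<alpha>)\<close>, are pullbacks of \<open>P\<close> along \<open>f\<close>; the comparison is the
    required isomorphism.\<close>
  define \<chi> where "\<chi> f = lift C \<pi> f (c f) (pj (W f))" for f
  have \<chi> [simp]: "arr (\<chi> f)" "src (\<chi> f) = tot (W f)" "tgt (\<chi> f) = pb C \<pi> f"
    "pb1 C \<pi> f \<cdot> \<chi> f = c f" "pb2 C \<pi> f \<cdot> \<chi> f = pj (W f)" if "f \<in> S" for f
    using that \<pi>c[OF that] by (simp_all add: \<chi>_def)
  have \<chi>_mor: "qmor (W f) (\<chi> f) (pullq f (P, \<alpha>))" if "f \<in> S" for f
    using qmor_lift[OF V _ _ W[OF that] c_over[OF that]] that by (simp add: \<chi>_def)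
  have \<chi>_iso: "iso_arrow C (\<chi> f)" if f: "f \<in> S" for f
    by (rule pullback_comparison_iso[OF c_cart[OF f] pb]) (use f in simp_all)
  define \<psi> where "\<psi> f = inv_arrow C (\<chi> f)" for f
  have \<psi>_inv: "inverse_arrows C (\<chi> f) (\<psi> f)" if "f \<in> S" for f
    unfolding \<psi>_def by (rule inverse_arrows_inv_arrow[OF \<chi>_iso[OF that]])
  have \<psi> [simp]: "arr (\<psi> f)" "src (\<psi> f) = pb C \<pi> f" "tgt (\<psi> f) = tot (W f)" "\<chi> f \<cdot> \<psi> f = Ident C (pb C \<pi> f)" if "f \<in> S" for f
    using \<psi>_inv[OF that] that by (simp_all add: inverse_arrows_def Hom_iff)
  have c\<psi>: "c f \<cdot> \<psi> f = pb1 C \<pi> f" and p\<psi>: "pj (W f) \<cdot> \<psi> f = pb2 C \<pi> f" if "f \<in> S" for f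
    using that comp_eq_arr[OF \<chi>(4)[OF that], of "\<psi> f"] comp_eq_arr[OF \<chi>(5)[OF that], of "\<psi> f"] by simp_all
  have \<psi>': "inverse_arrows (qfib (src f)) (W f, \<chi> f, pullq f (P, \<alpha>)) (pullq f (P, \<alpha>), \<psi> f, W f)" if "f \<in> S" for f
    using qfib_inverse_iff[OF W[OF that] pullq_obj[OF V] \<chi>_mor[OF that]] \<psi>_inv[OF that] that by simp
  have \<psi>_mor: "qmor (pullq f (P, \<alpha>)) (\<psi> f) (W f)" if "f \<in> S" for f
    using \<psi>'[OF that] by (simp add: inverse_arrows_def qfib_Hom_iff)
  have \<psi>_iso: "iso_arrow (qfib (src f)) (pullq f (P, \<alpha>), \<psi> f, W f)" if "f \<in> S" for f
  proof (rule qfib_iso[OF _ W[OF that] \<psi>_mor[OF that]])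
    show "pullq f (P, \<alpha>) \<in> qobj (src f)" using pullq_obj[OF V] that by simp
    show "iso_arrow C (\<psi> f)"
      unfolding iso_arrow_def using \<psi>_inv[OF that] that by (intro exI[of _ "\<chi> f"]) (simp add: inverse_arrows_def Hom_iff)
  qed
  have compat: "\<phi> f g \<cdot> pull_arr g (pullq f (P, \<alpha>)) (\<psi> f) (W f) = \<psi> (f \<cdot> g) \<cdot> coh_arr f g (P, \<alpha>)"
    if f: "f \<in> S" and g: "arr g" "tgt g = src f" for f g
  proof -
    note [simp] = f g
    have f': "arr f" "tgt f = Y" and fg: "f \<cdot> g \<in> S" by simp_all
    note 1 = \<phi>_simps[OF f g] and 2 = coh_arr_simps[OF V f' g]
    note 3 = pull_arr_simps[OF pullq_obj[OF V f'] W[OF f] \<psi>_mor[OF f] g]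
    let ?p = "pull_arr g (pullq f (P, \<alpha>)) (\<psi> f) (W f)" and ?c = "coh_arr f g (P, \<alpha>)"
    have [simp]: "arr ?c" "src ?c = pb C (pb2 C \<pi> f) g" "tgt ?c = pb C \<pi> (f \<cdot> g)" using 2(1-3) by simp_all
    have [simp]: "arr ?p" "src ?p = pb C (pb2 C \<pi> f) g" "tgt ?p = pb C (pj (W f)) g" using 3(1-3) by simp_all
    note [simp] = 1(1-3)
    show ?thesis
    proof (rule c_ext[OF fg])
      have "c (f \<cdot> g) \<cdot> (\<phi> f g \<cdot> ?p) = c f \<cdot> (e f g \<cdot> (\<phi> f g \<cdot> ?p))"
        by (rule comp_eq_arr[OF ce[OF f g], symmetric]) simp_all
      also have "e f g \<cdot> (\<phi> f g \<cdot> ?p) = \<psi> f \<cdot> pb1 C (pb2 C \<pi> f) g"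
        using comp_eq_arr[OF e_\<phi>[OF f g], of ?p] 3(4) by simp
      also have "c f \<cdot> \<dots> = pb1 C \<pi> f \<cdot> pb1 C (pb2 C \<pi> f) g"
        by (rule comp_eq_arr[OF c\<psi>[OF f]]) simp_all
      also have "\<dots> = pb1 C \<pi> (f \<cdot> g) \<cdot> ?c" using 2(4) by simp
      also have "\<dots> = c (f \<cdot> g) \<cdot> (\<psi> (f \<cdot> g) \<cdot> ?c)"
        by (rule comp_eq_arr[OF c\<psi>[OF fg], symmetric]) simp_all
      finally show "c (f \<cdot> g) \<cdot> (\<phi> f g \<cdot> ?p) = c (f \<cdot> g) \<cdot> (\<psi> (f \<cdot> g) \<cdot> ?c)" .
      have "pj (W (f \<cdot> g)) \<cdot> (\<phi> f g \<cdot> ?p) = pb2 C (pb2 C \<pi> f) g"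
        using comp_eq_arr[OF 1(4), of ?p] 3(5) by simp
      also have "\<dots> = pj (W (f \<cdot> g)) \<cdot> (\<psi> (f \<cdot> g) \<cdot> ?c)"
        using comp_eq_arr[OF p\<psi>[OF fg], of ?c] 2(5) by simp
      finally show "pj (W (f \<cdot> g)) \<cdot> (\<phi> f g \<cdot> ?p) = pj (W (f \<cdot> g)) \<cdot> (\<psi> (f \<cdot> g) \<cdot> ?c)" .
    qed simp_all
  qed
  show ?thesis
    unfolding effective_def
  proof (intro exI[of _ "(P, \<alpha>)"] exI[of _ "\<lambda>f. (pullq f (P, \<alpha>), \<psi> f, W f)"] conjI ballI impI)
    show "(P, \<alpha>) \<in> Obj (fib XG Y)" using V by simp
  next
    fix f assume f: "f \<in> S"
    show "(pullq f (P, \<alpha>), \<psi> f, W f) \<in> Hom (fib XG (src f)) (omap (pull XG f) (P, \<alpha>)) (W f)"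
      using W[OF f] pullq_obj[OF V] \<psi>_mor[OF f] f by (simp add: qfib_Hom_iff)
    show "iso_arrow (fib XG (src f)) (pullq f (P, \<alpha>), \<psi> f, W f)" using \<psi>_iso[OF f] by simp
  next
    fix f g assume "f \<in> S" "arr g" "tgt g = src f"
    then show "Comp (fib XG (src g)) (\<Phi> f g) (amap (pull XG g) (pullq f (P, \<alpha>), \<psi> f, W f))
       = Comp (fib XG (src g)) (pullq (f \<cdot> g) (P, \<alpha>), \<psi> (f \<cdot> g), W (f \<cdot> g)) (coh XG f g (P, \<alpha>))"
      using \<phi>(1)[of f g] compat[of f g] by simp
  qed
qed

end

lemma (in quotient) effective_descent: "effective_descent C \<tau> XG"
  unfolding effective_descent_def
proof (intro ballI allI impI)
  fix Y S W \<Phi> assume "Y \<in> Obj C" "S \<in> \<tau> Y" "descent_datum C XG S W \<Phi>"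
  then interpret quotient_descent C \<kappa> \<tau> G X x Y S W \<Phi> by unfold_locales
  show "effective C XG Y S W \<Phi>" by (rule effective)
qed

theorem theorem1p1:
  fixes \<kappa> :: "'k rel"
    and C :: "('o, 'a) pcat"
    and \<tau> :: "'o \<Rightarrow> 'a set set"
    and G :: "('o, 'a) grp"
    and X :: 'o
    and x :: 'a
  assumes "smallness_cardinal \<kappa>"
    and "pullback_category C"
    and "cocomplete \<kappa> C"
    and "pullbacks_preserve_colimits \<kappa> C"
    and "site \<kappa> C \<tau>"
    and "subcanonical C \<tau>"
    and "group_object C G"
    and "action C G X x"
  shows "is_stack \<kappa> C \<tau> (quotient_prestack \<kappa> C \<tau> G X x)"
proof -
  interpret quotient C \<kappa> \<tau> G X x
    using assms by (simp add: quotient_def quotient_axioms_def principal_bundles_def descent_site_def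
        descent_site_axioms_def subcanonical_site_def subcanonical_site_axioms_def group_in_category_def
        group_in_category_axioms_def)
  show ?thesis
    unfolding is_stack_def using prestack effective_descent glue separated by blast
qed

end
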